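(* Let $n\ge 2$ and $d\ge 1$ be integers. There is an (explicitly computable) constant $c(n,d)>0$ depending only on $n$ and $d$ with the following property. Let $F\in\mathbb{Z}[X_1,\ldots,X_n]$ be a decomposable form of degree $d$ in $n$ variables. If $V(F)$ is finite and $F$ does not vanish at any nonzero integral point (i.e. $F(\mathbf{x})\neq 0$ for all $\mathbf{x}\in\mathbb{Z}^n\setminus\{\mathbf 0\}$), then $V(F)\le c(n,d)$.
   Context: A decomposable form of degree $d$ in $n$ variables is a homogeneous polynomial of degree $d$ that factors as $F(\mathbf{X})=\prod_{i=1}^d L_i(\mathbf{X})$, where each $L_i(\mathbf X)\in\mathbb{C}[X_1,\ldots,X_n]$ is a nonzero homogeneous linear form. $V(F)$ denotes the $n$-dimensional volume (Lebesgue measure) of the set $\{\mathbf{x}\in\mathbb{R}^n : |F(\mathbf{x})|\le 1\}$. *)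

theory Defs
  imports "HOL-Analysis.Analysis" "HOL-Library.Poly_Mapping"
begin

(* The type (nat =>0 nat) =>0 'a is the monoid algebra over the exponent vectors, i.e. the ring of
   polynomials over 'a in the variables X_0, X_1, ...; its multiplication is convolution. *)
type_synonym 'a mpoly = "(nat \<Rightarrow>\<^sub>0 nat) \<Rightarrow>\<^sub>0 'a"

definition eval_mpoly :: "'a::comm_semiring_1 mpoly \<Rightarrow> (nat \<Rightarrow> 'a) \<Rightarrow> 'a" where
  "eval_mpoly p x =
     (\<Sum>m\<in>Poly_Mapping.keys p. Poly_Mapping.lookup p m *
       (\<Prod>i\<in>Poly_Mapping.keys m. x i ^ Poly_Mapping.lookup m i))"

definition of_int_mpoly :: "int mpoly \<Rightarrow> 'a::comm_ring_1 mpoly" where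
  "of_int_mpoly p = Poly_Mapping.map of_int p"

(* A form in n variables uses only X_0, ..., X_{n-1}. The zero polynomial is a form of every
   degree. *)
definition is_form :: "nat \<Rightarrow> nat \<Rightarrow> 'a::zero mpoly \<Rightarrow> bool" where
  "is_form n d p \<longleftrightarrow>
     (\<forall>m\<in>Poly_Mapping.keys p. Poly_Mapping.keys m \<subseteq> {..<n} \<and>
        (\<Sum>i\<in>Poly_Mapping.keys m. Poly_Mapping.lookup m i) = d)"

definition decomposable_form :: "nat \<Rightarrow> nat \<Rightarrow> int mpoly \<Rightarrow> bool" where
  "decomposable_form n d F \<longleftrightarrow>
     is_form n d F \<and>
     (\<exists>L :: nat \<Rightarrow> complex mpoly.
        (\<forall>i<d. is_form n 1 (L i) \<and> L i \<noteq> 0) \<and> of_int_mpoly F = (\<Prod>i<d. L i))"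

(* R^n is modelled by the product of n copies of the real line, so that n can be a variable. *)
definition form_volume :: "nat \<Rightarrow> int mpoly \<Rightarrow> ennreal" where
  "form_volume n F =
     (let M = Pi\<^sub>M {..<n} (\<lambda>_. lborel :: real measure)
      in emeasure M {x \<in> space M. \<bar>eval_mpoly (of_int_mpoly F) x\<bar> \<le> 1})"

(* Total recursive functions, generated by the initial functions, composition, primitive recursion
   and minimization of regular functions. A k-ary function is represented by a function on lists,
   of which only the values on lists of length k matter. *)
inductive recursive_fun :: "(nat list \<Rightarrow> nat) \<Rightarrow> bool" where
  zero: "recursive_fun (\<lambda>_. 0)"
| succ: "recursive_fun (\<lambda>xs. case xs of [] \<Rightarrow> 0 | x # _ \<Rightarrow> Suc x)"
| proj: "recursive_fun (\<lambda>xs. if i < length xs then xs ! i else 0)"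
| comp: "recursive_fun g \<Longrightarrow> (\<And>f. f \<in> set fs \<Longrightarrow> recursive_fun f) \<Longrightarrow>
    recursive_fun (\<lambda>xs. g (map (\<lambda>f. f xs) fs))"
| prec: "recursive_fun f \<Longrightarrow> recursive_fun g \<Longrightarrow>
    recursive_fun (\<lambda>xs. case xs of [] \<Rightarrow> 0
      | x # ys \<Rightarrow> rec_nat (f ys) (\<lambda>k r. g (r # k # ys)) x)"
| minim: "recursive_fun f \<Longrightarrow> (\<And>xs. \<exists>y. f (y # xs) = 0) \<Longrightarrow>
    recursive_fun (\<lambda>xs. LEAST y. f (y # xs) = 0)"

(* The real numbers c n d are computable uniformly in n and d: rational approximations to within
   1/(k+1) can be computed from n, d and k. *)
definition computable_real2 :: "(nat \<Rightarrow> nat \<Rightarrow> real) \<Rightarrow> bool" where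
  "computable_real2 c \<longleftrightarrow>
     (\<exists>p q. recursive_fun p \<and> recursive_fun q \<and>
        (\<forall>n d k. \<bar>c n d - (real (p [n, d, k]) - real (q [n, d, k])) / real (k + 1)\<bar>
                  \<le> 1 / real (k + 1)))"

end

(* Write the form as a product of d complex linear forms L_i. By symmetric function theory a suitably
   weighted product of all nonzero n x n minors of (L_i) is a nonzero rational number with a controlled
   denominator, hence bounded below. For v in Z^d let B(v) be the set where |L_i| <= exp(v_i) for all i.
   Its volume w is at most 4^n exp(v_I) / |det L_I| for every basis I, where v_I is the sum of v over I.
   Since the form does not vanish at nonzero integral points, Minkowski's theorem supplies an integral
   point z in a dilate of B(v) by a factor of order w^(-1/n); normalizing the forms to take the value 1
   at z makes the arithmetic bound depend only on w. Together these confine log |det L_I| - v_I to an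
   interval of length O(1 + log(1/w)), for all I simultaneously. If this did not confine v itself, the
   basis exchange property would split R^n into two parts on which the form decouples, and rescaling
   the parts against each other would show that the volume is infinite. Hence the volumes of the B(v)
   decay exponentially in v, and they sum to an explicit bound. *)
theory Submission
  imports Defs "Jordan_Normal_Form.Determinant"
begin

unbundle no vec_syntax
unbundle no fps_syntax
hide_const (open) Determinants.det
hide_const (open) Finite_Cartesian_Product.mat
section \<open>Determinants\<close>

text \<open>The bound must not depend on F, while the numbers log |det L_I| can be arbitrarily
  large. So two boxes are always compared: in v - w the determinants cancel, and the decay is
  measured from a box w of largest volume, whose own position is never controlled. The linear
  factors are determined only up to scalars and their coefficients carry no integrality; only F
  does. Restricting F to lines through z transfers its integrality to the ratios of the values of a
  factor, with F(z) as common denominator. No Galois group enters: symmetry is forced by summing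
  over all permutations of the d factors, so repeated or reducible factors cause no trouble. The
  rescaling that proves infinite volume has to be a real map, so the partition of the forms must
  respect complex conjugation. It does so because only vectors v coming from points with |F| <= 1
  are used: on a conjugate pair of forms the entries of v - w nearly agree, and the gap in the
  values is taken wide enough to absorb the error.\<close>

definition fdet :: "nat \<Rightarrow> (nat \<Rightarrow> nat \<Rightarrow> 'a::comm_ring_1) \<Rightarrow> 'a" where
  "fdet n A = det (Matrix.mat n n (\<lambda>(i,j). A i j))"

lemma fdet_cong:
  assumes "\<And>i j. i < n \<Longrightarrow> j < n \<Longrightarrow> A i j = B i j"
  shows "fdet n A = fdet n B"
proof -
  have "Matrix.mat n n (\<lambda>(i,j). A i j) = Matrix.mat n n (\<lambda>(i,j). B i j)"
    using assms by (intro eq_matI) auto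
  then show ?thesis by (simp add: fdet_def)
qed

lemma fdet_expand:
  "fdet n A = (\<Sum>p | p permutes {0..<n}. signof p * (\<Prod>i<n. A i (p i)))"
proof -
  have "fdet n A = (\<Sum>p | p permutes {0..<n}. signof p * (\<Prod>i = 0..<n. Matrix.mat n n (\<lambda>(i,j). A i j) $$ (i, p i)))"
    unfolding fdet_def by (rule det_def') auto
  also have "\<dots> = (\<Sum>p | p permutes {0..<n}. signof p * (\<Prod>i<n. A i (p i)))"
  proof (rule sum.cong[OF refl])
    fix p assume "p \<in> {p. p permutes {0..<n}}"
    then have "p i < n" if "i < n" for i
      using that permutes_in_image[of p "{0..<n}" i] by auto
    then show "signof p * (\<Prod>i = 0..<n. Matrix.mat n n (\<lambda>(i,j). A i j) $$ (i, p i)) =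
        signof p * (\<Prod>i<n. A i (p i))"
      by (auto simp: lessThan_atLeast0 intro!: prod.cong arg_cong2[of _ _ _ _ "(*)"])
  qed
  finally show ?thesis .
qed

lemma fdet_id: "fdet n (\<lambda>i j. if i = j then 1 else 0) = (1 :: 'a :: comm_ring_1)"
proof -
  have "Matrix.mat n n (\<lambda>(i,j). if i = j then 1 else 0) = (1\<^sub>m n :: 'a mat)" by (intro eq_matI) auto
  then show ?thesis unfolding fdet_def by (simp only: det_one)
qed

lemma fdet_multrow:
  assumes "k < n"
  shows "fdet n (A(k := \<lambda>j. c * A k j)) = c * fdet n A"
proof -
  have "Matrix.mat n n (\<lambda>(i,j). (A(k := \<lambda>j. c * A k j)) i j) = multrow k c (Matrix.mat n n (\<lambda>(i,j). A i j))"
    by (intro eq_matI) auto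
  then show ?thesis using det_multrow[OF assms, of "Matrix.mat n n (\<lambda>(i,j). A i j)" c] by (simp add: fdet_def)
qed

lemma fdet_addrow:
  assumes "k < n" "l < n" "k \<noteq> l"
  shows "fdet n (A(k := \<lambda>j. A k j + c * A l j)) = fdet n A"
proof -
  have "Matrix.mat n n (\<lambda>(i,j). (A(k := \<lambda>j. A k j + c * A l j)) i j)
      = addrow c k l (Matrix.mat n n (\<lambda>(i,j). A i j))"
    using assms by (intro eq_matI) auto
  then show ?thesis using det_addrow[OF assms(2,3), of "Matrix.mat n n (\<lambda>(i,j). A i j)" c] by (simp add: fdet_def)
qed

lemma fdet_row_add:
  assumes "k < n"
  shows "fdet n (A(k := \<lambda>j. u j + v j)) = fdet n (A(k := u)) + fdet n (A(k := v))"
proof -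
  have *: "(\<Prod>i<n. (A(k := w)) i (p i)) = w (p k) * (\<Prod>i\<in>{..<n} - {k}. A i (p i))" for w p
    using assms by (subst prod.remove[of _ k]) (auto intro!: prod.cong)
  show ?thesis
    unfolding fdet_expand * by (simp add: sum.distrib[symmetric] algebra_simps)
qed

lemma fdet_scale: "fdet n (\<lambda>i j. c * A i j) = c ^ n * fdet n A"
  unfolding fdet_expand
  by (simp add: prod.distrib sum_distrib_left mult_ac)

lemma fdet_row_scale: "fdet n (\<lambda>i j. c i * A i j) = (\<Prod>i<n. c i) * fdet n A"
  unfolding fdet_expand
  by (simp add: prod.distrib sum_distrib_left mult_ac)

lemma fdet_of_real: "fdet n (\<lambda>i j. of_real (A i j)) = (of_real (fdet n A) :: 'a :: {comm_ring_1,real_algebra_1})"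
  unfolding fdet_expand by (auto simp: sign_def intro!: sum.cong)

lemma fdet_eq_0_iff:
  fixes A :: "nat \<Rightarrow> nat \<Rightarrow> 'a :: field"
  shows "fdet n A = 0 \<longleftrightarrow> (\<exists>x. (\<exists>j<n. x j \<noteq> 0) \<and> (\<forall>i<n. (\<Sum>j<n. A i j * x j) = 0))"
proof -
  let ?M = "Matrix.mat n n (\<lambda>(i,j). A i j)"
  have M: "?M \<in> carrier_mat n n" by auto
  have mv: "?M *\<^sub>v vec n x = 0\<^sub>v n \<longleftrightarrow> (\<forall>i<n. (\<Sum>j<n. A i j * x j) = 0)" for x
    by (auto simp: vec_eq_iff scalar_prod_def lessThan_atLeast0)
  have v0: "vec n x \<noteq> 0\<^sub>v n \<longleftrightarrow> (\<exists>j<n. x j \<noteq> 0)" for x :: "nat \<Rightarrow> 'a"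
    by (auto simp: vec_eq_iff)
  show ?thesis
  proof
    assume "fdet n A = 0"
    then obtain v where v: "v \<in> carrier_vec n" "v \<noteq> 0\<^sub>v n" "?M *\<^sub>v v = 0\<^sub>v n"
      unfolding fdet_def det_0_iff_vec_prod_zero_field[OF M] by auto
    have "vec n (vec_index v) = v" using v(1) by auto
    then show "\<exists>x. (\<exists>j<n. x j \<noteq> 0) \<and> (\<forall>i<n. (\<Sum>j<n. A i j * x j) = 0)"
      using v mv[of "vec_index v"] v0[of "vec_index v"] by auto
  next
    assume "\<exists>x. (\<exists>j<n. x j \<noteq> 0) \<and> (\<forall>i<n. (\<Sum>j<n. A i j * x j) = 0)"
    then obtain x where "vec n x \<noteq> 0\<^sub>v n" "?M *\<^sub>v vec n x = 0\<^sub>v n" using mv v0 by auto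
    then show "fdet n A = 0" unfolding fdet_def det_0_iff_vec_prod_zero_field[OF M]
      by (intro exI[of _ "vec n x"]) auto
  qed
qed

lemma fdet_inverse:
  fixes A :: "nat \<Rightarrow> nat \<Rightarrow> 'a :: field"
  assumes "fdet n A \<noteq> 0"
  obtains B where "\<And>i j. i < n \<Longrightarrow> j < n \<Longrightarrow> (\<Sum>k<n. A i k * B k j) = (if i = j then 1 else 0)"
    "\<And>i j. i < n \<Longrightarrow> j < n \<Longrightarrow> (\<Sum>k<n. B i k * A k j) = (if i = j then 1 else 0)"
proof -
  let ?M = "Matrix.mat n n (\<lambda>(i,j). A i j)"
  have M: "?M \<in> carrier_mat n n" by auto
  have "?M \<in> Units (ring_mat TYPE('a) n undefined)"
    by (rule det_non_zero_imp_unit[OF M]) (use assms in \<open>simp add: fdet_def\<close>)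
  then obtain N where N: "N \<in> carrier_mat n n" "N * ?M = 1\<^sub>m n" "?M * N = 1\<^sub>m n"
    by (auto simp: Units_def ring_mat_def)
  show ?thesis
  proof (rule that[of "\<lambda>i j. N $$ (i,j)"])
    fix i j assume ij: "i < n" "j < n"
    have "(?M * N) $$ (i,j) = (\<Sum>k<n. A i k * N $$ (k,j))"
      using ij N(1) by (auto simp: scalar_prod_def lessThan_atLeast0)
    then show "(\<Sum>k<n. A i k * N $$ (k,j)) = (if i = j then 1 else 0)" using N(3) ij by simp
    have "(N * ?M) $$ (i,j) = (\<Sum>k<n. N $$ (i,k) * A k j)"
      using ij N(1) by (auto simp: scalar_prod_def lessThan_atLeast0)
    then show "(\<Sum>k<n. N $$ (i,k) * A k j) = (if i = j then 1 else 0)" using N(2) ij by simp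
  qed
qed

lemma fdet_add_rows:
  assumes "finite S" "S \<subseteq> {..<n} - {k}" "k < n"
  shows "fdet n (A(k := \<lambda>j. A k j + (\<Sum>l\<in>S. c l * A l j))) = fdet n A"
  using assms
proof (induction S rule: finite_induct)
  case (insert x S)
  let ?A = "A(k := \<lambda>j. A k j + (\<Sum>l\<in>S. c l * A l j))"
  have "fdet n (?A(k := \<lambda>j. ?A k j + c x * ?A x j)) = fdet n ?A"
    using insert by (intro fdet_addrow) auto
  moreover have "?A(k := \<lambda>j. ?A k j + c x * ?A x j) = A(k := \<lambda>j. A k j + (\<Sum>l\<in>insert x S. c l * A l j))"
    using insert by (auto simp: fun_eq_iff algebra_simps)
  moreover have "fdet n ?A = fdet n A" using insert by blast
  ultimately show ?case by metis
qed simp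

text \<open>Row operations remove the contributions of all rows but row k. This expresses the
  coordinates of a form in a basis of forms by the minors in which one basis element has been
  exchanged.\<close>

lemma fdet_cramer:
  assumes "k < n" "\<And>j. j < n \<Longrightarrow> b j = (\<Sum>l<n. c l * A l j)"
  shows "fdet n (A(k := b)) = c k * fdet n A"
proof -
  let ?A = "A(k := \<lambda>j. c k * A k j)"
  have "fdet n (A(k := b)) = fdet n (?A(k := \<lambda>j. ?A k j + (\<Sum>l\<in>{..<n} - {k}. c l * ?A l j)))"
  proof (rule fdet_cong)
    fix i j assume "i < n" "j < n"
    then show "(A(k := b)) i j = (?A(k := \<lambda>j. ?A k j + (\<Sum>l\<in>{..<n} - {k}. c l * ?A l j))) i j"
      using assms by (auto simp: sum.remove[of _ k])
  qed
  also have "\<dots> = fdet n ?A" using assms(1) by (intro fdet_add_rows) auto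
  also have "\<dots> = c k * fdet n A" by (rule fdet_multrow[OF assms(1)])
  finally show ?thesis .
qed

section \<open>Linear changes of variables\<close>

definition real_space :: "nat \<Rightarrow> (nat \<Rightarrow> real) measure" where
  "real_space n = Pi\<^sub>M {..<n} (\<lambda>_. lborel)"

definition mat_act :: "nat \<Rightarrow> (nat \<Rightarrow> nat \<Rightarrow> real) \<Rightarrow> (nat \<Rightarrow> real) \<Rightarrow> nat \<Rightarrow> real" where
  "mat_act n A x = (\<lambda>i\<in>{..<n}. \<Sum>j<n. A i j * x j)"

interpretation lborel_product: product_sigma_finite "\<lambda>_::nat. lborel :: real measure"
  by standard

lemma space_real_space: "space (real_space n) = {..<n} \<rightarrow>\<^sub>E UNIV"
  by (simp add: real_space_def space_PiM)

lemma measurable_real_space_component [measurable]: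
  "j < n \<Longrightarrow> (\<lambda>x. x j) \<in> borel_measurable (real_space n)"
  unfolding real_space_def using measurable_component_singleton[of j "{..<n}" "\<lambda>_. lborel"] by simp

lemma measurable_mat_act [measurable]: "mat_act n A \<in> measurable (real_space n) (real_space n)"
proof -
  have "mat_act n A \<in> measurable (real_space n) (Pi\<^sub>M {..<n} (\<lambda>_. lborel))"
    unfolding mat_act_def
  proof (rule measurable_restrict)
    fix i assume "i \<in> {..<n}"
    have "(\<lambda>x. \<Sum>j<n. A i j * x j) \<in> borel_measurable (real_space n)"
      by (intro borel_measurable_sum borel_measurable_times borel_measurable_const measurable_real_space_component) auto
    then show "(\<lambda>x. \<Sum>j<n. A i j * x j) \<in> measurable (real_space n) lborel" by simp
  qed
  then show ?thesis by (simp add: real_space_def[symmetric])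
qed


text \<open>Preimages under a measurable map are measurable, and with the determinant as a factor on
  the left the property passes through row operations without any division in
  \<open>ennreal\<close>.\<close>

definition scales_volume :: "nat \<Rightarrow> (nat \<Rightarrow> nat \<Rightarrow> real) \<Rightarrow> bool" where
  "scales_volume n A \<longleftrightarrow> (\<forall>E\<in>sets (real_space n).
     emeasure (real_space n) (mat_act n A -` E \<inter> space (real_space n)) * ennreal \<bar>fdet n A\<bar> = emeasure (real_space n) E)"

lemma nn_integral_real_space_split:
  assumes "k < n" "f \<in> borel_measurable (real_space n)"
  shows "integral\<^sup>N (real_space n) f = (\<integral>\<^sup>+x. \<integral>\<^sup>+y. f (x(k := y)) \<partial>lborel \<partial>Pi\<^sub>M ({..<n} - {k}) (\<lambda>_. lborel))"
proof -
  have "insert k ({..<n} - {k}) = {..<n}" using assms(1) by auto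
  then show ?thesis
    using lborel_product.product_nn_integral_insert[of "{..<n} - {k}" k f] assms(2)
    by (simp add: real_space_def)
qed

lemma measurable_real_space_upd:
  assumes "k < n" "x \<in> space (Pi\<^sub>M ({..<n} - {k}) (\<lambda>_. lborel :: real measure))"
    "f \<in> borel_measurable (real_space n)"
  shows "(\<lambda>y. f (x(k := y))) \<in> borel_measurable lborel"
proof -
  have "insert k ({..<n} - {k}) = {..<n}" using assms(1) by auto
  moreover have "(\<lambda>y. x(k := y)) \<in> measurable lborel (Pi\<^sub>M (insert k ({..<n} - {k})) (\<lambda>_. lborel))"
    using assms(2) by (intro measurable_component_update) auto
  ultimately have "(\<lambda>y. x(k := y)) \<in> measurable lborel (real_space n)" by (simp add: real_space_def)
  from measurable_compose[OF this assms(3)] show ?thesis .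
qed

text \<open>By Fubini coordinate k may be integrated first. With the other coordinates fixed,
  \<open>T\<close> acts on it as the affine map y -> t x + c y, which scales Lebesgue measure on the
  line by |c|.\<close>

lemma emeasure_real_space_affine_coord:
  assumes k: "k < n" and E: "E \<in> sets (real_space n)" and c: "c \<noteq> 0"
    and T: "T \<in> measurable (real_space n) (real_space n)"
    and t: "\<And>x y. x \<in> space (Pi\<^sub>M ({..<n} - {k}) (\<lambda>_. lborel :: real measure)) \<Longrightarrow>
          T (x(k := y)) = x(k := t x + c * y)"
  shows "emeasure (real_space n) (T -` E \<inter> space (real_space n)) * ennreal \<bar>c\<bar> = emeasure (real_space n) E"
proof -
  let ?P = "Pi\<^sub>M ({..<n} - {k}) (\<lambda>_. lborel :: real measure)"
  have fE: "indicator E \<in> borel_measurable (real_space n)" using E by simp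
  have fT: "(\<lambda>x. indicator E (T x) :: ennreal) \<in> borel_measurable (real_space n)"
    using measurable_compose[OF T fE] .
  have "emeasure (real_space n) (T -` E \<inter> space (real_space n)) = (\<integral>\<^sup>+x. indicator (T -` E \<inter> space (real_space n)) x \<partial>real_space n)"
    using measurable_sets[OF T E] by simp
  also have "\<dots> = (\<integral>\<^sup>+x. indicator E (T x) \<partial>real_space n)"
    by (intro nn_integral_cong) (auto simp: indicator_def)
  also have "\<dots> = (\<integral>\<^sup>+x. \<integral>\<^sup>+y. indicator E (T (x(k := y))) \<partial>lborel \<partial>?P)"
    by (rule nn_integral_real_space_split[OF k fT])
  also have "\<dots> = (\<integral>\<^sup>+x. \<integral>\<^sup>+y. indicator E (x(k := t x + c * y)) \<partial>lborel \<partial>?P)"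
    by (intro nn_integral_cong) (simp add: t)
  finally have 1: "emeasure (real_space n) (T -` E \<inter> space (real_space n)) =
     (\<integral>\<^sup>+x. \<integral>\<^sup>+y. indicator E (x(k := t x + c * y)) \<partial>lborel \<partial>?P)" .
  have 2: "(\<integral>\<^sup>+y. indicator E (x(k := y)) \<partial>lborel) =
      ennreal \<bar>c\<bar> * (\<integral>\<^sup>+y. indicator E (x(k := t x + c * y)) \<partial>lborel)" if "x \<in> space ?P" for x
    using measurable_real_space_upd[OF k that fE] by (intro nn_integral_real_affine[OF _ c]) simp
  have "emeasure (real_space n) E = (\<integral>\<^sup>+x. indicator E x \<partial>real_space n)" using E by simp
  also have "\<dots> = (\<integral>\<^sup>+x. \<integral>\<^sup>+y. indicator E (x(k := y)) \<partial>lborel \<partial>?P)"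
    by (rule nn_integral_real_space_split[OF k fE])
  also have "\<dots> = (\<integral>\<^sup>+x. ennreal \<bar>c\<bar> * (\<integral>\<^sup>+y. indicator E (x(k := t x + c * y)) \<partial>lborel) \<partial>?P)"
    by (intro nn_integral_cong 2)
  also have "\<dots> = ennreal \<bar>c\<bar> * (\<integral>\<^sup>+x. (\<integral>\<^sup>+y. indicator E (x(k := t x + c * y)) \<partial>lborel) \<partial>?P)"
  \<comment> \<open>Nothing is known about \<open>t\<close> alone, so the measurability of the inner
    integral is taken from \<open>T\<close>.\<close>
  proof (rule nn_integral_cmult)
    have "insert k ({..<n} - {k}) = {..<n}" using k by auto
    then have "(\<lambda>(x, y). x(k := y)) \<in> measurable (?P \<Otimes>\<^sub>M lborel) (real_space n)"
      using measurable_add_dim[of k "{..<n} - {k}" "\<lambda>_. lborel :: real measure"] by (simp add: real_space_def)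
    then have "(\<lambda>p. indicator E (T ((\<lambda>(x, y). x(k := y)) p)) :: ennreal) \<in> borel_measurable (?P \<Otimes>\<^sub>M lborel)"
      by (rule measurable_compose[OF _ fT])
    then have "(\<lambda>x. \<integral>\<^sup>+y. indicator E (T (x(k := y))) \<partial>lborel) \<in> borel_measurable ?P"
      by (intro lborel.borel_measurable_nn_integral) (simp add: case_prod_beta')
    then show "(\<lambda>x. \<integral>\<^sup>+y. indicator E (x(k := t x + c * y)) \<partial>lborel) \<in> borel_measurable ?P"
      by (rule measurable_cong[THEN iffD1, rotated]) (simp add: t)
  qed
  finally show ?thesis unfolding 1 by (simp add: mult.commute)
qed

lemma mat_act_in_space: "mat_act n A x \<in> space (real_space n)"
  by (simp add: space_real_space mat_act_def)

lemma goodD: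
  assumes "scales_volume n A" "E \<in> sets (real_space n)"
  shows "emeasure (real_space n) (mat_act n A -` E \<inter> space (real_space n)) * ennreal \<bar>fdet n A\<bar> = emeasure (real_space n) E"
  using assms by (auto simp: scales_volume_def)

lemma mat_act_nth: "i < n \<Longrightarrow> mat_act n A x i = (\<Sum>j<n. A i j * x j)"
  by (simp add: mat_act_def)

text \<open>Treats shears and dilations of one coordinate together. Hypothesis \<open>tt\<close>
  makes the shift independent of coordinate k, so \<open>T\<close> is affine along each line in that
  direction.\<close>

lemma scales_volume_affine_coord:
  assumes g: "scales_volume n A" and k: "k < n" and c: "c \<noteq> 0"
    and T: "\<And>x. x \<in> space (real_space n) \<Longrightarrow> T x = x(k := t x + c * x k)" "T \<in> measurable (real_space n) (real_space n)"
    and tt: "\<And>x y. t (x(k := y)) = t x"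
    and B: "\<And>x. x \<in> space (real_space n) \<Longrightarrow> mat_act n B x = T (mat_act n A x)"
    and d: "fdet n B = c * fdet n A"
  shows "scales_volume n B"
  unfolding scales_volume_def
proof (intro ballI)
  fix E assume E: "E \<in> sets (real_space n)"
  have TE: "T -` E \<inter> space (real_space n) \<in> sets (real_space n)" by (rule measurable_sets[OF T(2) E])
  have "mat_act n B -` E \<inter> space (real_space n) = mat_act n A -` (T -` E \<inter> space (real_space n)) \<inter> space (real_space n)"
    using B mat_act_in_space by auto
  moreover have "emeasure (real_space n) (T -` E \<inter> space (real_space n)) * ennreal \<bar>c\<bar> = emeasure (real_space n) E"
  proof (rule emeasure_real_space_affine_coord[OF k E c T(2), where t = t])
    fix x y assume x: "x \<in> space (Pi\<^sub>M ({..<n} - {k}) (\<lambda>_. lborel :: real measure))"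
    then have "x(k := y) \<in> space (real_space n)"
      using k by (auto simp: space_PiM space_real_space PiE_iff extensional_def)
    then show "T (x(k := y)) = x(k := t x + c * y)" by (simp add: T tt)
  qed
  ultimately show "emeasure (real_space n) (mat_act n B -` E \<inter> space (real_space n)) * ennreal \<bar>fdet n B\<bar> = emeasure (real_space n) E"
    using goodD[OF g TE] by (simp add: d abs_mult ennreal_mult' mult_ac)
qed

lemma scales_volume_addrow:
  assumes g: "scales_volume n A" and kl: "k < n" "l < n" "k \<noteq> l"
  shows "scales_volume n (A(k := \<lambda>j. A k j + c * A l j))"
proof (rule scales_volume_affine_coord[OF g kl(1), where c = 1 and t = "\<lambda>x. c * x l" and
      T = "mat_act n (\<lambda>i j. if i = j then 1 else if i = k \<and> j = l then c else 0)"])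
  fix x :: "nat \<Rightarrow> real" assume x: "x \<in> space (real_space n)"
  have "(\<Sum>j<n. (if i = j then 1 else if i = k \<and> j = l then c else 0) * x j)
     = (\<Sum>j<n. (if j = i then x j else 0) + (if j = l then (if i = k then c * x l else 0) else 0))" for i
    using kl by (intro sum.cong) auto
  then have *: "(\<Sum>j<n. (if i = j then 1 else if i = k \<and> j = l then c else 0) * x j)
     = x i + (if i = k then c * x l else 0)" if "i < n" for i
    using that kl by (simp add: sum.distrib)
  show "mat_act n (\<lambda>i j. if i = j then 1 else if i = k \<and> j = l then c else 0) x = x(k := c * x l + 1 * x k)"
  proof
    fix i show "mat_act n (\<lambda>i j. if i = j then 1 else if i = k \<and> j = l then c else 0) x i = (x(k := c * x l + 1 * x k)) i"
      using x kl * by (cases "i < n") (auto simp: mat_act_def space_real_space PiE_iff extensional_def)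
  qed
next
  fix x :: "nat \<Rightarrow> real" assume x: "x \<in> space (real_space n)"
  let ?y = "mat_act n A x"
  have "(\<Sum>j<n. (if i = j then 1 else if i = k \<and> j = l then c else 0) * ?y j)
     = (\<Sum>j<n. (if j = i then ?y j else 0) + (if j = l then (if i = k then c * ?y l else 0) else 0))" for i
    using kl by (intro sum.cong) auto
  then have *: "(\<Sum>j<n. (if i = j then 1 else if i = k \<and> j = l then c else 0) * ?y j)
     = ?y i + (if i = k then c * ?y l else 0)" if "i < n" for i
    using that kl by (simp add: sum.distrib)
  show "mat_act n (A(k := \<lambda>j. A k j + c * A l j)) x
    = mat_act n (\<lambda>i j. if i = j then 1 else if i = k \<and> j = l then c else 0) ?y"
  proof
    fix i show "mat_act n (A(k := \<lambda>j. A k j + c * A l j)) x i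
    = mat_act n (\<lambda>i j. if i = j then 1 else if i = k \<and> j = l then c else 0) ?y i"
    proof (cases "i < n")
      case True
      then show ?thesis using kl unfolding mat_act_nth[OF True] *[OF True]
        by (auto simp: mat_act_nth algebra_simps sum.distrib sum_distrib_left)
    qed (simp add: mat_act_def)
  qed
qed (use kl in \<open>auto simp: fdet_addrow\<close>)

lemma scales_volume_multrow:
  assumes g: "scales_volume n A" and k: "k < n" and c: "c \<noteq> 0"
  shows "scales_volume n (A(k := \<lambda>j. c * A k j))"
proof (rule scales_volume_affine_coord[OF g k c, where t = "\<lambda>x. 0" and
      T = "mat_act n (\<lambda>i j. if i = j then if i = k then c else 1 else 0)"])
  have *: "(\<Sum>j<n. (if i = j then if i = k then c else 1 else 0) * x j) = (if i = k then c else 1) * x i"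
    if "i < n" for i and x :: "nat \<Rightarrow> real"
    using that by (simp add: if_distrib[of "\<lambda>z. z * _"] cong: if_cong)
  fix x :: "nat \<Rightarrow> real" assume x: "x \<in> space (real_space n)"
  show "mat_act n (\<lambda>i j. if i = j then if i = k then c else 1 else 0) x = x(k := 0 + c * x k)"
    using x k * by (auto simp: mat_act_def space_real_space PiE_iff extensional_def fun_eq_iff)
  show "mat_act n (A(k := \<lambda>j. c * A k j)) x = mat_act n (\<lambda>i j. if i = j then if i = k then c else 1 else 0) (mat_act n A x)"
    using * k by (auto simp: mat_act_def fun_eq_iff sum_distrib_left mult_ac)
qed (use k in \<open>auto simp: fdet_multrow\<close>)

lemma scales_volume_id:
  assumes "\<And>i j. i < n \<Longrightarrow> j < n \<Longrightarrow> A i j = (if i = j then 1 else 0)"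
  shows "scales_volume n A"
proof -
  have "fdet n A = 1" using fdet_cong[of n A "\<lambda>i j. if i = j then 1 else 0"] assms fdet_id by auto
  moreover have "mat_act n A x = x" if "x \<in> space (real_space n)" for x
  proof
    fix i
    have "(\<Sum>j<n. A i j * x j) = (\<Sum>j<n. if i = j then x j else 0)" if "i < n"
      using that assms by (intro sum.cong) auto
    then show "mat_act n A x i = x i"
      using that by (auto simp: mat_act_def space_real_space PiE_iff extensional_def)
  qed
  moreover have "E \<subseteq> space (real_space n)" if "E \<in> sets (real_space n)" for E using sets.sets_into_space[OF that] .
  ultimately show ?thesis unfolding scales_volume_def
    by (auto intro!: arg_cong[of _ _ "emeasure _"])
qed

text \<open>Elimination in column m, by descending induction on the number r of rows known to be
  clear. The matrix with row r cleared has the property by induction, and the inverse row operation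
  leads back to A.\<close>

lemma scales_volume_clear_column:
  assumes "r \<le> n" and m: "m < n"
    and next_column: "\<And>B. fdet n B \<noteq> 0 \<Longrightarrow> (\<And>i j. i < n \<Longrightarrow> j < Suc m \<Longrightarrow> B i j = (if i = j then 1 else 0)) \<Longrightarrow> scales_volume n B"
    and "fdet n A \<noteq> 0" "\<And>i j. i < n \<Longrightarrow> j < m \<Longrightarrow> A i j = (if i = j then 1 else 0)"
    and "A m m = 1" "\<And>i. i < r \<Longrightarrow> i \<noteq> m \<Longrightarrow> A i m = 0"
  shows "scales_volume n A"
  using assms(1,4-)
proof (induction r arbitrary: A rule: inc_induct)
  case base
  then show ?case by (intro next_column) (auto simp: less_Suc_eq)
next
  case (step r)
  show ?case
  proof (cases "r = m")
    case True
    then show ?thesis using step by (intro step.IH) (auto simp: less_Suc_eq)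
  next
    case False
    define B where "B = A(r := \<lambda>j. A r j + (- A r m) * A m j)"
    have "scales_volume n B"
    proof (rule step.IH)
      show "fdet n B \<noteq> 0" unfolding B_def using step False m by (subst fdet_addrow) auto
    qed (use step False m in \<open>auto simp: B_def less_Suc_eq\<close>)
    then have "scales_volume n (B(r := \<lambda>j. B r j + A r m * B m j))"
      using step False m by (intro scales_volume_addrow) auto
    also have "B(r := \<lambda>j. B r j + A r m * B m j) = A" using False by (auto simp: B_def)
    finally show ?thesis .
  qed
qed

text \<open>Gauss-Jordan elimination, as a descending induction on the number m of columns that are
  already unit vectors; at m = n the matrix is the identity.\<close>

lemma scales_volume_all:
  assumes "fdet n A \<noteq> 0"
  shows "scales_volume n A"
proof -
  have "scales_volume n A" if "m \<le> n" "fdet n A \<noteq> 0" "\<And>i j. i < n \<Longrightarrow> j < m \<Longrightarrow> A i j = (if i = j then 1 else 0)" for m A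
    using that
  proof (induction m arbitrary: A rule: inc_induct)
    case base
    then show ?case by (intro scales_volume_id) auto
  next
    case (step m)
    note m = \<open>m < n\<close>
    have unit: "scales_volume n B" if B: "fdet n B \<noteq> 0" "\<And>i j. i < n \<Longrightarrow> j < m \<Longrightarrow> B i j = (if i = j then 1 else 0)" "B m m \<noteq> 0" for B
    proof -
      define C where "C = B(m := \<lambda>j. inverse (B m m) * B m j)"
      have "scales_volume n C"
        by (rule scales_volume_clear_column[of 0, OF _ m step.IH])
          (use B m in \<open>auto simp: C_def fdet_multrow\<close>)
      then have "scales_volume n (C(m := \<lambda>j. B m m * C m j))" using B m by (intro scales_volume_multrow) auto
      also have "C(m := \<lambda>j. B m m * C m j) = B" using B by (auto simp: C_def fun_eq_iff)
      finally show ?thesis .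
    qed
    show ?case
    proof (cases "A m m = 0")
      case False
      then show ?thesis using unit step by auto
    next
      case True
      have "\<exists>i<n. m < i \<and> A i m \<noteq> 0"
      proof (rule ccontr)
        assume neg: "\<not> (\<exists>i<n. m < i \<and> A i m \<noteq> 0)"
        \<comment> \<open>Without a pivot, column m is a combination of the first m unit columns;
          \<open>x\<close> is this linear relation.\<close>
        define x where "x = (\<lambda>j. if j = m then 1 else if j < m then - A j m else 0)"
        have "(\<Sum>j<n. A i j * x j) = 0" if i: "i < n" for i
        proof -
          have "(\<Sum>j<n. A i j * x j) = (\<Sum>j<n. (if j = m then A i m else 0) + (if j = i then if i < m then - A i m else 0 else 0))"
            using i step by (intro sum.cong) (auto simp: x_def)
          also have "\<dots> = A i m + (if i < m then - A i m else 0)" using i m by (simp add: sum.distrib)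
          also have "\<dots> = 0"
          proof (cases "i < m")
            case False
            then have "i = m \<or> m < i" by auto
            then show ?thesis using i neg True by auto
          qed simp
          finally show ?thesis .
        qed
        moreover have "x m \<noteq> 0" by (simp add: x_def)
        ultimately have "fdet n A = 0" unfolding fdet_eq_0_iff using m by blast
        then show False using step by simp
      qed
      then obtain i where i: "i < n" "m < i" "A i m \<noteq> 0" by auto
      \<comment> \<open>Adding row i to row m creates the pivot, in place of a row exchange.\<close>
      define B where "B = A(m := \<lambda>j. A m j + 1 * A i j)"
      have "scales_volume n B"
      proof (rule unit)
        show "fdet n B \<noteq> 0" unfolding B_def using step i m by (subst fdet_addrow) auto
        show "B m m \<noteq> 0" using i True by (simp add: B_def)
      qed (use step i m in \<open>auto simp: B_def\<close>)
      then have "scales_volume n (B(m := \<lambda>j. B m j + (- 1) * B i j))"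
        using i m by (intro scales_volume_addrow) auto
      also have "B(m := \<lambda>j. B m j + (- 1) * B i j) = A" using i by (auto simp: B_def)
      finally show ?thesis .
    qed
  qed
  from this[of 0] assms show ?thesis by simp
qed

lemma emeasure_mat_act_vimage:
  assumes "fdet n A \<noteq> 0" "E \<in> sets (real_space n)"
  shows "emeasure (real_space n) (mat_act n A -` E \<inter> space (real_space n)) * ennreal \<bar>fdet n A\<bar> = emeasure (real_space n) E"
  using goodD[OF scales_volume_all[OF assms(1)] assms(2)] .

section \<open>Boxes, translations and hyperplanes\<close>

lemma emeasure_real_space_box:
  assumes "\<And>i. i < n \<Longrightarrow> A i \<in> sets borel"
  shows "emeasure (real_space n) (Pi\<^sub>E {..<n} A) = (\<Prod>i<n. emeasure lborel (A i))"
  unfolding real_space_def using assms by (intro lborel_product.emeasure_PiM) auto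

lemma emeasure_translate:
  fixes a :: "nat \<Rightarrow> real"
  assumes E: "E \<in> sets (real_space n)"
  shows "emeasure (real_space n) {x \<in> space (real_space n). (\<lambda>i\<in>{..<n}. a i + x i) \<in> E} = emeasure (real_space n) E"
proof -
  let ?T = "\<lambda>x. \<lambda>i\<in>{..<n}. a i + x i"
  have T: "?T \<in> measurable (real_space n) (real_space n)"
  proof -
    have "?T \<in> measurable (real_space n) (Pi\<^sub>M {..<n} (\<lambda>_. lborel))"
      by (intro measurable_restrict) auto
    then show ?thesis by (simp add: real_space_def[symmetric])
  qed
  have "distr (real_space n) (real_space n) ?T = Pi\<^sub>M {..<n} (\<lambda>_. lborel)"
  proof (rule lborel_product.PiM_eqI)
    fix A :: "nat \<Rightarrow> real set" assume A: "\<And>i. i \<in> {..<n} \<Longrightarrow> A i \<in> sets lborel"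
    have 1: "(\<lambda>y. a i + y) -` A i \<in> sets borel" if "i < n" for i
      using A[of i] that measurable_sets[of "\<lambda>y. a i + y" borel borel "A i"] by simp
    have "Pi\<^sub>E {..<n} A \<in> sets (real_space n)" unfolding real_space_def using A by (intro sets_PiM_I_finite) auto
    then have "emeasure (distr (real_space n) (real_space n) ?T) (Pi\<^sub>E {..<n} A)
       = emeasure (real_space n) (?T -` Pi\<^sub>E {..<n} A \<inter> space (real_space n))"
      by (rule emeasure_distr[OF T])
    also have "?T -` Pi\<^sub>E {..<n} A \<inter> space (real_space n) = Pi\<^sub>E {..<n} (\<lambda>i. (\<lambda>y. a i + y) -` A i)"
      by (auto simp: space_real_space PiE_iff)
    also have "emeasure (real_space n) \<dots> = (\<Prod>i<n. emeasure lborel ((\<lambda>y. a i + y) -` A i))"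
      by (rule emeasure_real_space_box[OF 1])
    also have "\<dots> = (\<Prod>i<n. emeasure lborel (A i))"
    proof (rule prod.cong[OF refl])
      fix i assume "i \<in> {..<n}"
      then have "emeasure (distr lborel borel ((+) (a i))) (A i) = emeasure lborel ((+) (a i) -` A i \<inter> space lborel)"
        using A by (intro emeasure_distr) auto
      then show "emeasure lborel ((\<lambda>y. a i + y) -` A i) = emeasure lborel (A i)"
        by (simp add: lborel_distr_plus)
    qed
    finally show "emeasure (distr (real_space n) (real_space n) ?T) (Pi\<^sub>E {..<n} A) = (\<Prod>i<n. emeasure lborel (A i))" .
  qed (auto simp: real_space_def)
  then have "emeasure (real_space n) E = emeasure (distr (real_space n) (real_space n) ?T) E" by (simp add: real_space_def)
  also have "\<dots> = emeasure (real_space n) (?T -` E \<inter> space (real_space n))" by (rule emeasure_distr[OF T E])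
  also have "?T -` E \<inter> space (real_space n) = {x \<in> space (real_space n). ?T x \<in> E}" by auto
  finally show ?thesis by simp
qed

text \<open>Replacing row p of the identity matrix by r gives an invertible map under which the
  hyperplane is the preimage of a box with one degenerate side.\<close>

lemma null_hyperplane:
  fixes r :: "nat \<Rightarrow> real"
  assumes p: "p < n" "r p \<noteq> 0"
  shows "emeasure (real_space n) {x \<in> space (real_space n). (\<Sum>j<n. r j * x j) = 0} = 0"
proof -
  define I where "I = (\<lambda>i j :: nat. if i = j then 1 else 0 :: real)"
  define A where "A = I(p := r)"
  have "fdet n A = r p * fdet n I"
    unfolding A_def using p by (intro fdet_cramer) (auto simp: I_def if_distrib[of "\<lambda>z. _ * z"] cong: if_cong)
  then have d: "fdet n A \<noteq> 0" using p fdet_id[of n, where 'a = real] by (simp add: I_def)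
  let ?E = "Pi\<^sub>E {..<n} (\<lambda>i. if i = p then {0} else UNIV) :: (nat \<Rightarrow> real) set"
  have E: "?E \<in> sets (real_space n)" unfolding real_space_def by (intro sets_PiM_I_finite) auto
  have E0: "emeasure (real_space n) ?E = 0"
  proof (subst emeasure_real_space_box)
    show "(\<Prod>i<n. emeasure lborel (if i = p then {0::real} else UNIV)) = 0"
      using p(1) by (subst prod.remove[of _ p]) auto
  qed auto
  have eq: "mat_act n A -` ?E \<inter> space (real_space n) = {x \<in> space (real_space n). (\<Sum>j<n. r j * x j) = 0}"
  proof -
    have "mat_act n A x \<in> ?E \<longleftrightarrow> mat_act n A x p = 0" for x
      using p(1) mat_act_in_space[of n A x] by (auto simp: PiE_iff space_real_space split: if_splits)
    moreover have "mat_act n A x p = (\<Sum>j<n. r j * x j)" for x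
      using p(1) by (simp add: mat_act_nth A_def)
    ultimately show ?thesis by auto
  qed
  show ?thesis using emeasure_mat_act_vimage[OF d E] E0 d unfolding eq by (simp add: ennreal_zero_less_mult_iff)
qed

section \<open>Bodies bounded by linear forms\<close>

definition lin_form :: "nat \<Rightarrow> (nat \<Rightarrow> 'a::comm_semiring_1) \<Rightarrow> (nat \<Rightarrow> 'a) \<Rightarrow> 'a" where
  "lin_form n c x = (\<Sum>j<n. c j * x j)"

abbreviation lin_form_real :: "nat \<Rightarrow> (nat \<Rightarrow> complex) \<Rightarrow> (nat \<Rightarrow> real) \<Rightarrow> complex" where
  "lin_form_real n c x \<equiv> lin_form n c (\<lambda>j. complex_of_real (x j))"

abbreviation lin_form_int :: "nat \<Rightarrow> (nat \<Rightarrow> complex) \<Rightarrow> (nat \<Rightarrow> int) \<Rightarrow> complex" where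
  "lin_form_int n c z \<equiv> lin_form n c (\<lambda>j. of_int (z j))"

definition form_body :: "nat \<Rightarrow> nat \<Rightarrow> (nat \<Rightarrow> nat \<Rightarrow> complex) \<Rightarrow> (nat \<Rightarrow> real) \<Rightarrow> (nat \<Rightarrow> real) set" where
  "form_body n d c b = {x \<in> space (real_space n). \<forall>i<d. cmod (lin_form_real n (c i) x) \<le> b i}"

lemma Re_lin_form_real: "Re (lin_form_real n c x) = (\<Sum>j<n. Re (c j) * x j)"
  by (simp add: lin_form_def)

lemma Im_lin_form_real: "Im (lin_form_real n c x) = (\<Sum>j<n. Im (c j) * x j)"
  by (simp add: lin_form_def)

lemma measurable_lin_form_real [measurable]: "(\<lambda>x. lin_form_real n c x) \<in> borel_measurable (real_space n)"
  unfolding lin_form_def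
  by (intro borel_measurable_sum borel_measurable_times borel_measurable_const
      measurable_compose[OF measurable_real_space_component, of _ _ complex_of_real]) auto

lemma sets_form_body [measurable]: "form_body n d c b \<in> sets (real_space n)"
proof -
  have "{x \<in> space (real_space n). \<forall>i\<in>{..<d}. cmod (lin_form_real n (c i) x) \<le> b i} \<in> sets (real_space n)"
  proof (intro sets.sets_Collect_finite_All)
    fix i
    show "{x \<in> space (real_space n). cmod (lin_form_real n (c i) x) \<le> b i} \<in> sets (real_space n)" by measurable
  qed simp
  then show ?thesis by (simp add: form_body_def Ball_def)
qed

text \<open>Cut E into the cells of the lattice 2Z^n and translate all pieces into the single cell
  [0,2)^n of volume 2^n: two pieces must overlap. The lattice 2Z^n is chosen so that half of the
  difference x - y is integral.\<close>

lemma blichfeldt: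
  assumes E: "E \<in> sets (real_space n)" and vol: "emeasure (real_space n) E > 2 ^ n"
  obtains x y and z :: "nat \<Rightarrow> int" where "x \<in> E" "y \<in> E" "\<exists>i<n. z i \<noteq> 0"
    "\<And>i. i < n \<Longrightarrow> x i - y i = 2 * of_int (z i)"
proof (rule ccontr)
  assume neg: "\<not> thesis"
  define Z where "Z = ({..<n} \<rightarrow>\<^sub>E (UNIV :: int set))"
  have countable: "countable Z" unfolding Z_def by (intro countable_PiE) auto
  define Q where "Q z = {x \<in> E. \<forall>i\<in>{..<n}. \<lfloor>x i / 2\<rfloor> = z i}" for z
  define T where "T z = {x \<in> space (real_space n). (\<lambda>i\<in>{..<n}. 2 * of_int (z i) + x i) \<in> Q z}" for z
  have Esp: "E \<subseteq> space (real_space n)" using sets.sets_into_space[OF E] .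
  have Q: "Q z \<in> sets (real_space n)" for z
  proof -
    have "{x \<in> space (real_space n). \<forall>i\<in>{..<n}. \<lfloor>x i / 2\<rfloor> = z i} \<in> sets (real_space n)"
    proof (intro sets.sets_Collect_finite_All)
      fix i assume "i \<in> {..<n}"
      then have [measurable]: "(\<lambda>x. x i) \<in> borel_measurable (real_space n)" by auto
      have "(\<lambda>x. x i / 2) \<in> borel_measurable (real_space n)" by measurable
      then have "{x \<in> space (real_space n). real_of_int (z i) \<le> x i / 2} \<in> sets (real_space n)"
        "{x \<in> space (real_space n). x i / 2 < real_of_int (z i) + 1} \<in> sets (real_space n)"
        by measurable
      then have "{x \<in> space (real_space n). real_of_int (z i) \<le> x i / 2} \<inter> {x \<in> space (real_space n). x i / 2 < real_of_int (z i) + 1} \<in> sets (real_space n)"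
        by (rule sets.Int)
      moreover have "{x \<in> space (real_space n). real_of_int (z i) \<le> x i / 2} \<inter> {x \<in> space (real_space n). x i / 2 < real_of_int (z i) + 1}
         = {x \<in> space (real_space n). \<lfloor>x i / 2\<rfloor> = z i}" by (auto simp: floor_eq_iff)
      ultimately show "{x \<in> space (real_space n). \<lfloor>x i / 2\<rfloor> = z i} \<in> sets (real_space n)" by simp
    qed simp
    moreover have "Q z = E \<inter> {x \<in> space (real_space n). \<forall>i\<in>{..<n}. \<lfloor>x i / 2\<rfloor> = z i}" using Esp by (auto simp: Q_def)
    ultimately show ?thesis using E by auto
  qed
  have T: "T z \<in> sets (real_space n)" for z
  proof -
    have "(\<lambda>x. \<lambda>i\<in>{..<n}. 2 * of_int (z i) + x i) \<in> measurable (real_space n) (Pi\<^sub>M {..<n} (\<lambda>_. lborel :: real measure))"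
      by (intro measurable_restrict) auto
    then have "(\<lambda>x. \<lambda>i\<in>{..<n}. 2 * of_int (z i) + x i) \<in> measurable (real_space n) (real_space n)" by (simp add: real_space_def[symmetric])
    from measurable_sets[OF this Q[of z]] show ?thesis by (auto simp: T_def vimage_def Int_def conj_commute)
  qed
  have QT: "emeasure (real_space n) (T z) = emeasure (real_space n) (Q z)" for z
    unfolding T_def by (rule emeasure_translate[OF Q])
  have EQ: "E = (\<Union>z\<in>Z. Q z)"
  proof -
    have "x \<in> (\<Union>z\<in>Z. Q z)" if "x \<in> E" for x
      by (rule UN_I[of "\<lambda>i\<in>{..<n}. \<lfloor>x i / 2\<rfloor>"]) (use that in \<open>auto simp: Z_def Q_def\<close>)
    then show ?thesis by (auto simp: Q_def)
  qed
  have disjQ: "disjoint_family_on Q Z"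
    unfolding disjoint_family_on_def
  proof (intro ballI impI)
    fix z z' assume "z \<in> Z" "z' \<in> Z" "z \<noteq> z'"
    then obtain i where "i < n" "z i \<noteq> z' i" unfolding Z_def by (metis PiE_ext lessThan_iff)
    then show "Q z \<inter> Q z' = {}" by (auto simp: Q_def)
  qed
  have disjT: "disjoint_family_on T Z"
    unfolding disjoint_family_on_def
  proof (intro ballI impI)
    fix z z' assume zz: "z \<in> Z" "z' \<in> Z" "z \<noteq> z'"
    then obtain i where i: "i < n" "z i \<noteq> z' i" unfolding Z_def by (metis PiE_ext lessThan_iff)
    show "T z \<inter> T z' = {}"
    proof (rule ccontr)
      assume "T z \<inter> T z' \<noteq> {}"
      then obtain x where x: "x \<in> T z" "x \<in> T z'" by auto
      then have "(\<lambda>i\<in>{..<n}. 2 * of_int (z i) + x i) \<in> E" "(\<lambda>i\<in>{..<n}. 2 * of_int (z' i) + x i) \<in> E"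
        by (auto simp: T_def Q_def)
      then show False using neg that[of "\<lambda>i\<in>{..<n}. 2 * of_int (z i) + x i" "\<lambda>i\<in>{..<n}. 2 * of_int (z' i) + x i" "\<lambda>i. z i - z' i"] i
        by auto
    qed
  qed
  have Tsub: "(\<Union>z\<in>Z. T z) \<subseteq> Pi\<^sub>E {..<n} (\<lambda>_. {0..<2})"
  proof
    fix x assume "x \<in> (\<Union>z\<in>Z. T z)"
    then obtain z where "x \<in> T z" by auto
    then have x: "x \<in> space (real_space n)" "\<And>i. i < n \<Longrightarrow> \<lfloor>(2 * of_int (z i) + x i) / 2\<rfloor> = z i" by (auto simp: T_def Q_def)
    have "0 \<le> x i \<and> x i < 2" if "i < n" for i
      using x(2)[OF that] by (simp add: floor_eq_iff field_simps)
    then show "x \<in> Pi\<^sub>E {..<n} (\<lambda>_. {0..<2})" using x(1) by (auto simp: space_real_space PiE_iff)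
  qed
  have "emeasure (real_space n) E = (\<integral>\<^sup>+z. emeasure (real_space n) (Q z) \<partial>count_space Z)"
    unfolding EQ by (rule emeasure_UN_countable[OF Q countable disjQ])
  also have "\<dots> = (\<integral>\<^sup>+z. emeasure (real_space n) (T z) \<partial>count_space Z)" by (simp add: QT)
  also have "\<dots> = emeasure (real_space n) (\<Union>z\<in>Z. T z)"
    by (rule emeasure_UN_countable[OF T countable disjT, symmetric])
  also have "\<dots> \<le> emeasure (real_space n) (Pi\<^sub>E {..<n} (\<lambda>_. {0..<2}))"
    by (rule emeasure_mono[OF Tsub]) (auto simp: real_space_def intro!: sets_PiM_I_finite)
  also have "\<dots> = (\<Prod>i<n. emeasure lborel {0::real..<2})" by (rule emeasure_real_space_box) auto
  also have "\<dots> = 2 ^ n" by simp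
  finally show False using vol by simp
qed

section \<open>Minkowski's theorem for bodies bounded by linear forms\<close>

lemma lin_form_diff: "lin_form n (c :: nat \<Rightarrow> 'a :: comm_ring_1) (\<lambda>j. x j - y j) = lin_form n c x - lin_form n c y"
  by (simp add: lin_form_def sum_subtractf algebra_simps)

lemma lin_form_add: "lin_form n (c :: nat \<Rightarrow> 'a :: comm_ring_1) (\<lambda>j. x j + y j) = lin_form n c x + lin_form n c y"
  by (simp add: lin_form_def sum.distrib algebra_simps)

lemma lin_form_scale: "lin_form n (c :: nat \<Rightarrow> 'a :: comm_ring_1) (\<lambda>j. a * x j) = a * lin_form n c x"
  by (simp add: lin_form_def sum_distrib_left mult_ac)

lemma lin_form_cong: "(\<And>j. j < n \<Longrightarrow> c j = c' j) \<Longrightarrow> (\<And>j. j < n \<Longrightarrow> x j = x' j) \<Longrightarrow> lin_form n c x = lin_form n c' x'"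
  by (simp add: lin_form_def)

text \<open>The integral point is (x - y)/2 for the two points of \<open>blichfeldt\<close>.
  Convexity and symmetry of the body amount to the triangle inequality for each form.\<close>

lemma minkowski_form_body:
  assumes "emeasure (real_space n) (form_body n d c b) > 2 ^ n"
  obtains z :: "nat \<Rightarrow> int" where "\<exists>i<n. z i \<noteq> 0" "\<And>i. i < d \<Longrightarrow> cmod (lin_form_int n (c i) z) \<le> b i"
proof (rule blichfeldt[OF sets_form_body assms])
  fix x y and z :: "nat \<Rightarrow> int"
  assume xyz: "x \<in> form_body n d c b" "y \<in> form_body n d c b" "\<exists>i<n. z i \<noteq> 0"
    "\<And>i. i < n \<Longrightarrow> x i - y i = 2 * of_int (z i)"
  show thesis
  proof (rule that[OF xyz(3)])
    fix i assume i: "i < d"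
    have "2 * lin_form_int n (c i) z = lin_form n (c i) (\<lambda>j. complex_of_real (x j) - complex_of_real (y j))"
      unfolding lin_form_scale[symmetric]
    proof (rule lin_form_cong)
      fix j assume "j < n"
      then show "2 * of_int (z j) = complex_of_real (x j) - complex_of_real (y j)"
        using arg_cong[OF xyz(4), of j complex_of_real] by simp
    qed simp
    also have "\<dots> = lin_form_real n (c i) x - lin_form_real n (c i) y" by (rule lin_form_diff)
    finally have "2 * cmod (lin_form_int n (c i) z) = cmod (lin_form_real n (c i) x - lin_form_real n (c i) y)"
      by (metis norm_mult norm_numeral)
    also have "\<dots> \<le> cmod (lin_form_real n (c i) x) + cmod (lin_form_real n (c i) y)" by (rule norm_triangle_ineq4)
    also have "\<dots> \<le> b i + b i" using xyz(1,2) i by (intro add_mono) (auto simp: form_body_def)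
    finally show "cmod (lin_form_int n (c i) z) \<le> b i" by simp
  qed
qed

lemma emeasure_form_body_scale:
  assumes s: "s > 0"
  shows "emeasure (real_space n) (form_body n d c (\<lambda>i. s * b i)) = ennreal (s ^ n) * emeasure (real_space n) (form_body n d c b)"
proof -
  let ?I = "\<lambda>i j :: nat. if i = j then 1 else 0 :: real"
  let ?A = "\<lambda>i j :: nat. s * ?I i j"
  have d: "fdet n ?A = s ^ n" by (subst fdet_scale) (simp add: fdet_id)
  have mat_act: "mat_act n ?A x j = s * x j" if "j < n" for x j
    using that by (simp add: mat_act_nth if_distrib[of "\<lambda>z. s * z * _"] cong: if_cong)
  have "lin_form_real n (c i) (mat_act n ?A x) = of_real s * lin_form_real n (c i) x" for i x
    unfolding lin_form_scale[symmetric] by (rule lin_form_cong) (auto simp: mat_act)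
  then have "cmod (lin_form_real n (c i) (mat_act n ?A x)) = s * cmod (lin_form_real n (c i) x)" for i x
    using s by (simp add: norm_mult)
  then have "mat_act n ?A -` form_body n d c (\<lambda>i. s * b i) \<inter> space (real_space n) = form_body n d c b"
    using s mat_act_in_space by (auto simp: form_body_def)
  then show ?thesis
    using emeasure_mat_act_vimage[of n ?A "form_body n d c (\<lambda>i. s * b i)"] d s by (simp add: mult.commute)
qed

section \<open>Positivity and upper bounds of volumes\<close>

lemma ex_small_radius:
  fixes K :: "nat \<Rightarrow> real"
  assumes "\<And>i. i < d \<Longrightarrow> b i > 0"
  shows "\<exists>\<epsilon>>0. \<forall>i<d. \<epsilon> * K i \<le> b i"
  using assms
proof (induction d)
  case 0
  show ?case by (intro exI[of _ 1]) auto
next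
  case (Suc d)
  then obtain \<epsilon> where e: "\<epsilon> > 0" "\<And>i. i < d \<Longrightarrow> \<epsilon> * K i \<le> b i" by fastforce
  define \<delta> where "\<delta> = min \<epsilon> (b d / (\<bar>K d\<bar> + 1))"
  have d: "\<delta> > 0" using e Suc.prems[of d] by (auto simp: \<delta>_def)
  have "\<delta> * K i \<le> b i" if "i < Suc d" for i
  proof (cases "i = d")
    case True
    have "\<delta> * K d \<le> \<delta> * (\<bar>K d\<bar> + 1)" using d by (intro mult_left_mono) auto
    also have "\<dots> \<le> b d / (\<bar>K d\<bar> + 1) * (\<bar>K d\<bar> + 1)" by (intro mult_right_mono) (auto simp: \<delta>_def)
    also have "\<dots> = b d" by simp
    finally show ?thesis using True by simp
  next
    case False
    then have i: "i < d" using that by simp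
    show ?thesis
    proof (cases "K i \<ge> 0")
      case True
      then have "\<delta> * K i \<le> \<epsilon> * K i" by (intro mult_right_mono) (auto simp: \<delta>_def)
      then show ?thesis using e(2)[OF i] by simp
    next
      case False
      then have "\<delta> * K i \<le> 0" using d by (simp add: mult_le_0_iff)
      then show ?thesis using Suc.prems[of i] i by auto
    qed
  qed
  then show ?case using d by blast
qed

lemma emeasure_form_body_pos:
  assumes "\<And>i. i < d \<Longrightarrow> b i > 0"
  shows "emeasure (real_space n) (form_body n d c b) > 0"
proof -
  obtain \<epsilon> where e: "\<epsilon> > 0" "\<And>i. i < d \<Longrightarrow> \<epsilon> * (\<Sum>j<n. cmod (c i j)) \<le> b i"
    using ex_small_radius[OF assms, of d "\<lambda>i. i" "\<lambda>i. \<Sum>j<n. cmod (c i j)"] by auto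
  have "0 < ennreal ((2 * \<epsilon>) ^ n)" using e by simp
  also have "\<dots> = (\<Prod>i<n. emeasure lborel {-\<epsilon>..\<epsilon>})" using e by (simp add: ennreal_power)
  also have "\<dots> = emeasure (real_space n) (Pi\<^sub>E {..<n} (\<lambda>_. {-\<epsilon>..\<epsilon>}))" by (rule emeasure_real_space_box[symmetric]) auto
  also have "\<dots> \<le> emeasure (real_space n) (form_body n d c b)"
  proof (rule emeasure_mono[OF _ sets_form_body], rule subsetI)
    fix x assume x: "x \<in> Pi\<^sub>E {..<n} (\<lambda>_. {-\<epsilon>..\<epsilon>})"
    have "cmod (lin_form_real n (c i) x) \<le> b i" if "i < d" for i
    proof -
      have "cmod (lin_form_real n (c i) x) \<le> (\<Sum>j<n. cmod (c i j) * \<bar>x j\<bar>)"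
        unfolding lin_form_def by (rule order_trans[OF norm_sum]) (simp add: norm_mult)
      also have "\<dots> \<le> (\<Sum>j<n. cmod (c i j) * \<epsilon>)" using x by (intro sum_mono mult_left_mono) (auto simp: PiE_iff abs_le_iff minus_le_iff)
      also have "\<dots> \<le> b i" using e(2)[OF that] by (simp only: sum_distrib_left mult.commute)
      finally show ?thesis .
    qed
    then show "x \<in> form_body n d c b" using x by (auto simp: form_body_def space_real_space PiE_iff)
  qed
  finally show ?thesis .
qed

text \<open>Splitting one row into real and imaginary part writes the determinant as R + i I, so R
  or I has at least half of its modulus. Doing this for all n rows costs 2^n and leaves a real
  matrix, to which the change of variables applies.\<close>

lemma fdet_real_rows:
  fixes c :: "nat \<Rightarrow> nat \<Rightarrow> complex"
  shows "\<exists>r. (\<forall>k<n. r k = (\<lambda>j. Re (c k j)) \<or> r k = (\<lambda>j. Im (c k j))) \<and> cmod (fdet n c) \<le> 2 ^ n * \<bar>fdet n r\<bar>"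
proof -
  have "\<exists>r. (\<forall>k<m. r k = (\<lambda>j. Re (c k j)) \<or> r k = (\<lambda>j. Im (c k j))) \<and>
      cmod (fdet n c) \<le> 2 ^ m * cmod (fdet n (\<lambda>k. if k < m then \<lambda>j. complex_of_real (r k j) else c k))" if "m \<le> n" for m
    using that
  proof (induction m)
    case 0
    show ?case by simp
  next
    case (Suc m)
    then obtain r where r: "\<And>k. k < m \<Longrightarrow> r k = (\<lambda>j. Re (c k j)) \<or> r k = (\<lambda>j. Im (c k j))"
      "cmod (fdet n c) \<le> 2 ^ m * cmod (fdet n (\<lambda>k. if k < m then \<lambda>j. complex_of_real (r k j) else c k))" by auto
    let ?A = "\<lambda>k. if k < m then \<lambda>j. complex_of_real (r k j) else c k"
    let ?R = "fdet n (?A(m := \<lambda>j. complex_of_real (Re (c m j))))" and ?I = "fdet n (?A(m := \<lambda>j. complex_of_real (Im (c m j))))"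
    have m: "m < n" using Suc.prems by simp
    have "fdet n ?A = fdet n (?A(m := \<lambda>j. complex_of_real (Re (c m j)) + \<i> * complex_of_real (Im (c m j))))"
      by (rule fdet_cong) (auto simp: complex_eq[symmetric])
    also have "\<dots> = ?R + fdet n (?A(m := \<lambda>j. \<i> * complex_of_real (Im (c m j))))" by (rule fdet_row_add[OF m])
    also have "fdet n (?A(m := \<lambda>j. \<i> * complex_of_real (Im (c m j)))) = \<i> * ?I"
      using fdet_multrow[OF m, of "?A(m := \<lambda>j. complex_of_real (Im (c m j)))" \<i>] by simp
    finally have split: "fdet n ?A = ?R + \<i> * ?I" .
    have "cmod (a + \<i> * b) \<le> cmod a + cmod b" for a b
      using norm_triangle_ineq[of a "\<i> * b"] by (simp add: norm_mult)
    from this[of ?R ?I] have "cmod (fdet n ?A) \<le> cmod ?R + cmod ?I" by (simp only: split)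
    then have "cmod (fdet n ?A) \<le> 2 * cmod ?R \<or> cmod (fdet n ?A) \<le> 2 * cmod ?I" by linarith
    then obtain f where f: "f = (\<lambda>j. Re (c m j)) \<or> f = (\<lambda>j. Im (c m j))"
      "cmod (fdet n ?A) \<le> 2 * cmod (fdet n (?A(m := \<lambda>j. complex_of_real (f j))))"
      by (elim disjE) (rule that, rule disjI1, rule refl, assumption, rule that, rule disjI2, rule refl, assumption)
    have eq: "?A(m := \<lambda>j. complex_of_real (f j)) = (\<lambda>k. if k < Suc m then \<lambda>j. complex_of_real ((r(m := f)) k j) else c k)"
      by (auto simp: fun_eq_iff)
    have "cmod (fdet n c) \<le> 2 ^ m * (2 * cmod (fdet n (?A(m := \<lambda>j. complex_of_real (f j)))))"
      by (rule order_trans[OF r(2)]) (use f(2) in \<open>intro mult_left_mono, auto\<close>)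
    then show ?case unfolding eq
      by (intro exI[of _ "r(m := f)"]) (use r f in \<open>auto simp: less_Suc_eq\<close>)
  qed
  from this[of n] obtain r where r: "\<And>k. k < n \<Longrightarrow> r k = (\<lambda>j. Re (c k j)) \<or> r k = (\<lambda>j. Im (c k j))"
      "cmod (fdet n c) \<le> 2 ^ n * cmod (fdet n (\<lambda>k. if k < n then \<lambda>j. complex_of_real (r k j) else c k))" by auto
  have "fdet n (\<lambda>k. if k < n then \<lambda>j. complex_of_real (r k j) else c k) = fdet n (\<lambda>k j. complex_of_real (r k j))"
    by (rule fdet_cong) auto
  then show ?thesis using r by (intro exI[of _ r]) (simp add: fdet_of_real)
qed

text \<open>Each row of the real matrix r is the real or imaginary part of a form, so the body lies
  in the preimage under r of a box of volume 2^n times the product of the b_k. Passing from det r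
  back to det c costs the other 2^n.\<close>

lemma emeasure_form_body_le:
  assumes fdet: "fdet n c \<noteq> 0" and b: "\<And>k. k < n \<Longrightarrow> b k > 0"
  shows "emeasure (real_space n) (form_body n n c b) \<le> ennreal (4 ^ n * (\<Prod>k<n. b k) / cmod (fdet n c))"
proof -
  obtain r :: "nat \<Rightarrow> nat \<Rightarrow> real" where r: "\<And>k. k < n \<Longrightarrow> r k = (\<lambda>j. Re (c k j)) \<or> r k = (\<lambda>j. Im (c k j))"
    "cmod (fdet n c) \<le> 2 ^ n * \<bar>fdet n r\<bar>"
    using fdet_real_rows[of n c] by auto
  have dr: "\<bar>fdet n r\<bar> > 0" using r(2) fdet by (cases "fdet n r = 0") auto
  let ?E = "Pi\<^sub>E {..<n} (\<lambda>k. {- b k .. b k})"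
  have E: "?E \<in> sets (real_space n)" unfolding real_space_def by (intro sets_PiM_I_finite) auto
  have "emeasure (real_space n) ?E = (\<Prod>k<n. emeasure lborel {- b k .. b k})" by (rule emeasure_real_space_box) auto
  also have "\<dots> = (\<Prod>k<n. ennreal (2 * b k))" using b by (intro prod.cong) (auto simp: less_imp_le)
  also have "\<dots> = ennreal (2 ^ n * (\<Prod>k<n. b k))" using b by (subst prod_ennreal) (auto simp: prod.distrib less_imp_le)
  finally have vE: "emeasure (real_space n) ?E = ennreal (2 ^ n * (\<Prod>k<n. b k))" .
  let ?B = "mat_act n r -` ?E \<inter> space (real_space n)"
  have "form_body n n c b \<subseteq> ?B"
  proof
    fix x assume x: "x \<in> form_body n n c b"
    have "\<bar>mat_act n r x k\<bar> \<le> b k" if k: "k < n" for k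
    proof -
      have "\<bar>mat_act n r x k\<bar> \<le> cmod (lin_form_real n (c k) x)"
        using r(1)[OF k] abs_Re_le_cmod[of "lin_form_real n (c k) x"] abs_Im_le_cmod[of "lin_form_real n (c k) x"] k
        unfolding Re_lin_form_real Im_lin_form_real mat_act_nth[OF k] by auto
      then show ?thesis using x k by (auto simp: form_body_def)
    qed
    then have "mat_act n r x \<in> ?E" using mat_act_in_space[of n r x] by (auto simp: space_real_space PiE_iff abs_le_iff minus_le_iff)
    then show "x \<in> ?B" using x by (auto simp: form_body_def)
  qed
  then have "emeasure (real_space n) (form_body n n c b) \<le> emeasure (real_space n) ?B"
    by (rule emeasure_mono) (rule measurable_sets[OF measurable_mat_act E])
  also have "emeasure (real_space n) ?B = ennreal (2 ^ n * (\<Prod>k<n. b k) / \<bar>fdet n r\<bar>)"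
  proof -
    have P: "0 \<le> (\<Prod>k<n. b k)" using b by (intro prod_nonneg) (auto simp: less_imp_le)
    have "emeasure (real_space n) ?B * ennreal \<bar>fdet n r\<bar> = ennreal (2 ^ n * (\<Prod>k<n. b k))"
      using emeasure_mat_act_vimage[of n r, OF _ E] dr vE by auto
    then have "emeasure (real_space n) ?B * ennreal \<bar>fdet n r\<bar> = ennreal (2 ^ n * (\<Prod>k<n. b k) / \<bar>fdet n r\<bar>) * ennreal \<bar>fdet n r\<bar>"
      using dr P by (subst ennreal_mult'[symmetric]) auto
    then have "emeasure (real_space n) ?B * ennreal \<bar>fdet n r\<bar> / ennreal \<bar>fdet n r\<bar>
        = ennreal (2 ^ n * (\<Prod>k<n. b k) / \<bar>fdet n r\<bar>) * ennreal \<bar>fdet n r\<bar> / ennreal \<bar>fdet n r\<bar>" by simp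
    then show ?thesis using dr by (simp add: mult_divide_eq_ennreal)
  qed
  also have "\<dots> \<le> ennreal (4 ^ n * (\<Prod>k<n. b k) / cmod (fdet n c))"
  proof (rule ennreal_leI)
    have P: "0 \<le> (\<Prod>k<n. b k)" using b by (intro prod_nonneg) (auto simp: less_imp_le)
    have "(2 ^ n * (\<Prod>k<n. b k)) * cmod (fdet n c) \<le> (2 ^ n * (\<Prod>k<n. b k)) * (2 ^ n * \<bar>fdet n r\<bar>)"
      using P r(2) by (intro mult_left_mono) auto
    also have "\<dots> = (4 ^ n * (\<Prod>k<n. b k)) * \<bar>fdet n r\<bar>"
      using power_mult_distrib[of "2::real" 2 n] by simp
    finally show "2 ^ n * (\<Prod>k<n. b k) / \<bar>fdet n r\<bar> \<le> 4 ^ n * (\<Prod>k<n. b k) / cmod (fdet n c)"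
      using dr fdet by (simp add: field_simps)
  qed
  finally show ?thesis .
qed

lemma null_complex_hyperplane:
  assumes "p < n" "c p \<noteq> 0"
  shows "emeasure (real_space n) {x \<in> space (real_space n). lin_form_real n c x = 0} = 0"
proof -
  obtain r :: "nat \<Rightarrow> real" where r: "r p \<noteq> 0" "\<And>x. lin_form_real n c x = 0 \<Longrightarrow> (\<Sum>j<n. r j * x j) = 0"
  proof (cases "Re (c p) = 0")
    case True
    then have "Im (c p) \<noteq> 0" using assms(2) by (auto simp: complex_eq_iff)
    then show ?thesis using that[of "\<lambda>j. Im (c j)"] Im_lin_form_real[of n c] by (metis zero_complex.sel(2))
  next
    case False
    then show ?thesis using that[of "\<lambda>j. Re (c j)"] Re_lin_form_real[of n c] by (metis zero_complex.sel(1))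
  qed
  have "emeasure (real_space n) {x \<in> space (real_space n). lin_form_real n c x = 0}
      \<le> emeasure (real_space n) {x \<in> space (real_space n). (\<Sum>j<n. r j * x j) = 0}"
  proof (rule emeasure_mono)
    have "(\<lambda>x. \<Sum>j<n. r j * x j) \<in> borel_measurable (real_space n)"
      by (intro borel_measurable_sum borel_measurable_times borel_measurable_const measurable_real_space_component) auto
    then show "{x \<in> space (real_space n). (\<Sum>j<n. r j * x j) = 0} \<in> sets (real_space n)" by measurable
  qed (use r(2) in auto)
  then show ?thesis using null_hyperplane[of p n r] assms(1) r(1) by simp
qed

(* If the volume were finite, the map would preserve volume, so all the sets of x in S with
   |c x| < q^k (k an integer) would have the same volume. *)
lemma infinite_volume_of_expansion:
  assumes S: "S \<in> sets (real_space n)" and pos: "emeasure (real_space n) S > 0" and fdet: "fdet n A \<noteq> 0"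
    and inv: "\<And>x. x \<in> space (real_space n) \<Longrightarrow> mat_act n A x \<in> S \<longleftrightarrow> x \<in> S"
    and c: "p < n" "c p \<noteq> 0" and q: "q > 1"
    and expand: "\<And>x. x \<in> space (real_space n) \<Longrightarrow> cmod (lin_form_real n c (mat_act n A x)) = q * cmod (lin_form_real n c x)"
  shows "emeasure (real_space n) S = \<infinity>"
proof (rule ccontr)
  assume fin: "emeasure (real_space n) S \<noteq> \<infinity>"
  have Ssub: "S \<subseteq> space (real_space n)" using sets.sets_into_space[OF S] .
  have "mat_act n A -` S \<inter> space (real_space n) = S" using inv Ssub by auto
  then have "emeasure (real_space n) S * ennreal \<bar>fdet n A\<bar> = emeasure (real_space n) S" using emeasure_mat_act_vimage[OF fdet S] by simp
  moreover obtain v where v: "emeasure (real_space n) S = ennreal v" "v > 0"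
    using fin pos by (cases "emeasure (real_space n) S") auto
  ultimately have "v * \<bar>fdet n A\<bar> = v" by (simp flip: ennreal_mult')
  then have dt1: "\<bar>fdet n A\<bar> = 1" using v by simp
  define U where "U t = {x \<in> S. cmod (lin_form_real n c x) < t}" for t
  have U: "U t \<in> sets (real_space n)" for t
  proof -
    have "{x \<in> space (real_space n). cmod (lin_form_real n c x) < t} \<in> sets (real_space n)" by measurable
    from sets.Int[OF S this] show ?thesis using Ssub by (auto simp: U_def Int_def intro: back_subst[of "\<lambda>X. X \<in> sets (real_space n)"])
  qed
  have Uq: "emeasure (real_space n) (U (q * t)) = emeasure (real_space n) (U t)" for t
  proof -
    have "mat_act n A -` U (q * t) \<inter> space (real_space n) = U t" using inv expand q Ssub by (auto simp: U_def)
    then show ?thesis using emeasure_mat_act_vimage[OF fdet U, of "q * t"] dt1 by simp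
  qed
  have Up: "emeasure (real_space n) (U (q ^ k)) = emeasure (real_space n) (U 1)" for k
    by (induction k) (auto simp: Uq)
  have Um: "emeasure (real_space n) (U (1 / q ^ k)) = emeasure (real_space n) (U 1)" for k
  proof (induction k)
    case (Suc k)
    have "q * (1 / q ^ Suc k) = 1 / q ^ k" using q by simp
    then show ?case using Uq[of "1 / q ^ Suc k"] Suc by simp
  qed simp
  have pw: "q ^ k \<le> q ^ Suc k" for k using q by simp
  \<comment> \<open>For growing k these sets exhaust S, so \<open>U 1\<close> has the full volume of
    S. With 1 / q^k in place of q^k they shrink into a hyperplane, which would give
    \<open>U 1\<close> volume 0.\<close>
  have "incseq (\<lambda>k. U (q ^ k))"
    by (rule incseq_SucI) (use pw in \<open>auto simp: U_def intro: less_le_trans\<close>)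
  then have "(\<lambda>k. emeasure (real_space n) (U (q ^ k))) \<longlonglongrightarrow> emeasure (real_space n) (\<Union>k. U (q ^ k))"
    by (intro Lim_emeasure_incseq) (use U in auto)
  moreover have "(\<Union>k. U (q ^ k)) = S" using real_arch_pow[OF q] by (auto simp: U_def)
  ultimately have 1: "emeasure (real_space n) S = emeasure (real_space n) (U 1)"
    unfolding Up using LIMSEQ_unique tendsto_const by metis
  have "decseq (\<lambda>k. U (1 / q ^ k))"
  proof (rule decseq_SucI)
    fix k
    have "1 / q ^ Suc k \<le> 1 / q ^ k" using pw[of k] q by (intro divide_left_mono) auto
    then show "U (1 / q ^ Suc k) \<subseteq> U (1 / q ^ k)" unfolding U_def by (auto intro: less_le_trans)
  qed
  then have "(\<lambda>k. emeasure (real_space n) (U (1 / q ^ k))) \<longlonglongrightarrow> emeasure (real_space n) (\<Inter>k. U (1 / q ^ k))"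
    by (intro Lim_emeasure_decseq) (use U Um 1 fin in auto)
  then have "emeasure (real_space n) (U 1) = emeasure (real_space n) (\<Inter>k. U (1 / q ^ k))"
    unfolding Um using LIMSEQ_unique tendsto_const by metis
  also have "\<dots> \<le> emeasure (real_space n) {x \<in> space (real_space n). lin_form_real n c x = 0}"
  proof (rule emeasure_mono)
    show "(\<Inter>k. U (1 / q ^ k)) \<subseteq> {x \<in> space (real_space n). lin_form_real n c x = 0}"
    proof
      fix x assume x: "x \<in> (\<Inter>k. U (1 / q ^ k))"
      have "cmod (lin_form_real n c x) = 0"
      proof (rule ccontr)
        assume "cmod (lin_form_real n c x) \<noteq> 0"
        then have pos: "cmod (lin_form_real n c x) > 0" by simp
        obtain k where "1 / cmod (lin_form_real n c x) < q ^ k" using real_arch_pow[OF q] by blast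
        then have "1 / q ^ k < cmod (lin_form_real n c x)" using pos q by (simp add: field_simps)
        moreover have "cmod (lin_form_real n c x) < 1 / q ^ k" using x by (auto simp: U_def)
        ultimately show False by simp
      qed
      then show "x \<in> {x \<in> space (real_space n). lin_form_real n c x = 0}" using x Ssub by (auto simp: U_def)
    qed
    show "{x \<in> space (real_space n). lin_form_real n c x = 0} \<in> sets (real_space n)" by measurable
  qed
  also have "\<dots> = 0" by (rule null_complex_hyperplane[of p n c, OF c])
  finally show False using 1 pos by simp
qed

section \<open>Evaluation of forms\<close>

abbreviation power_product :: "(nat \<Rightarrow> 'a::comm_semiring_1) \<Rightarrow> (nat \<Rightarrow>\<^sub>0 nat) \<Rightarrow> 'a" where
  "power_product x m \<equiv> (\<Prod>i\<in>Poly_Mapping.keys m. x i ^ Poly_Mapping.lookup m i)"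

lemma power_product_superset:
  assumes "finite A" "Poly_Mapping.keys m \<subseteq> A"
  shows "power_product x m = (\<Prod>i\<in>A. x i ^ Poly_Mapping.lookup m i)"
  using assms by (intro prod.mono_neutral_left) (auto simp: in_keys_iff)

lemma power_product_add: "power_product x (m + m') = power_product x m * power_product x m'"
proof -
  let ?A = "Poly_Mapping.keys m \<union> Poly_Mapping.keys m'"
  have "power_product x (m + m') = (\<Prod>i\<in>?A. x i ^ Poly_Mapping.lookup (m + m') i)"
    by (rule power_product_superset) (auto dest: subsetD[OF keys_add])
  also have "\<dots> = (\<Prod>i\<in>?A. x i ^ Poly_Mapping.lookup m i) * (\<Prod>i\<in>?A. x i ^ Poly_Mapping.lookup m' i)"
    by (simp add: lookup_add power_add prod.distrib)
  also have "\<dots> = power_product x m * power_product x m'"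
    by (simp add: power_product_superset[of ?A])
  finally show ?thesis .
qed

lemma eval_mpoly_superset:
  assumes "finite A" "Poly_Mapping.keys p \<subseteq> A"
  shows "eval_mpoly p x = (\<Sum>m\<in>A. Poly_Mapping.lookup p m * power_product x m)"
  unfolding eval_mpoly_def using assms by (intro sum.mono_neutral_left) (auto simp: in_keys_iff)

lemma eval_mpoly_add: "eval_mpoly (p + q) x = eval_mpoly p x + eval_mpoly q x"
proof -
  let ?A = "Poly_Mapping.keys p \<union> Poly_Mapping.keys q"
  have "eval_mpoly (p + q) x = (\<Sum>m\<in>?A. Poly_Mapping.lookup (p + q) m * power_product x m)"
    by (rule eval_mpoly_superset) (auto dest: subsetD[OF keys_add])
  then show ?thesis
    by (simp add: eval_mpoly_superset[of ?A] lookup_add distrib_right sum.distrib)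
qed

lemma eval_mpoly_0 [simp]: "eval_mpoly 0 x = 0"
  by (simp add: eval_mpoly_def)

lemma eval_mpoly_single: "eval_mpoly (Poly_Mapping.single m c) x = c * power_product x m"
  by (simp add: eval_mpoly_def)

lemma mpoly_induct [case_names zero add_single]:
  fixes p :: "'a::comm_monoid_add mpoly"
  assumes "P 0" "\<And>p m c. P p \<Longrightarrow> P (p + Poly_Mapping.single m c)"
  shows "P p"
proof (induction p rule: update_induct)
  case const
  show ?case by (rule assms(1))
next
  case (update p k c)
  have "Poly_Mapping.update k c p = p + Poly_Mapping.single k c"
    using update(1) by (intro poly_mapping_eqI) (auto simp: lookup_update lookup_add lookup_single in_keys_iff)
  then show ?case using assms(2) update by metis
qed

lemma eval_mpoly_mult: "eval_mpoly (p * q) x = eval_mpoly p x * eval_mpoly q x"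
proof (induction p rule: mpoly_induct)
  case (add_single p m c)
  have "eval_mpoly (Poly_Mapping.single m c * q) x = c * power_product x m * eval_mpoly q x"
    by (induction q rule: mpoly_induct)
      (simp_all add: distrib_left eval_mpoly_add mult_single eval_mpoly_single power_product_add mult_ac)
  then show ?case using add_single by (simp add: distrib_right eval_mpoly_add eval_mpoly_single)
qed simp

lemma eval_mpoly_1 [simp]: "eval_mpoly 1 x = 1"
  by (simp add: eval_mpoly_def)

lemma eval_mpoly_prod: "eval_mpoly (\<Prod>i\<in>A. p i) x = (\<Prod>i\<in>A. eval_mpoly (p i) x)"
  by (induction A rule: infinite_finite_induct) (simp_all add: eval_mpoly_mult)

lemma eval_of_int_mpoly:
  "eval_mpoly (of_int_mpoly F) x = (\<Sum>m\<in>Poly_Mapping.keys F. of_int (Poly_Mapping.lookup F m) * power_product x m)"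
proof -
  have "eval_mpoly (of_int_mpoly F) x = (\<Sum>m\<in>Poly_Mapping.keys F.
      Poly_Mapping.lookup (of_int_mpoly F) m * power_product x m)"
    by (rule eval_mpoly_superset) (auto simp: of_int_mpoly_def in_keys_iff Poly_Mapping.map.rep_eq when_def)
  then show ?thesis
    by (auto simp: of_int_mpoly_def Poly_Mapping.map.rep_eq when_def intro!: sum.cong)
qed

lemma eval_of_int_mpoly_of_int:
  "eval_mpoly (of_int_mpoly F) (\<lambda>j. of_int (z j)) = of_int (eval_mpoly F z)"
  unfolding eval_of_int_mpoly by (simp add: eval_mpoly_def)

lemma eval_of_int_mpoly_of_real:
  "eval_mpoly (of_int_mpoly F) (\<lambda>j. complex_of_real (x j)) = of_real (eval_mpoly (of_int_mpoly F) x)"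
  unfolding eval_of_int_mpoly by simp

lemma eval_of_int_mpoly_cnj:
  "eval_mpoly (of_int_mpoly F) (\<lambda>j. cnj (x j)) = cnj (eval_mpoly (of_int_mpoly F) x)"
  unfolding eval_of_int_mpoly by simp

section \<open>Polynomials with integral coefficients\<close>

lemma coeff_mult_Ints:
  assumes "\<And>k. coeff p k \<in> \<int>" "\<And>k. coeff q k \<in> \<int>"
  shows "coeff (p * q) k \<in> (\<int> :: 'a :: comm_ring_1 set)"
  unfolding coeff_mult using assms by (intro Ints_sum Ints_mult)

lemma coeff_prod_Ints:
  assumes "\<And>i k. i \<in> A \<Longrightarrow> coeff (p i) k \<in> \<int>"
  shows "coeff (\<Prod>i\<in>A. p i) k \<in> (\<int> :: 'a :: comm_ring_1 set)"
  using assms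
proof (induction A arbitrary: k rule: infinite_finite_induct)
  case (insert x A)
  have "coeff (p x * (\<Prod>i\<in>A. p i)) k \<in> \<int>" using insert by (intro coeff_mult_Ints) auto
  then show ?case using insert by simp
qed (auto simp: coeff_1)

lemma coeff_power_Ints:
  assumes "\<And>k. coeff p k \<in> \<int>"
  shows "coeff (p ^ e) k \<in> (\<int> :: 'a :: comm_ring_1 set)"
  using coeff_prod_Ints[of "{..<e}" "\<lambda>_. p"] assms by simp

text \<open>The restriction of F to the line through z in direction t. Its zeros encode the ratios
  of the values of the linear factors at t and z, so this is where the integrality of F reaches the
  factors.\<close>

lemma eval_on_line_poly:
  fixes z t :: "nat \<Rightarrow> int"
  obtains P :: "complex poly" where "\<And>k. coeff P k \<in> \<int>"
    "\<And>X. poly P X = eval_mpoly (of_int_mpoly F) (\<lambda>j. of_int (z j) + X * of_int (t j))"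
proof (rule that)
  let ?q = "\<lambda>j. [:of_int (z j), of_int (t j):] :: complex poly"
  let ?P = "\<Sum>m\<in>Poly_Mapping.keys F. [:of_int (Poly_Mapping.lookup F m):] *
     (\<Prod>j\<in>Poly_Mapping.keys m. ?q j ^ Poly_Mapping.lookup m j)"
  show "coeff ?P k \<in> \<int>" for k
    unfolding coeff_sum
    by (intro Ints_sum coeff_mult_Ints coeff_prod_Ints coeff_power_Ints) (auto simp: coeff_pCons split: nat.splits)
  show "poly ?P X = eval_mpoly (of_int_mpoly F) (\<lambda>j. of_int (z j) + X * of_int (t j))" for X
    unfolding eval_of_int_mpoly by (simp add: poly_sum poly_prod)
qed

section \<open>Linear factors of a decomposable form\<close>

lemma linear_form_eval:
  assumes L: "is_form n 1 L" "L \<noteq> 0"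
  obtains c where "\<exists>j<n. c j \<noteq> 0" "\<And>x. eval_mpoly L x = lin_form n c x"
proof -
  let ?s = "\<lambda>j::nat. Poly_Mapping.single j (1::nat)"
  have sub: "Poly_Mapping.keys L \<subseteq> ?s ` {..<n}"
  proof
    fix m assume "m \<in> Poly_Mapping.keys L"
    then have m: "Poly_Mapping.keys m \<subseteq> {..<n}" "(\<Sum>i\<in>Poly_Mapping.keys m. Poly_Mapping.lookup m i) = 1"
      using L(1) by (auto simp: is_form_def)
    from m(2) have "\<exists>j\<in>Poly_Mapping.keys m. Poly_Mapping.lookup m j = 1 \<and>
        (\<forall>i\<in>Poly_Mapping.keys m. j \<noteq> i \<longrightarrow> Poly_Mapping.lookup m i = 0)"
      using sum_eq_1_iff[of "Poly_Mapping.keys m" "Poly_Mapping.lookup m"] by simp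
    then obtain j where j: "j \<in> Poly_Mapping.keys m" "Poly_Mapping.lookup m j = 1"
      "\<And>i. i \<in> Poly_Mapping.keys m \<Longrightarrow> i \<noteq> j \<Longrightarrow> Poly_Mapping.lookup m i = 0"
      by auto
    have "m = ?s j" using j by (intro poly_mapping_eqI) (auto simp: lookup_single when_def in_keys_iff)
    then show "m \<in> ?s ` {..<n}" using j(1) m(1) by auto
  qed
  have inj: "inj_on ?s {..<n}"
    by (rule inj_onI) (metis lookup_single_eq lookup_single_not_eq zero_neq_one)
  define c where "c j = Poly_Mapping.lookup L (?s j)" for j
  have "eval_mpoly L x = lin_form n c x" for x
  proof -
    have "eval_mpoly L x = (\<Sum>m\<in>?s ` {..<n}. Poly_Mapping.lookup L m * power_product x m)"
      by (rule eval_mpoly_superset[OF _ sub]) simp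
    also have "\<dots> = lin_form n c x" by (subst sum.reindex[OF inj]) (simp add: lin_form_def c_def)
    finally show ?thesis .
  qed
  moreover have "\<exists>j<n. c j \<noteq> 0"
  proof -
    obtain m where "m \<in> Poly_Mapping.keys L" using L(2) by (metis keys_eq_empty equals0I)
    then show ?thesis using sub by (auto simp: c_def in_keys_iff)
  qed
  ultimately show ?thesis using that by blast
qed

lemma decomposable_form_factors:
  assumes "decomposable_form n d F"
  obtains c :: "nat \<Rightarrow> nat \<Rightarrow> complex" where "\<And>i. i < d \<Longrightarrow> \<exists>j<n. c i j \<noteq> 0"
    "\<And>x. eval_mpoly (of_int_mpoly F) x = (\<Prod>i<d. lin_form n (c i) x)"
proof -
  obtain L :: "nat \<Rightarrow> complex mpoly" where L: "\<And>i. i < d \<Longrightarrow> is_form n 1 (L i) \<and> L i \<noteq> 0"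
    "of_int_mpoly F = (\<Prod>i<d. L i)" using assms by (auto simp: decomposable_form_def)
  have "\<forall>i\<in>{..<d}. \<exists>c. (\<exists>j<n. c j \<noteq> 0) \<and> (\<forall>x. eval_mpoly (L i) x = lin_form n c x)"
  proof
    fix i assume "i \<in> {..<d}"
    then have "is_form n 1 (L i)" "L i \<noteq> 0" using L(1) by auto
    then show "\<exists>c. (\<exists>j<n. c j \<noteq> 0) \<and> (\<forall>x. eval_mpoly (L i) x = lin_form n c x)"
      by (rule linear_form_eval) auto
  qed
  then obtain c where "\<forall>i\<in>{..<d}. (\<exists>j<n. c i j \<noteq> 0) \<and> (\<forall>x. eval_mpoly (L i) x = lin_form n (c i) x)"
    by (drule_tac bchoice) blast
  then show ?thesis by (intro that[of c]) (auto simp: L(2) eval_mpoly_prod)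
qed

section \<open>Integrality of symmetric functions\<close>

(* With E the product of the 1 + c_i X, the generating series of the signed power sums is
   (d E - X E') / E, and E has constant term 1. *)
lemma power_sum_Ints:
  fixes c :: "nat \<Rightarrow> complex"
  assumes E: "\<And>k. coeff (\<Prod>i<d. [:1, c i:]) k \<in> \<int>"
  shows "(\<Sum>i<d. c i ^ k) \<in> \<int>"
proof -
  define E where "E = (\<Prod>i<d. [:1, c i:])"
  define R where "R = of_nat d * E - [:0, 1:] * pderiv E"
  define g where "g k = (\<Sum>i<d. (- c i) ^ k)" for k
  have Ei: "coeff E k \<in> \<int>" for k using E by (simp add: E_def)
  have E0: "coeff E 0 = 1"
    unfolding E_def poly_0_coeff_0[symmetric] by (simp add: poly_prod)
  \<comment> \<open>Product rule for E; in the i-th summand the remaining factor is (1 + c_i X) -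
    c_i X = 1.\<close>
  have "R = (\<Sum>i<d. \<Prod>j\<in>{..<d} - {i}. [:1, c j:])"
  proof -
    have "[:0, 1:] * pderiv E = (\<Sum>i<d. (\<Prod>j\<in>{..<d} - {i}. [:1, c j:]) * [:0, c i:])"
      unfolding E_def pderiv_prod sum_distrib_left
      by (intro sum.cong refl) (simp add: pderiv_pCons mult.commute[of "[:0, 1:]"] mult.assoc)
    moreover have "of_nat d * E = (\<Sum>i<d. (\<Prod>j\<in>{..<d} - {i}. [:1, c j:]) * [:1, c i:])"
    proof -
      have "(\<Prod>j\<in>{..<d} - {i}. [:1, c j:]) * [:1, c i:] = E" if "i \<in> {..<d}" for i
        unfolding E_def using that by (subst (2) prod.remove[of _ i]) auto
      then show ?thesis by simp
    qed
    ultimately have "R = (\<Sum>i<d. (\<Prod>j\<in>{..<d} - {i}. [:1, c j:]) * ([:1, c i:] - [:0, c i:]))"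
      unfolding R_def by (simp only: sum_subtractf right_diff_distrib)
    then show ?thesis by (simp add: one_pCons[symmetric])
  qed
  moreover have "fps_of_poly E * Abs_fps g = fps_of_poly (\<Sum>i<d. \<Prod>j\<in>{..<d} - {i}. [:1, c j:])"
  proof -
    \<comment> \<open>Geometric series: the inverse of 1 + a X.\<close>
    have inv: "fps_of_poly [:1, a:] * Abs_fps (\<lambda>k. (- a) ^ k) = 1" for a :: complex
    proof (rule fps_ext)
      fix k show "fps_nth (fps_of_poly [:1, a:] * Abs_fps (\<lambda>k. (- a) ^ k)) k = fps_nth 1 k"
        by (cases k) (simp_all add: fps_of_poly_pCons distrib_right mult.assoc)
    qed
    have "Abs_fps g = (\<Sum>i<d. Abs_fps (\<lambda>k. (- c i) ^ k))"
      by (rule fps_ext) (simp add: g_def fps_sum_nth)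
    then have "fps_of_poly E * Abs_fps g = (\<Sum>i<d. fps_of_poly E * Abs_fps (\<lambda>k. (- c i) ^ k))"
      by (simp add: sum_distrib_left)
    also have "\<dots> = (\<Sum>i<d. fps_of_poly (\<Prod>j\<in>{..<d} - {i}. [:1, c j:]))"
    proof (intro sum.cong refl)
      fix i assume i: "i \<in> {..<d}"
      have "E = (\<Prod>j\<in>{..<d} - {i}. [:1, c j:]) * [:1, c i:]"
        unfolding E_def using i by (subst prod.remove[of _ i]) auto
      then have "fps_of_poly E * Abs_fps (\<lambda>k. (- c i) ^ k) =
         fps_of_poly (\<Prod>j\<in>{..<d} - {i}. [:1, c j:]) * (fps_of_poly [:1, c i:] * Abs_fps (\<lambda>k. (- c i) ^ k))"
        by (simp only: fps_of_poly_mult mult.assoc)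
      then show "fps_of_poly E * Abs_fps (\<lambda>k. (- c i) ^ k) = fps_of_poly (\<Prod>j\<in>{..<d} - {i}. [:1, c j:])"
        by (simp only: inv mult_1_right)
    qed
    finally show ?thesis by (simp add: fps_of_poly_sum)
  qed
  ultimately have conv: "fps_of_poly E * Abs_fps g = fps_of_poly R" by simp
  have Ri: "coeff R k \<in> \<int>" for k
    unfolding R_def of_nat_poly coeff_diff coeff_mult[of "[:0, 1:]"]
    using Ei by (intro Ints_diff coeff_mult_Ints Ints_sum Ints_mult)
      (auto simp: coeff_pCons coeff_pderiv split: nat.splits intro!: Ints_mult Ints_add)
  \<comment> \<open>Because E has constant term 1, comparing coefficients expresses g k through
    integers and earlier values of g without any division.\<close>
  have "g k \<in> \<int>"
  proof (induction k rule: less_induct)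
    case (less k)
    have "coeff R k = (\<Sum>l=0..k. coeff E l * g (k - l))"
      using arg_cong[OF conv, of "\<lambda>f. fps_nth f k"] by (simp add: fps_mult_nth)
    also have "\<dots> = g k + (\<Sum>l\<in>{0..k} - {0}. coeff E l * g (k - l))"
      by (subst sum.remove[of _ 0]) (auto simp: E0)
    finally have "g k = coeff R k - (\<Sum>l\<in>{0..k} - {0}. coeff E l * g (k - l))" by simp
    also have "\<dots> \<in> \<int>" using Ri Ei less by (intro Ints_diff Ints_sum Ints_mult) auto
    finally show ?case .
  qed
  moreover have "(\<Sum>i<d. c i ^ k) = (- 1) ^ k * g k"
    by (simp add: g_def sum_distrib_left power_mult_distrib[symmetric])
  ultimately show ?thesis by (simp add: Ints_mult)
qed

(* Both sides are k! times the coefficient of X^k in the product of the exp (y l * X) - 1. *)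
lemma polarization:
  fixes y :: "nat \<Rightarrow> complex"
  shows "(\<Sum>S\<in>Pow {..<k}. (- 1) ^ (k - card S) * (\<Sum>l\<in>S. y l) ^ k) = fact k * (\<Prod>l<k. y l)"
proof -
  have exp: "(\<Prod>l\<in>S. fps_exp (y l)) = fps_exp (\<Sum>l\<in>S. y l)" if "finite S" for S
    using that by (induction S rule: finite_induct) (auto simp: fps_exp_add_mult)
  have "(\<Prod>l<k. fps_exp (y l) - 1) = (\<Prod>l<k. fps_exp (y l) + (- 1))" by simp
  also have "\<dots> = (\<Sum>S\<in>Pow {..<k}. (\<Prod>l\<in>S. fps_exp (y l)) * (\<Prod>l\<in>{..<k} - S. - 1))"
    by (rule prod_add) simp
  also have "\<dots> = (\<Sum>S\<in>Pow {..<k}. fps_const ((- 1) ^ (k - card S)) * fps_exp (\<Sum>l\<in>S. y l))"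
  proof (intro sum.cong refl)
    fix S assume "S \<in> Pow {..<k}"
    then have "finite S" "card ({..<k} - S) = k - card S"
      by (auto simp: card_Diff_subset finite_subset)
    then show "(\<Prod>l\<in>S. fps_exp (y l)) * (\<Prod>l\<in>{..<k} - S. - 1) =
        fps_const ((- 1) ^ (k - card S)) * fps_exp (\<Sum>l\<in>S. y l)"
      by (simp add: exp fps_const_power[symmetric] fps_const_neg[symmetric] mult.commute del: fps_const_neg fps_const_power)
  qed
  finally have "fps_nth (\<Prod>l<k. fps_exp (y l) - 1) k
     = (\<Sum>S\<in>Pow {..<k}. (- 1) ^ (k - card S) * ((\<Sum>l\<in>S. y l) ^ k / fact k))"
    by (simp add: fps_sum_nth)
  moreover have "fps_nth (\<Prod>l<k. fps_exp (y l) - 1) k = (\<Prod>l<k. y l)"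
  proof -
    \<comment> \<open>Each factor is divisible by X with linear coefficient y l, so only these
      linear terms contribute to the coefficient of X^k.\<close>
    have "(\<Prod>l<m. fps_exp (y l) - 1) = fps_X ^ m * (\<Prod>l<m. fps_shift 1 (fps_exp (y l)))" for m
    proof (induction m)
      case (Suc m)
      have "fps_exp (y m) - 1 = fps_X * fps_shift 1 (fps_exp (y m))"
        by (rule fps_ext) auto
      then show ?case using Suc by (simp add: mult_ac)
    qed simp
    moreover have "fps_nth (\<Prod>l<m. fps_shift 1 (fps_exp (y l))) 0 = (\<Prod>l<m. y l)" for m
      by (induction m) auto
    ultimately show ?thesis by (simp add: fps_X_power_mult_nth)
  qed
  ultimately have "(\<Prod>l<k. y l) = (\<Sum>S\<in>Pow {..<k}. (- 1) ^ (k - card S) * (\<Sum>l\<in>S. y l) ^ k) / fact k"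
    by (simp add: sum_divide_distrib)
  then show ?thesis by simp
qed

(* Polynomials with integer coefficients, homogeneous of total degree k in the entries of the rows
   Y 0, ..., Y (d - 1), represented as functions; js i lists the columns of the factors from row i. *)
inductive int_poly_fun :: "nat \<Rightarrow> nat \<Rightarrow> nat \<Rightarrow> ((nat \<Rightarrow> nat \<Rightarrow> complex) \<Rightarrow> complex) \<Rightarrow> bool" for d n where
  mono: "(\<And>i. i < d \<Longrightarrow> set (js i) \<subseteq> {..<n}) \<Longrightarrow> (\<Sum>i<d. length (js i)) = k \<Longrightarrow>
    int_poly_fun d n k (\<lambda>Y. \<Prod>i<d. prod_list (map (Y i) (js i)))"
| zero: "int_poly_fun d n k (\<lambda>Y. 0)"
| add: "int_poly_fun d n k G \<Longrightarrow> int_poly_fun d n k H \<Longrightarrow> int_poly_fun d n k (\<lambda>Y. G Y + H Y)"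
| uminus: "int_poly_fun d n k G \<Longrightarrow> int_poly_fun d n k (\<lambda>Y. - G Y)"

lemma int_poly_fun_one: "int_poly_fun d n 0 (\<lambda>Y. 1)"
  using int_poly_fun.mono[of d "\<lambda>_. []" n 0] by simp

lemma int_poly_fun_var:
  assumes "i < d" "j < n"
  shows "int_poly_fun d n 1 (\<lambda>Y. Y i j)"
proof -
  have len: "(\<Sum>l<d. length (if l = i then [j] else [])) = 1"
    using assms by (subst sum.remove[of _ i]) auto
  have "int_poly_fun d n 1 (\<lambda>Y. \<Prod>l<d. prod_list (map (Y l) (if l = i then [j] else [])))"
    by (rule int_poly_fun.mono[OF _ len]) (use assms in auto)
  also have "(\<lambda>Y :: nat \<Rightarrow> nat \<Rightarrow> complex. \<Prod>l<d. prod_list (map (Y l) (if l = i then [j] else []))) = (\<lambda>Y. Y i j)"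
  proof (rule ext)
    fix Y :: "nat \<Rightarrow> nat \<Rightarrow> complex"
    show "(\<Prod>l<d. prod_list (map (Y l) (if l = i then [j] else []))) = Y i j"
      using assms by (subst prod.remove[of _ i]) auto
  qed
  finally show ?thesis .
qed

lemma int_poly_fun_mult:
  assumes "int_poly_fun d n k G" "int_poly_fun d n l H"
  shows "int_poly_fun d n (k + l) (\<lambda>Y. G Y * H Y)"
  using assms(1)
proof induction
  case (mono js k)
  note m = this
  show ?case using assms(2)
  proof induction
    case (mono js' l)
    have "int_poly_fun d n (k + l) (\<lambda>Y. \<Prod>i<d. prod_list (map (Y i) (js i @ js' i)))"
      using m mono by (intro int_poly_fun.mono) (auto simp: sum.distrib)
    then show ?case by (simp add: prod.distrib)
  next
    case (add l G' H')
    then show ?case using int_poly_fun.add[OF add.IH] by (simp add: distrib_left)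
  next
    case (uminus l G')
    then show ?case using int_poly_fun.uminus[OF uminus.IH] by simp
  qed (simp add: int_poly_fun.zero)
next
  case (add k G' H')
  then show ?case using int_poly_fun.add[OF add.IH] by (simp add: distrib_right)
next
  case (uminus k G')
  then show ?case using int_poly_fun.uminus[OF uminus.IH] by simp
qed (simp add: int_poly_fun.zero)

lemma int_poly_fun_prod:
  assumes "finite A" "\<And>a. a \<in> A \<Longrightarrow> int_poly_fun d n k (G a)"
  shows "int_poly_fun d n (k * card A) (\<lambda>Y. \<Prod>a\<in>A. G a Y)"
  using assms by (induction A rule: finite_induct) (auto simp: int_poly_fun_one intro!: int_poly_fun_mult)

lemma int_poly_fun_sum:
  assumes "finite A" "\<And>a. a \<in> A \<Longrightarrow> int_poly_fun d n k (G a)"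
  shows "int_poly_fun d n k (\<lambda>Y. \<Sum>a\<in>A. G a Y)"
  using assms by (induction A rule: finite_induct) (auto simp: int_poly_fun.zero intro!: int_poly_fun.add)

lemma int_poly_fun_fdet:
  assumes "\<And>k. k < n \<Longrightarrow> \<tau> k < d"
  shows "int_poly_fun d n n (\<lambda>Y. fdet n (\<lambda>k. Y (\<tau> k)))"
  unfolding fdet_expand
proof (rule int_poly_fun_sum)
  fix p assume "p \<in> {p. p permutes {0..<n}}"
  then have p: "p k < n" if "k < n" for k
    using that permutes_in_image[of p "{0..<n}" k] by auto
  have *: "int_poly_fun d n (1 * card {..<n}) (\<lambda>Y. \<Prod>k<n. Y (\<tau> k) (p k))"
    using assms p by (intro int_poly_fun_prod int_poly_fun_var) auto
  show "int_poly_fun d n n (\<lambda>Y. signof p * (\<Prod>k<n. Y (\<tau> k) (p k)))"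
  proof (cases "sign p = 1")
    case True
    then show ?thesis using * by simp
  next
    case False
    then have "sign p = -1" by (metis sign_def)
    then show ?thesis using int_poly_fun.uminus[OF *] by simp
  qed
qed (simp add: finite_permutations)

text \<open>For r = d these are the permutations of the forms, as extensional functions. Smaller r
  occur because sums over permutations are built up one value at a time.\<close>

definition injections :: "nat \<Rightarrow> nat \<Rightarrow> (nat \<Rightarrow> nat) set" where
  "injections r d = {\<phi> \<in> {..<r} \<rightarrow>\<^sub>E {..<d}. inj_on \<phi> {..<r}}"

lemma finite_injections: "finite (injections r d)"
  by (rule finite_subset[of _ "{..<r} \<rightarrow>\<^sub>E {..<d}"]) (auto simp: injections_def intro: finite_PiE)

lemma card_injections_le: "card (injections r d) \<le> d ^ r"
proof -
  have "card (injections r d) \<le> card ({..<r} \<rightarrow>\<^sub>E {..<d})"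
    by (intro card_mono) (auto simp: injections_def intro: finite_PiE)
  then show ?thesis by (simp add: card_PiE)
qed

(* The value at r ranges over everything but the values already taken; each forbidden value merges the
   factor r into an earlier factor. *)
lemma sum_injections_Suc:
  fixes g :: "nat \<Rightarrow> nat \<Rightarrow> 'a :: comm_ring_1"
  shows "(\<Sum>\<phi>\<in>injections (Suc r) d. \<Prod>l<Suc r. g l (\<phi> l)) =
    (\<Sum>i<d. g r i) * (\<Sum>\<phi>\<in>injections r d. \<Prod>l<r. g l (\<phi> l))
    - (\<Sum>k<r. \<Sum>\<phi>\<in>injections r d. \<Prod>l<r. (if l = k then g k (\<phi> l) * g r (\<phi> l) else g l (\<phi> l)))"
proof -
  let ?S = "SIGMA \<phi>:injections r d. {..<d} - \<phi> ` {..<r}"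
  have bij: "bij_betw (\<lambda>(\<phi>, i). \<phi>(r := i)) ?S (injections (Suc r) d)"
  proof (rule bij_betw_byWitness[where f' = "\<lambda>\<psi>. (restrict \<psi> {..<r}, \<psi> r)"])
    show "\<forall>a\<in>?S. (\<lambda>\<psi>. (restrict \<psi> {..<r}, \<psi> r)) ((\<lambda>(\<phi>, i). \<phi>(r := i)) a) = a"
    proof
      fix a assume "a \<in> ?S"
      then obtain \<phi> i where a: "a = (\<phi>, i)" "\<phi> \<in> injections r d" by auto
      have "restrict (\<phi>(r := i)) {..<r} = \<phi>"
        using a(2) by (auto simp: injections_def PiE_iff extensional_def fun_eq_iff)
      then show "(\<lambda>\<psi>. (restrict \<psi> {..<r}, \<psi> r)) ((\<lambda>(\<phi>, i). \<phi>(r := i)) a) = a" using a by simp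
    qed
    show "\<forall>\<psi>\<in>injections (Suc r) d. (\<lambda>(\<phi>, i). \<phi>(r := i)) (restrict \<psi> {..<r}, \<psi> r) = \<psi>"
      by (auto simp: injections_def PiE_iff extensional_def fun_eq_iff)
    show "(\<lambda>(\<phi>, i). \<phi>(r := i)) ` ?S \<subseteq> injections (Suc r) d"
    proof (rule subsetI, elim imageE)
      fix \<psi> a assume "a \<in> ?S" and \<psi>: "\<psi> = (\<lambda>(\<phi>, i). \<phi>(r := i)) a"
      then obtain \<phi> i where a: "a = (\<phi>, i)" "\<phi> \<in> injections r d" "i < d" "i \<notin> \<phi> ` {..<r}" by auto
      have "inj_on (\<phi>(r := i)) {..<Suc r}"
        using a by (auto simp: injections_def inj_on_def less_Suc_eq)
      then show "\<psi> \<in> injections (Suc r) d"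
        using a \<psi> by (auto simp: injections_def PiE_iff extensional_def less_Suc_eq)
    qed
    show "(\<lambda>\<psi>. (restrict \<psi> {..<r}, \<psi> r)) ` injections (Suc r) d \<subseteq> ?S"
    proof (rule subsetI, elim imageE)
      fix a \<psi> assume \<psi>: "\<psi> \<in> injections (Suc r) d" and a: "a = (restrict \<psi> {..<r}, \<psi> r)"
      have inj: "inj_on \<psi> {..<Suc r}" using \<psi> by (simp add: injections_def)
      have "\<psi> r \<notin> \<psi> ` {..<r}"
      proof
        assume "\<psi> r \<in> \<psi> ` {..<r}"
        then obtain x where "x < r" "\<psi> r = \<psi> x" by auto
        then show False using inj_onD[OF inj, of r x] by auto
      qed
      moreover have "inj_on (restrict \<psi> {..<r}) {..<r}" using inj by (auto simp: inj_on_def)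
      ultimately show "a \<in> ?S" using \<psi> a by (auto simp: injections_def PiE_iff less_Suc_eq image_iff)
    qed
  qed
  have "(\<Sum>\<phi>\<in>injections (Suc r) d. \<Prod>l<Suc r. g l (\<phi> l)) = (\<Sum>a\<in>?S. \<Prod>l<Suc r. g l ((\<lambda>(\<phi>, i). \<phi>(r := i)) a l))"
    by (rule sum.reindex_bij_betw[OF bij, symmetric])
  also have "\<dots> = (\<Sum>(\<phi>, i)\<in>?S. (\<Prod>l<r. g l (\<phi> l)) * g r i)"
    by (intro sum.cong refl) (auto simp: lessThan_Suc mult.commute intro!: arg_cong2[of _ _ _ _ "(*)"] prod.cong)
  also have "\<dots> = (\<Sum>\<phi>\<in>injections r d. \<Sum>i\<in>{..<d} - \<phi> ` {..<r}. (\<Prod>l<r. g l (\<phi> l)) * g r i)"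
    by (subst sum.Sigma) (auto simp: finite_injections)
  also have "\<dots> = (\<Sum>\<phi>\<in>injections r d. (\<Prod>l<r. g l (\<phi> l)) * ((\<Sum>i<d. g r i) - (\<Sum>k<r. g r (\<phi> k))))"
  proof (intro sum.cong refl)
    fix \<phi> assume \<phi>: "\<phi> \<in> injections r d"
    have "(\<Sum>i<d. g r i) = (\<Sum>i\<in>{..<d} - \<phi> ` {..<r}. g r i) + (\<Sum>i\<in>\<phi> ` {..<r}. g r i)"
      using \<phi> by (intro sum.subset_diff) (auto simp: injections_def)
    moreover have "(\<Sum>i\<in>\<phi> ` {..<r}. g r i) = (\<Sum>k<r. g r (\<phi> k))"
      using \<phi> by (subst sum.reindex) (auto simp: injections_def)
    ultimately show "(\<Sum>i\<in>{..<d} - \<phi> ` {..<r}. (\<Prod>l<r. g l (\<phi> l)) * g r i)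
        = (\<Prod>l<r. g l (\<phi> l)) * ((\<Sum>i<d. g r i) - (\<Sum>k<r. g r (\<phi> k)))"
      by (simp add: sum_distrib_left[symmetric])
  qed
  also have "\<dots> = (\<Sum>\<phi>\<in>injections r d. (\<Sum>i<d. g r i) * (\<Prod>l<r. g l (\<phi> l)))
      - (\<Sum>\<phi>\<in>injections r d. \<Sum>k<r. (\<Prod>l<r. g l (\<phi> l)) * g r (\<phi> k))"
    by (simp add: right_diff_distrib sum_subtractf sum_distrib_left sum_distrib_right mult.commute)
  also have "(\<Sum>\<phi>\<in>injections r d. \<Sum>k<r. (\<Prod>l<r. g l (\<phi> l)) * g r (\<phi> k))
     = (\<Sum>\<phi>\<in>injections r d. \<Sum>k<r. \<Prod>l<r. (if l = k then g k (\<phi> l) * g r (\<phi> l) else g l (\<phi> l)))"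
  proof (intro sum.cong refl)
    fix \<phi> k assume "k \<in> {..<r}"
    then show "(\<Prod>l<r. g l (\<phi> l)) * g r (\<phi> k) = (\<Prod>l<r. (if l = k then g k (\<phi> l) * g r (\<phi> l) else g l (\<phi> l)))"
      by (subst (1 2) prod.remove[of _ k]) (auto simp: mult_ac intro!: prod.cong)
  qed
  finally show ?thesis by (simp add: sum_distrib_left sum.swap[of _ "injections r d"])
qed

lemma fact_dvd_imp_Ints:
  assumes "fact k * x \<in> (\<int> :: complex set)" "k \<le> D"
  shows "fact D * x \<in> \<int>"
proof -
  obtain q :: nat where "fact D = fact k * q" using fact_dvd[OF assms(2), where 'a = nat] by (auto elim: dvdE)
  then have "(of_nat (fact D) :: complex) = of_nat (fact k * q)" by (simp only:)
  then have "(fact D :: complex) = fact k * of_nat q" by simp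
  then have "fact D * x = of_nat q * (fact k * x)" by simp
  also have "\<dots> \<in> \<int>" by (rule Ints_mult[OF Ints_of_nat assms(1)])
  finally show ?thesis .
qed

text \<open>In the application m consists of the forms normalized at z, and a is F(z). The
  hypothesis concerns every integral combination of the columns of m, and a degree k costs the
  denominator a^k.\<close>

context
  fixes d n :: nat and m :: "nat \<Rightarrow> nat \<Rightarrow> complex" and a :: int
  assumes power_sums: "\<And>(t :: nat \<Rightarrow> int) k. of_int a ^ k * (\<Sum>i<d. (\<Sum>j<n. of_int (t j) * m i j) ^ k) \<in> \<int>"
begin

text \<open>Polarization turns the product of the entries in the columns \<open>js\<close> into a
  signed sum of powers of column sums, each covered by \<open>power_sums\<close>. The price is the
  factorial of the degree.\<close>

lemma monomial_sum_Ints: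
  assumes js: "set js \<subseteq> {..<n}"
  shows "fact (length js) * (of_int a ^ length js * (\<Sum>i<d. prod_list (map (m i) js))) \<in> \<int>"
proof -
  let ?k = "length js"
  \<comment> \<open>The integral coefficient of column j counts the positions in S at which
    \<open>js\<close> has the entry j.\<close>
  have mat_act: "(\<Sum>l\<in>S. m i (js ! l)) = (\<Sum>j<n. of_int (\<Sum>l\<in>S. if js ! l = j then 1 else 0) * m i j)"
    if S: "S \<in> Pow {..<?k}" for S i
  proof -
    have "(\<Sum>j<n. of_int (\<Sum>l\<in>S. if js ! l = j then 1 else 0) * m i j)
       = (\<Sum>l\<in>S. \<Sum>j<n. if js ! l = j then m i j else 0)"
      unfolding of_int_sum sum_distrib_right
      by (subst sum.swap) (auto intro!: sum.cong)
    also have "\<dots> = (\<Sum>l\<in>S. m i (js ! l))"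
    proof (intro sum.cong refl)
      fix l assume "l \<in> S"
      then have "js ! l \<in> set js" using S by auto
      then have "js ! l < n" using js by auto
      then show "(\<Sum>j<n. if js ! l = j then m i j else 0) = m i (js ! l)" by simp
    qed
    finally show ?thesis by simp
  qed
  have pl: "prod_list (map (m i) js) = (\<Prod>l<?k. m i (js ! l))" for i
    by (simp add: prod.list_conv_set_nth lessThan_atLeast0)
  have "fact ?k * (of_int a ^ ?k * (\<Sum>i<d. prod_list (map (m i) js)))
      = of_int a ^ ?k * (\<Sum>i<d. \<Sum>S\<in>Pow {..<?k}. (- 1) ^ (?k - card S) * (\<Sum>l\<in>S. m i (js ! l)) ^ ?k)"
    unfolding polarization pl by (simp add: sum_distrib_left mult_ac)
  also have "\<dots> = (\<Sum>S\<in>Pow {..<?k}. (- 1) ^ (?k - card S) * (of_int a ^ ?k * (\<Sum>i<d. (\<Sum>l\<in>S. m i (js ! l)) ^ ?k)))"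
    by (subst sum.swap) (simp add: sum_distrib_left mult_ac)
  also have "\<dots> \<in> \<int>"
  proof (rule Ints_sum, rule Ints_mult)
    fix S assume S: "S \<in> Pow {..<?k}"
    show "(- 1) ^ (?k - card S) \<in> (\<int> :: complex set)" by (intro Ints_power) auto
    show "of_int a ^ ?k * (\<Sum>i<d. (\<Sum>l\<in>S. m i (js ! l)) ^ ?k) \<in> \<int>"
      unfolding mat_act[OF S] by (rule power_sums)
  qed
  finally show ?thesis .
qed

text \<open>Induction on r by \<open>sum_injections_Suc\<close>. Merging two factors concatenates
  their column lists, so the total degree k is preserved, and each step brings in one further power
  sum and with it one factorial. Since all degrees are at most D, the single factorial of D serves
  for every one of them.\<close>

lemma injective_sum_Ints:
  assumes "\<And>l. l < r \<Longrightarrow> set (js l) \<subseteq> {..<n}" "(\<Sum>l<r. length (js l)) = k" "k \<le> D"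
  shows "fact D ^ r * (of_int a ^ k * (\<Sum>\<phi>\<in>injections r d. \<Prod>l<r. prod_list (map (m (\<phi> l)) (js l)))) \<in> \<int>"
  using assms
proof (induction r arbitrary: js k)
  case 0
  then show ?case by (simp add: injections_def)
next
  case (Suc r)
  define k' where "k' = (\<Sum>l<r. length (js l))"
  have k: "k = k' + length (js r)" using Suc.prems(2) by (simp add: k'_def)
  define P where "P = (\<Sum>i<d. prod_list (map (m i) (js r)))"
  define Q where "Q = (\<Sum>\<phi>\<in>injections r d. \<Prod>l<r. prod_list (map (m (\<phi> l)) (js l)))"
  define R where "R j = (\<Sum>\<phi>\<in>injections r d. \<Prod>l<r. prod_list (map (m (\<phi> l)) (if l = j then js j @ js r else js l)))" for j
  have R: "fact D ^ r * (of_int a ^ k * R j) \<in> \<int>" if j: "j < r" for j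
    unfolding R_def
  proof (rule Suc.IH)
    have "(\<Sum>l<r. length (if l = j then js j @ js r else js l)) = (\<Sum>l<r. length (js l) + (if l = j then length (js r) else 0))"
      by (intro sum.cong) auto
    also have "\<dots> = k" using j by (simp add: sum.distrib k k'_def)
    finally show "(\<Sum>l<r. length (if l = j then js j @ js r else js l)) = k" .
  qed (use Suc.prems j in \<open>auto simp: less_Suc_eq\<close>)
  have Q: "fact D ^ r * (of_int a ^ k' * Q) \<in> \<int>"
    unfolding Q_def by (rule Suc.IH) (use Suc.prems k in \<open>auto simp: k'_def\<close>)
  have P: "fact D * (of_int a ^ length (js r) * P) \<in> \<int>"
    unfolding P_def using Suc.prems k by (intro fact_dvd_imp_Ints[OF monomial_sum_Ints]) auto
  have X: "(\<Sum>\<phi>\<in>injections (Suc r) d. \<Prod>l<Suc r. prod_list (map (m (\<phi> l)) (js l))) = P * Q - (\<Sum>j<r. R j)"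
    unfolding sum_injections_Suc[where g = "\<lambda>l i. prod_list (map (m i) (js l))"] P_def Q_def R_def
    by (auto intro!: sum.cong prod.cong arg_cong2[of _ _ _ _ "(-)"])
  have "fact D ^ Suc r * (of_int a ^ k * (\<Sum>\<phi>\<in>injections (Suc r) d. \<Prod>l<Suc r. prod_list (map (m (\<phi> l)) (js l))))
     = fact D ^ Suc r * (of_int a ^ k * (P * Q - (\<Sum>j<r. R j)))" by (simp only: X)
  also have "\<dots> = (fact D * (of_int a ^ length (js r) * P)) * (fact D ^ r * (of_int a ^ k' * Q))
       - (\<Sum>j<r. fact D * (fact D ^ r * (of_int a ^ k * R j)))"
  proof -
    have "(\<Sum>j<r. fact D * (fact D ^ r * (of_int a ^ k * R j))) = fact D * (fact D ^ r * (of_int a ^ k * (\<Sum>j<r. R j)))"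
      by (simp only: sum_distrib_left)
    then show ?thesis by (simp add: k power_add algebra_simps)
  qed
  also have "\<dots> \<in> \<int>" 
    by (intro Ints_diff[OF Ints_mult[OF P Q]] Ints_sum Ints_mult[OF fact_in_Ints] R) auto
  finally show ?case .
qed

lemma int_poly_fun_sum_Ints:
  assumes "int_poly_fun d n k G" "k \<le> D"
  shows "fact D ^ d * (of_int a ^ k * (\<Sum>\<phi>\<in>injections d d. G (\<lambda>i. m (\<phi> i)))) \<in> \<int>"
  using assms
proof induction
  case (mono js k)
  then show ?case by (intro injective_sum_Ints) auto
next
  case (add k G H)
  then show ?case by (simp add: sum.distrib distrib_left Ints_add)
next
  case (uminus k G)
  then show ?case by (simp add: sum_negf Ints_minus)
qed simp

end

text \<open>Bases are ordered, so every basis occurs with all its orderings; a permutation of the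
  forms then acts by mere composition.\<close>

definition bases :: "nat \<Rightarrow> nat \<Rightarrow> (nat \<Rightarrow> nat \<Rightarrow> complex) \<Rightarrow> (nat \<Rightarrow> nat) set" where
  "bases n d c = {\<tau> \<in> {..<n} \<rightarrow>\<^sub>E {..<d}. fdet n (\<lambda>k. c (\<tau> k)) \<noteq> 0}"

lemma finite_bases: "finite (bases n d c)"
  by (rule finite_subset[of _ "{..<n} \<rightarrow>\<^sub>E {..<d}"]) (auto simp: bases_def intro: finite_PiE)

lemma basesD: "\<tau> \<in> bases n d c \<Longrightarrow> k < n \<Longrightarrow> \<tau> k < d"
  by (auto simp: bases_def)

text \<open>With a = F(z), F(z + X t) is a times the product of the 1 + y_i X, so a e_l is an
  integer for every elementary symmetric function e_l of the y_i. The numbers a y_i have elementary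
  symmetric functions a^l e_l, which for l >= 1 contain the required factor a. Hence
  \<open>power_sum_Ints\<close> applies to the a y_i.\<close>

lemma normalized_power_sums:
  fixes c :: "nat \<Rightarrow> nat \<Rightarrow> complex"
  assumes F: "\<And>x. eval_mpoly (of_int_mpoly F) x = (\<Prod>i<d. lin_form n (c i) x)"
    and a: "eval_mpoly F z \<noteq> 0"
  shows "of_int (eval_mpoly F z) ^ k * (\<Sum>i<d. (\<Sum>j<n. of_int (t j) * (c i j / lin_form_int n (c i) z)) ^ k) \<in> \<int>"
proof -
  let ?a = "of_int (eval_mpoly F z) :: complex"
  define y where "y i = lin_form_int n (c i) t / lin_form_int n (c i) z" for i
  have prod: "(\<Prod>i<d. lin_form_int n (c i) z) = ?a" unfolding F[symmetric] by (rule eval_of_int_mpoly_of_int)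
  then have "(\<Prod>i<d. lin_form_int n (c i) z) \<noteq> 0" using a by simp
  then have nz: "lin_form_int n (c i) z \<noteq> 0" if "i < d" for i using that by simp
  obtain P :: "complex poly" where P: "\<And>k. coeff P k \<in> \<int>"
    "\<And>X. poly P X = eval_mpoly (of_int_mpoly F) (\<lambda>j. of_int (z j) + X * of_int (t j))"
    by (rule eval_on_line_poly[of F z t]) auto
  have PE: "P = Polynomial.smult ?a (\<Prod>i<d. [:1, y i:])"
  proof (rule poly_ext)
    fix X
    have "poly P X = (\<Prod>i<d. lin_form_int n (c i) z * (1 + X * y i))"
      unfolding P(2) F by (intro prod.cong refl) (auto simp: y_def lin_form_add lin_form_scale nz field_simps)
    then show "poly P X = poly (Polynomial.smult ?a (\<Prod>i<d. [:1, y i:])) X"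
      by (simp add: prod.distrib prod poly_prod)
  qed
  have scale: "(\<Prod>i<d. [:1, ?a * y i:]) = pcompose (\<Prod>i<d. [:1, y i:]) [:0, ?a:]"
    by (simp add: pcompose_prod pcompose_pCons mult.commute)
  have "coeff (\<Prod>i<d. [:1, ?a * y i:]) l \<in> \<int>" for l
  proof (cases l)
    case 0
    have "coeff (\<Prod>i<d. [:1, ?a * y i:]) 0 = 1" by (simp add: poly_0_coeff_0[symmetric] poly_prod)
    then show ?thesis using 0 by simp
  next
    case (Suc l')
    have "coeff (\<Prod>i<d. [:1, ?a * y i:]) l = ?a ^ l' * coeff P l"
      unfolding scale coeff_pcompose_linear PE using Suc by simp
    then show ?thesis using P(1) by (auto intro!: Ints_mult Ints_power)
  qed
  then have "(\<Sum>i<d. (?a * y i) ^ k) \<in> \<int>" by (rule power_sum_Ints)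
  moreover have "(\<Sum>j<n. of_int (t j) * (c i j / lin_form_int n (c i) z)) = y i" for i
    by (simp add: y_def lin_form_def sum_divide_distrib mult.commute)
  ultimately show ?thesis by (simp add: power_mult_distrib sum_distrib_left)
qed

(* Substituting an arbitrary permutation of the forms into the product of all nonzero minors yields
   the same product or 0, so the symmetrization is a positive multiple of the product itself. *)
lemma product_of_minors_ge:
  fixes c :: "nat \<Rightarrow> nat \<Rightarrow> complex" and z :: "nat \<Rightarrow> int"
  assumes F: "\<And>x. eval_mpoly (of_int_mpoly F) x = (\<Prod>i<d. lin_form n (c i) x)"
    and a: "eval_mpoly F z \<noteq> 0"
  defines "D \<equiv> n * card (bases n d c)"
  shows "1 \<le> fact D ^ d * real d ^ d * \<bar>of_int (eval_mpoly F z)\<bar> ^ D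
     * (\<Prod>\<tau>\<in>bases n d c. cmod (fdet n (\<lambda>k j. c (\<tau> k) j / lin_form_int n (c (\<tau> k)) z)))"
proof -
  let ?a = "of_int (eval_mpoly F z) :: complex"
  define m where "m i = (\<lambda>j. c i j / lin_form_int n (c i) z)" for i
  define G where "G Y = (\<Prod>\<tau>\<in>bases n d c. fdet n (\<lambda>k. Y (\<tau> k)))" for Y :: "nat \<Rightarrow> nat \<Rightarrow> complex"
  have prod: "(\<Prod>i<d. lin_form_int n (c i) z) = ?a" unfolding F[symmetric] by (rule eval_of_int_mpoly_of_int)
  then have "(\<Prod>i<d. lin_form_int n (c i) z) \<noteq> 0" using a by simp
  then have nz: "lin_form_int n (c i) z \<noteq> 0" if "i < d" for i using that by simp
  have dtm: "fdet n (\<lambda>k. m (\<sigma> k)) = 0 \<longleftrightarrow> fdet n (\<lambda>k. c (\<sigma> k)) = 0" if "\<And>k. k < n \<Longrightarrow> \<sigma> k < d" for \<sigma>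
  proof -
    have "fdet n (\<lambda>k. m (\<sigma> k)) = (\<Prod>k<n. 1 / lin_form_int n (c (\<sigma> k)) z) * fdet n (\<lambda>k. c (\<sigma> k))"
      unfolding fdet_row_scale[symmetric] by (simp add: m_def)
    then show ?thesis using nz that by auto
  qed
  \<comment> \<open>Exactly these permutations keep every factor of the product nonzero; they
    permute the bases among themselves. The identity is one of them, so the symmetrization does not
    vanish.\<close>
  define Aut where "Aut = {\<phi> \<in> injections d d. \<forall>\<tau>\<in>bases n d c. (\<lambda>k\<in>{..<n}. \<phi> (\<tau> k)) \<in> bases n d c}"
  have restr: "fdet n (\<lambda>k. Y (\<phi> (\<tau> k))) = fdet n (\<lambda>k. Y ((\<lambda>k\<in>{..<n}. \<phi> (\<tau> k)) k))" for Y :: "nat \<Rightarrow> nat \<Rightarrow> complex" and \<phi> \<tau>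
    by (rule fdet_cong) simp
  have G: "G (\<lambda>i. m (\<phi> i)) = (if \<phi> \<in> Aut then G m else 0)" if \<phi>: "\<phi> \<in> injections d d" for \<phi>
  proof (cases "\<phi> \<in> Aut")
    case True
    let ?f = "\<lambda>\<tau>. \<lambda>k\<in>{..<n}. \<phi> (\<tau> k)"
    have sub: "?f ` bases n d c \<subseteq> bases n d c" using True by (auto simp: Aut_def)
    have inj: "inj_on ?f (bases n d c)"
    proof (rule inj_onI)
      fix \<tau> \<tau>' assume t: "\<tau> \<in> bases n d c" "\<tau>' \<in> bases n d c" "?f \<tau> = ?f \<tau>'"
      have "\<tau> k = \<tau>' k" if k: "k < n" for k
      proof -
        have "\<phi> (\<tau> k) = \<phi> (\<tau>' k)" using fun_cong[OF t(3), of k] k by simp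
        moreover have "\<tau> k < d" "\<tau>' k < d" using t(1,2) k by (auto dest: basesD)
        ultimately show ?thesis using \<phi> by (auto simp: injections_def inj_on_def)
      qed
      then have "\<tau> x = \<tau>' x" for x
        using t(1,2) by (cases "x < n") (auto simp: bases_def PiE_iff extensional_def)
      then show "\<tau> = \<tau>'" ..
    qed
    have "G (\<lambda>i. m (\<phi> i)) = (\<Prod>\<tau>\<in>bases n d c. fdet n (\<lambda>k. m (?f \<tau> k)))"
      unfolding G_def by (intro prod.cong refl) (rule restr)
    also have "\<dots> = (\<Prod>\<tau>\<in>?f ` bases n d c. fdet n (\<lambda>k. m (\<tau> k)))"
      by (simp only: prod.reindex[OF inj] comp_def)
    also have "?f ` bases n d c = bases n d c" by (rule endo_inj_surj[OF finite_bases sub inj])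
    finally show ?thesis using True by (simp add: G_def)
  next
    case False
    then obtain \<tau> where t: "\<tau> \<in> bases n d c" "(\<lambda>k\<in>{..<n}. \<phi> (\<tau> k)) \<notin> bases n d c"
      using \<phi> by (auto simp: Aut_def)
    have lt: "\<phi> (\<tau> k) < d" if "k < n" for k
      using basesD[OF t(1) that] \<phi> by (auto simp: injections_def)
    then have "fdet n (\<lambda>k. c ((\<lambda>k\<in>{..<n}. \<phi> (\<tau> k)) k)) = 0" using t(2) by (auto simp: bases_def)
    then have "fdet n (\<lambda>k. c (\<phi> (\<tau> k))) = 0" by (subst restr)
    then have "fdet n (\<lambda>k. m (\<phi> (\<tau> k))) = 0" using dtm[of "\<lambda>k. \<phi> (\<tau> k)"] lt by simp
    then have "G (\<lambda>i. m (\<phi> i)) = 0" unfolding G_def using t(1) by (intro prod_zero[OF finite_bases] bexI[of _ \<tau>])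
    then show ?thesis using False by simp
  qed
  have "int_poly_fun d n D G" unfolding G_def D_def by (intro int_poly_fun_prod finite_bases int_poly_fun_fdet) (auto dest: basesD)
  from int_poly_fun_sum_Ints[OF normalized_power_sums[OF F a] this order_refl]
  have "fact D ^ d * (?a ^ D * (\<Sum>\<phi>\<in>injections d d. G (\<lambda>i. m (\<phi> i)))) \<in> \<int>" by (simp add: m_def)
  also have "(\<Sum>\<phi>\<in>injections d d. G (\<lambda>i. m (\<phi> i))) = of_nat (card Aut) * G m"
  proof -
    have "Aut \<subseteq> injections d d" by (auto simp: Aut_def)
    then show ?thesis using G by (simp add: sum.If_cases finite_injections Int_absorb1 Int_def[symmetric])
  qed
  finally obtain Z where Z: "fact D ^ d * (?a ^ D * (of_nat (card Aut) * G m)) = of_int Z" by (auto elim: Ints_cases)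
  have "Aut \<noteq> {}"
  proof -
    have "(\<lambda>k\<in>{..<n}. (\<lambda>k\<in>{..<d}. k) (\<tau> k)) = \<tau>" if "\<tau> \<in> bases n d c" for \<tau>
      using that by (auto simp: bases_def PiE_iff extensional_def fun_eq_iff)
    then have "(\<lambda>k\<in>{..<d}. k) \<in> Aut" by (simp add: Aut_def injections_def inj_on_def)
    then show ?thesis by auto
  qed
  have finAut: "finite Aut" by (rule finite_subset[OF _ finite_injections[of d d]]) (auto simp: Aut_def)
  have cardAut: "card Aut \<noteq> 0" using \<open>Aut \<noteq> {}\<close> finAut by simp
  have "fdet n (\<lambda>k. m (\<tau> k)) \<noteq> 0" if "\<tau> \<in> bases n d c" for \<tau>
    using dtm[of \<tau>] basesD[OF that] that by (auto simp: bases_def)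
  then have "G m \<noteq> 0" unfolding G_def by (simp add: prod_zero_iff[OF finite_bases])
  then have "Z \<noteq> 0" using Z a cardAut by (metis fact_nonzero mult_eq_0_iff of_int_0 of_int_eq_0_iff of_nat_eq_0_iff power_not_zero)
  then have "1 \<le> cmod (of_int Z)" by simp
  also have "\<dots> = fact D ^ d * (\<bar>of_int (eval_mpoly F z)\<bar> ^ D * (real (card Aut) * cmod (G m)))"
    unfolding Z[symmetric] by (simp add: norm_mult norm_power)
  also have "\<dots> \<le> fact D ^ d * (\<bar>of_int (eval_mpoly F z)\<bar> ^ D * (real d ^ d * cmod (G m)))"
  proof -
    have "card Aut \<le> card (injections d d)" by (rule card_mono[OF finite_injections]) (auto simp: Aut_def)
    also have "\<dots> \<le> d ^ d" by (rule card_injections_le)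
    finally have "real (card Aut) \<le> real d ^ d" by (metis of_nat_le_iff of_nat_power)
    then show ?thesis by (intro mult_left_mono mult_right_mono) auto
  qed
  also have "cmod (G m) = (\<Prod>\<tau>\<in>bases n d c. cmod (fdet n (\<lambda>k j. c (\<tau> k) j / lin_form_int n (c (\<tau> k)) z)))"
    unfolding G_def m_def by (rule prod_norm[symmetric])
  finally show ?thesis by (simp add: mult_ac)
qed

section \<open>Forms of infinite volume\<close>

definition unit_body :: "nat \<Rightarrow> nat \<Rightarrow> (nat \<Rightarrow> nat \<Rightarrow> complex) \<Rightarrow> (nat \<Rightarrow> real) set" where
  "unit_body n d c = {x \<in> space (real_space n). cmod (\<Prod>i<d. lin_form_real n (c i) x) \<le> 1}"

lemma sets_unit_body [measurable]: "unit_body n d c \<in> sets (real_space n)"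
  unfolding unit_body_def by measurable

lemma emeasure_unit_body_pos: "emeasure (real_space n) (unit_body n d c) > 0"
proof -
  have "form_body n d c (\<lambda>_. 1) \<subseteq> unit_body n d c"
    by (auto simp: form_body_def unit_body_def prod_norm[symmetric] intro!: prod_le_1)
  then have "emeasure (real_space n) (form_body n d c (\<lambda>_. 1)) \<le> emeasure (real_space n) (unit_body n d c)"
    by (rule emeasure_mono) measurable
  then show ?thesis using emeasure_form_body_pos[of d "\<lambda>_. 1" n c] by (simp add: less_le_trans)
qed

text \<open>Conjugating the coefficients permutes the linear factors of a real form only up to
  scalars, hence the constant \<kappa>.\<close>

definition conj_proportional :: "nat \<Rightarrow> (nat \<Rightarrow> complex) \<Rightarrow> (nat \<Rightarrow> complex) \<Rightarrow> bool" where
  "conj_proportional n u v \<longleftrightarrow> (\<exists>\<kappa>. \<kappa> \<noteq> 0 \<and> (\<forall>j<n. cnj (u j) = \<kappa> * v j))"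

lemma conj_proportional_lin_form:
  assumes "conj_proportional n u v"
  obtains \<kappa> where "\<kappa> \<noteq> 0" "\<And>x. lin_form n u (\<lambda>j. cnj (x j)) = cnj (\<kappa> * lin_form n v x)"
proof -
  obtain \<kappa> where k: "\<kappa> \<noteq> 0" "\<And>j. j < n \<Longrightarrow> cnj (u j) = \<kappa> * v j" using assms by (auto simp: conj_proportional_def)
  have "lin_form n u (\<lambda>j. cnj (x j)) = cnj (\<kappa> * lin_form n v x)" for x
  proof -
    have "cnj (\<kappa> * lin_form n v x) = cnj (\<Sum>j<n. (\<kappa> * v j) * x j)" by (simp add: lin_form_def sum_distrib_left mult.assoc)
    also have "(\<Sum>j<n. (\<kappa> * v j) * x j) = (\<Sum>j<n. cnj (u j) * x j)" by (simp add: k(2))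
    also have "cnj \<dots> = lin_form n u (\<lambda>j. cnj (x j))" by (simp add: lin_form_def)
    finally show ?thesis by simp
  qed
  then show ?thesis using that k(1) by blast
qed

lemma conj_proportional_cmod:
  assumes "conj_proportional n u v"
  obtains q where "q > 0" "\<And>x. cmod (lin_form_real n u x) = q * cmod (lin_form_real n v x)"
proof -
  obtain \<kappa> where "\<kappa> \<noteq> 0" and k: "\<And>x. lin_form n u (\<lambda>j. cnj (x j)) = cnj (\<kappa> * lin_form n v x)"
    using conj_proportional_lin_form[OF assms] by metis
  have "cmod (lin_form_real n u x) = cmod \<kappa> * cmod (lin_form_real n v x)" for x
  proof -
    have "lin_form_real n u x = cnj (\<kappa> * lin_form_real n v x)" using k[of "\<lambda>j. complex_of_real (x j)"] by simp
    then have "cmod (lin_form_real n u x) = cmod (\<kappa> * lin_form_real n v x)" by (simp only: complex_mod_cnj)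
    then show ?thesis by (simp add: norm_mult)
  qed
  then show ?thesis using that \<open>\<kappa> \<noteq> 0\<close> by (metis zero_less_norm_iff)
qed

lemma lin_form_sum_left: "lin_form n (\<lambda>j. \<Sum>k\<in>A. e k * \<theta> k j) x = (\<Sum>k\<in>A. e k * lin_form n (\<theta> k) x)"
  unfolding lin_form_def sum_distrib_right sum_distrib_left by (subst sum.swap) (simp add: mult.assoc)

lemma lin_form_sum_right: "lin_form n u (\<lambda>j. \<Sum>k\<in>A. e k * h k j) = (\<Sum>k\<in>A. e k * lin_form n u (h k))"
  unfolding lin_form_def sum_distrib_right sum_distrib_left by (subst sum.swap) (simp add: mult_ac)

lemma prod_sum_PiE_expand:
  assumes "finite A" "finite B"
  shows "(\<Prod>j\<in>A. \<Sum>i\<in>B. f j i) = (\<Sum>g\<in>A \<rightarrow>\<^sub>E B. \<Prod>j\<in>A. f j (g j) :: 'a :: comm_semiring_1)"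
  using assms by (simp add: prod_sum_PiE)

(* By Cauchy-Binet the Gram matrix of the forms is singular. *)
lemma common_kernel:
  fixes c :: "nat \<Rightarrow> nat \<Rightarrow> complex"
  assumes "\<And>\<tau>. \<tau> \<in> {..<n} \<rightarrow>\<^sub>E {..<d} \<Longrightarrow> fdet n (\<lambda>k. c (\<tau> k)) = 0"
  obtains w where "\<exists>j<n. w j \<noteq> 0" "\<And>i. i < d \<Longrightarrow> lin_form n (c i) w = 0"
proof -
  define G where "G j k = (\<Sum>i<d. cnj (c i j) * c i k)" for j k
  have "fdet n G = (\<Sum>p | p permutes {0..<n}. signof p * (\<Sum>f\<in>{..<n} \<rightarrow>\<^sub>E {..<d}. \<Prod>j<n. cnj (c (f j) j) * c (f j) (p j)))"
    unfolding fdet_expand G_def by (subst prod_sum_PiE_expand) auto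
  also have "\<dots> = (\<Sum>f\<in>{..<n} \<rightarrow>\<^sub>E {..<d}. (\<Prod>j<n. cnj (c (f j) j)) * fdet n (\<lambda>k. c (f k)))"
    unfolding fdet_expand sum_distrib_left
    by (subst sum.swap) (simp add: prod.distrib mult_ac)
  also have "\<dots> = 0" using assms by simp
  finally obtain w where w: "\<exists>j<n. w j \<noteq> 0" "\<And>j. j < n \<Longrightarrow> (\<Sum>k<n. G j k * w k) = 0"
    unfolding fdet_eq_0_iff by auto
  \<comment> \<open>The Hermitian form of the Gram matrix at w is the sum of the squared moduli of
    the values of the forms at w, so w lies in every kernel.\<close>
  have "0 = (\<Sum>j<n. cnj (w j) * (\<Sum>k<n. G j k * w k))" using w(2) by simp
  also have "\<dots> = (\<Sum>i<d. cnj (lin_form n (c i) w) * lin_form n (c i) w)"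
  proof -
    have "(\<Sum>k<n. G j k * w k) = (\<Sum>i<d. cnj (c i j) * lin_form n (c i) w)" for j
      unfolding G_def lin_form_def sum_distrib_right sum_distrib_left by (subst sum.swap) (simp add: mult_ac)
    then have "(\<Sum>j<n. cnj (w j) * (\<Sum>k<n. G j k * w k)) = (\<Sum>j<n. \<Sum>i<d. cnj (w j) * (cnj (c i j) * lin_form n (c i) w))"
      by (simp add: sum_distrib_left)
    also have "\<dots> = (\<Sum>i<d. (\<Sum>j<n. cnj (c i j) * cnj (w j)) * lin_form n (c i) w)"
      unfolding sum_distrib_right by (subst sum.swap) (simp add: mult_ac)
    finally show ?thesis by (simp add: lin_form_def)
  qed
  also have "\<dots> = complex_of_real (\<Sum>i<d. (cmod (lin_form n (c i) w))\<^sup>2)"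
    by (simp only: of_real_sum complex_norm_square mult.commute)
  finally have "(\<Sum>i<d. (cmod (lin_form n (c i) w))\<^sup>2) = 0" by (metis of_real_eq_0_iff)
  then have "lin_form n (c i) w = 0" if "i < d" for i
    using that by (subst (asm) sum_nonneg_eq_0_iff) auto
  then show ?thesis using that w(1) by blast
qed

context
  fixes n d :: nat and c :: "nat \<Rightarrow> nat \<Rightarrow> complex"
  assumes nonzero: "\<And>i. i < d \<Longrightarrow> \<exists>j<n. c i j \<noteq> 0"
    and conj: "\<And>x. (\<Prod>i<d. lin_form n (c i) (\<lambda>j. cnj (x j))) = cnj (\<Prod>i<d. lin_form n (c i) x)"
begin

(* Otherwise the hyperplane where the conjugate of c i vanishes is not covered by the kernels of
   the forms, and the form is nonzero somewhere on it. *)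
lemma ex_conj_proportional:
  assumes i: "i < d"
  shows "\<exists>i'<d. conj_proportional n (c i) (c i')"
proof (rule ccontr)
  assume neg: "\<not> (\<exists>i'<d. conj_proportional n (c i) (c i'))"
  define e where "e j = cnj (c i j)" for j
  obtain p where p: "p < n" "e p \<noteq> 0" using nonzero[OF i] by (auto simp: e_def)
  have "\<exists>h. lin_form n e h = 0 \<and> lin_form n (c l) h \<noteq> 0" if l: "l < d" for l
  proof (rule ccontr)
    assume "\<not> (\<exists>h. lin_form n e h = 0 \<and> lin_form n (c l) h \<noteq> 0)"
    then have h: "lin_form n (c l) h = 0" if "lin_form n e h = 0" for h using that by blast
    \<comment> \<open>These vectors span the hyperplane where \<open>e\<close> vanishes. A form that
      vanishes on all of them is proportional to \<open>e\<close>.\<close>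
    have two: "lin_form n u (\<lambda>k. (if k = j then e p else 0) - (if k = p then e j else 0)) = u j * e p - u p * e j"
      if "j < n" for u j
      using that p(1) by (simp add: lin_form_def right_diff_distrib sum_subtractf if_distrib[of "\<lambda>z. _ * z"] cong: if_cong)
    have rel: "c l j * e p = c l p * e j" if "j < n" for j
      using h[of "\<lambda>k. (if k = j then e p else 0) - (if k = p then e j else 0)"] two[OF that] by simp
    have "c l p \<noteq> 0"
    proof
      assume "c l p = 0"
      then have "c l j = 0" if "j < n" for j using rel[OF that] p(2) by simp
      then show False using nonzero[OF l] by auto
    qed
    then have "\<forall>j<n. cnj (c i j) = (e p / c l p) * c l j" using rel by (simp add: e_def field_simps)
    then have "conj_proportional n (c i) (c l)"
      unfolding conj_proportional_def using p(2) \<open>c l p \<noteq> 0\<close> by (intro exI[of _ "e p / c l p"]) auto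
    then show False using neg l by blast
  qed
  then obtain h where h: "\<And>l. l < d \<Longrightarrow> lin_form n e (h l) = 0" "\<And>l. l < d \<Longrightarrow> lin_form n (c l) (h l) \<noteq> 0" by metis
  \<comment> \<open>Combining the vectors h l with weights s^l makes the value of each form a
    polynomial in s, nonzero because its coefficient at its own index is nonzero. One s thus avoids
    all kernels at once.\<close>
  define Q where "Q l' = (\<Sum>l<d. monom (lin_form n (c l') (h l)) l)" for l'
  have "Q l' \<noteq> 0" if "l' < d" for l'
  proof -
    have "coeff (Q l') l' = lin_form n (c l') (h l')" using that by (simp add: Q_def coeff_sum)
    then show ?thesis using h(2)[OF that] by auto
  qed
  then have "(\<Prod>l<d. Q l) \<noteq> 0" by simp
  then obtain s where s: "poly (\<Prod>l<d. Q l) s \<noteq> 0" using poly_all_0_iff_0 by blast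
  define x where "x j = (\<Sum>l<d. s ^ l * h l j)" for j
  have "lin_form n (c l) x = poly (Q l) s" for l
    unfolding x_def lin_form_sum_right by (simp add: Q_def poly_sum poly_monom mult.commute)
  then have 1: "(\<Prod>l<d. lin_form n (c l) x) \<noteq> 0" using s by (simp add: poly_prod)
  have "lin_form n e x = 0" unfolding x_def lin_form_sum_right using h(1) by simp
  then have "cnj (lin_form n e x) = 0" by simp
  moreover have "cnj (lin_form n e x) = lin_form n (c i) (\<lambda>j. cnj (x j))" by (simp add: lin_form_def e_def)
  ultimately have "(\<Prod>l<d. lin_form n (c l) (\<lambda>j. cnj (x j))) = 0" using i by (auto intro!: prod_zero)
  then show False using conj[of x] 1 by simp
qed

text \<open>The common kernel is stable under conjugation and so contains a nonzero real vector r.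
  The map x -> x + (x_p / r_p) r preserves every form and doubles the coordinate p, so
  \<open>infinite_volume_of_expansion\<close> applies.\<close>

lemma infinite_of_common_kernel:
  assumes w: "\<exists>j<n. w j \<noteq> 0" "\<And>i. i < d \<Longrightarrow> lin_form n (c i) w = 0"
  shows "emeasure (real_space n) (unit_body n d c) = \<infinity>"
proof -
  have w': "lin_form n (c i) (\<lambda>j. cnj (w j)) = 0" if i: "i < d" for i
  proof -
    obtain i' where i': "i' < d" "conj_proportional n (c i) (c i')" using ex_conj_proportional[OF i] by auto
    obtain \<kappa> where "\<And>x. lin_form n (c i) (\<lambda>j. cnj (x j)) = cnj (\<kappa> * lin_form n (c i') x)"
      using conj_proportional_lin_form[OF i'(2)] by metis
    then show ?thesis using w(2)[OF i'(1)] by simp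
  qed
  have "\<exists>r. (\<exists>j<n. r j \<noteq> 0) \<and> (\<forall>i<d. lin_form_real n (c i) r = 0)"
  proof -
    have 1: "lin_form_real n (c i) (\<lambda>j. Re (w j)) = 0" if "i < d" for i
    proof -
      have "2 * lin_form_real n (c i) (\<lambda>j. Re (w j)) = lin_form n (c i) (\<lambda>j. w j + cnj (w j))"
        unfolding lin_form_scale[symmetric] by (rule lin_form_cong) (auto simp: complex_eq_iff)
      then show ?thesis using w(2) w' that by (simp add: lin_form_add)
    qed
    have 2: "lin_form_real n (c i) (\<lambda>j. Im (w j)) = 0" if "i < d" for i
    proof -
      have "(2 * \<i>) * lin_form_real n (c i) (\<lambda>j. Im (w j)) = lin_form n (c i) (\<lambda>j. w j - cnj (w j))"
        unfolding lin_form_scale[symmetric] by (rule lin_form_cong) (auto simp: complex_eq_iff)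
      then show ?thesis using w(2) w' that by (simp add: lin_form_diff)
    qed
    obtain j where "j < n" "Re (w j) \<noteq> 0 \<or> Im (w j) \<noteq> 0" using w(1) by (auto simp: complex_eq_iff)
    then show ?thesis
    proof (elim disjE)
      assume "Re (w j) \<noteq> 0"
      then show ?thesis using 1 \<open>j < n\<close> by (intro exI[of _ "\<lambda>j. Re (w j)"]) auto
    next
      assume "Im (w j) \<noteq> 0"
      then show ?thesis using 2 \<open>j < n\<close> by (intro exI[of _ "\<lambda>j. Im (w j)"]) auto
    qed
  qed
  then obtain r p where r: "p < n" "r p \<noteq> 0" "\<And>i. i < d \<Longrightarrow> lin_form_real n (c i) r = 0" by blast
  define A where "A k j = (if k = j then 1 else 0) + (if j = p then r k / r p else 0)" for k j
  have mat_act: "(\<Sum>j<n. A k j * x j) = x k + x p * (r k / r p)" if "k < n" for x k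
    using that r(1) by (simp add: A_def distrib_right sum.distrib if_distrib[of "\<lambda>z. z * _"] cong: if_cong)
  have same: "lin_form_real n (c i) (mat_act n A x) = lin_form_real n (c i) x" if "i < d" for i x
  proof -
    have "lin_form_real n (c i) (mat_act n A x) = lin_form n (c i) (\<lambda>j. of_real (x j) + of_real (x p / r p) * of_real (r j))"
      by (rule lin_form_cong) (auto simp: mat_act_nth mat_act)
    then show ?thesis using r(3)[OF that] by (simp only: lin_form_add lin_form_scale) simp
  qed
  show ?thesis
  proof (rule infinite_volume_of_expansion[OF sets_unit_body emeasure_unit_body_pos,
        where c = "\<lambda>j. if j = p then 1 else 0" and q = 2])
    show "fdet n A \<noteq> 0"
    proof
      assume "fdet n A = 0"
      then obtain x where x: "\<exists>j<n. x j \<noteq> 0" "\<And>k. k < n \<Longrightarrow> x k + x p * (r k / r p) = 0"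
        unfolding fdet_eq_0_iff using mat_act by auto
      have "x p = 0" using x(2)[OF r(1)] r(2) by simp
      then show False using x by auto
    qed
    show "p < n" by fact
    show "(if p = p then 1 else 0 :: complex) \<noteq> 0" by simp
    show "(2::real) > 1" by simp
    fix x :: "nat \<Rightarrow> real" assume x: "x \<in> space (real_space n)"
    show "mat_act n A x \<in> unit_body n d c \<longleftrightarrow> x \<in> unit_body n d c"
      using x by (simp add: unit_body_def mat_act_in_space same)
    have ev: "lin_form_real n (\<lambda>j. if j = p then 1 else 0) y = of_real (y p)" for y
      using r(1) by (simp add: lin_form_def if_distrib[of "\<lambda>z. z * _"] cong: if_cong)
    show "cmod (lin_form_real n (\<lambda>j. if j = p then 1 else 0) (mat_act n A x)) = 2 * cmod (lin_form_real n (\<lambda>j. if j = p then 1 else 0) x)"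
      unfolding ev using r by (simp add: mat_act_nth mat_act norm_mult[symmetric])
  qed
qed

(* By Cramer's rule each form lies in the span of the basis elements on its own side of the partition,
   so scaling one side by 2^beta and the other by 2^(-alpha) multiplies each form by a constant and
   preserves their product. Conjugation invariance makes this map real. *)
lemma infinite_of_splitting:
  assumes A: "\<And>i i'. i < d \<Longrightarrow> i' < d \<Longrightarrow> conj_proportional n (c i) (c i') \<Longrightarrow> i \<in> A \<longleftrightarrow> i' \<in> A"
    and \<tau>: "\<And>k. k < n \<Longrightarrow> \<tau> k < d" "fdet n (\<lambda>k. c (\<tau> k)) \<noteq> 0"
    and no_exchange: "\<And>k j. k < n \<Longrightarrow> j < d \<Longrightarrow> (\<tau> k \<in> A) \<noteq> (j \<in> A) \<Longrightarrow> fdet n ((\<lambda>k. c (\<tau> k))(k := c j)) = 0"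
    and i0: "i0 < d" "i0 \<in> A" and j0: "j0 < d" "j0 \<notin> A"
  shows "emeasure (real_space n) (unit_body n d c) = \<infinity>"
proof -
  define \<theta> where "\<theta> = (\<lambda>k. c (\<tau> k))"
  have \<theta>: "fdet n \<theta> \<noteq> 0" using \<tau>(2) by (simp add: \<theta>_def)
  obtain B where B: "\<And>i j. i < n \<Longrightarrow> j < n \<Longrightarrow> (\<Sum>k<n. \<theta> i k * B k j) = (if i = j then 1 else 0)"
    "\<And>i j. i < n \<Longrightarrow> j < n \<Longrightarrow> (\<Sum>k<n. B i k * \<theta> k j) = (if i = j then 1 else 0)"
    by (rule fdet_inverse[OF \<theta>]) (rule that)
  have coords: "y m = (\<Sum>k<n. B m k * lin_form n (\<theta> k) y)" if "m < n" for y m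
  proof -
    have "(\<Sum>k<n. B m k * lin_form n (\<theta> k) y) = (\<Sum>j<n. (\<Sum>k<n. B m k * \<theta> k j) * y j)"
      unfolding lin_form_def sum_distrib_left sum_distrib_right by (subst sum.swap) (simp add: mult.assoc)
    also have "\<dots> = y m" using that B(2)[OF that] by (simp add: if_distrib[of "\<lambda>z. z * _"] cong: if_cong)
    finally show ?thesis by simp
  qed
  define e where "e i k = (\<Sum>l<n. c i l * B l k)" for i k
  have e: "c i j = (\<Sum>k<n. e i k * \<theta> k j)" if "j < n" for i j
  proof -
    have "(\<Sum>k<n. e i k * \<theta> k j) = (\<Sum>l<n. c i l * (\<Sum>k<n. B l k * \<theta> k j))"
      unfolding e_def sum_distrib_left sum_distrib_right by (subst sum.swap) (simp add: mult.assoc)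
    also have "\<dots> = c i j" using that B(2)[OF _ that] by (simp add: if_distrib[of "\<lambda>z. _ * z"] cong: if_cong)
    finally show ?thesis by simp
  qed
  have e0: "e i k = 0" if "i < d" "k < n" "(\<tau> k \<in> A) \<noteq> (i \<in> A)" for i k
  proof -
    have "fdet n (\<theta>(k := c i)) = e i k * fdet n \<theta>" by (rule fdet_cramer[OF that(2) e])
    moreover have "fdet n (\<theta>(k := c i)) = 0" using no_exchange[OF that(2,1,3)] by (simp add: \<theta>_def)
    ultimately show ?thesis using \<theta> by simp
  qed
  have lfc: "lin_form n (c i) x = (\<Sum>k<n. e i k * lin_form n (\<theta> k) x)" for i x
    unfolding lin_form_sum_left[symmetric] by (rule lin_form_cong) (auto simp: e)
  define \<alpha> where "\<alpha> = card ({..<d} \<inter> A)"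
  define \<beta> where "\<beta> = card ({..<d} \<inter> - A)"
  \<comment> \<open>Here j0 outside A is used: the forms in A, among them i0, are stretched by a
    factor greater than 1.\<close>
  have \<beta>: "\<beta> \<noteq> 0" using j0 by (auto simp: \<beta>_def card_eq_0_iff)
  define \<mu> where "\<mu> i = (if i \<in> A then 2 ^ \<beta> else (1/2) ^ \<alpha> :: real)" for i
  \<comment> \<open>The linear map that is diagonal, with entries \<mu>, in the coordinates given by
    the basis \<theta>.\<close>
  define T where "T x m = (\<Sum>l<n. B m l * (of_real (\<mu> (\<tau> l)) * lin_form n (\<theta> l) x))" for x m
  have T\<theta>: "lin_form n (\<theta> k) (T x) = of_real (\<mu> (\<tau> k)) * lin_form n (\<theta> k) x" if "k < n" for k x
  proof -
    have "lin_form n (\<theta> k) (T x) = (\<Sum>l<n. (\<Sum>m<n. \<theta> k m * B m l) * (of_real (\<mu> (\<tau> l)) * lin_form n (\<theta> l) x))"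
      unfolding lin_form_def[of n "\<theta> k" "T x"] T_def sum_distrib_left sum_distrib_right by (subst sum.swap) (simp add: mult.assoc)
    also have "\<dots> = of_real (\<mu> (\<tau> k)) * lin_form n (\<theta> k) x"
      using that B(1)[OF that] by (simp add: if_distrib[of "\<lambda>z. z * _"] cong: if_cong)
    finally show ?thesis .
  qed
  have Tc: "lin_form n (c i) (T x) = of_real (\<mu> i) * lin_form n (c i) x" if "i < d" for i x
  proof -
    have "lin_form n (c i) (T x) = (\<Sum>k<n. e i k * (of_real (\<mu> (\<tau> k)) * lin_form n (\<theta> k) x))"
      unfolding lfc[of i "T x"] by (simp add: T\<theta>)
    also have "\<dots> = (\<Sum>k<n. e i k * (of_real (\<mu> i) * lin_form n (\<theta> k) x))"
      using e0[OF that] by (intro sum.cong refl) (auto simp: \<mu>_def)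
    also have "\<dots> = of_real (\<mu> i) * lin_form n (c i) x"
      unfolding lfc[of i x] by (simp add: sum_distrib_left mult_ac)
    finally show ?thesis .
  qed
  \<comment> \<open>A form and its conjugate lie on the same side of the partition and have the same
    multiplier. So for real x the vector T x and its conjugate agree in all coordinates of the basis
    \<theta>.\<close>
  have Treal: "cnj (T x m) = T x m" if x: "\<And>j. cnj (x j) = x j" and m: "m < n" for x m
  proof -
    have "lin_form n (\<theta> k) (\<lambda>j. cnj (T x j)) = lin_form n (\<theta> k) (T x)" if k: "k < n" for k
    proof -
      obtain i' where i': "i' < d" "conj_proportional n (\<theta> k) (c i')" using ex_conj_proportional[OF \<tau>(1)[OF k]] by (auto simp: \<theta>_def)
      then have \<mu>: "\<mu> i' = \<mu> (\<tau> k)" using A[OF \<tau>(1)[OF k] i'(1)] by (simp add: \<mu>_def \<theta>_def)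
      obtain \<kappa> where \<kappa>: "\<And>x. lin_form n (\<theta> k) (\<lambda>j. cnj (x j)) = cnj (\<kappa> * lin_form n (c i') x)"
        using conj_proportional_lin_form[OF i'(2)] by metis
      have "lin_form n (\<theta> k) (\<lambda>j. cnj (T x j)) = of_real (\<mu> (\<tau> k)) * lin_form n (\<theta> k) (\<lambda>j. cnj (x j))"
        unfolding \<kappa> Tc[OF i'(1)] \<mu> by simp
      then show ?thesis using T\<theta>[OF k, of x] x by simp
    qed
    then show ?thesis using coords[OF m, of "\<lambda>j. cnj (T x j)"] coords[OF m, of "T x"] by simp
  qed
  define R where "R m j = Re (T (\<lambda>l. if l = j then 1 else 0) m)" for m j
  have RT: "complex_of_real (\<Sum>j<n. R m j * x j) = T (\<lambda>j. of_real (x j)) m" if m: "m < n" for m x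
  proof -
    have unit: "lin_form n u (\<lambda>l. if l = j then 1 else 0) = u j" if "j < n" for u :: "nat \<Rightarrow> complex" and j
      using that by (simp add: lin_form_def if_distrib[of "\<lambda>z. _ * z"] cong: if_cong)
    have Tj: "T (\<lambda>l. if l = j then 1 else 0) m = (\<Sum>l<n. B m l * (of_real (\<mu> (\<tau> l)) * \<theta> l j))" if "j < n" for j
      unfolding T_def by (simp add: unit[OF that])
    have "complex_of_real (R m j) = T (\<lambda>l. if l = j then 1 else 0) m" for j
      using Treal[of "\<lambda>l. if l = j then 1 else 0" m] m by (simp add: R_def complex_eq_iff)
    then have "complex_of_real (\<Sum>j<n. R m j * x j) = (\<Sum>j<n. (\<Sum>l<n. B m l * (of_real (\<mu> (\<tau> l)) * \<theta> l j)) * of_real (x j))"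
      by (simp add: Tj)
    also have "\<dots> = (\<Sum>l<n. B m l * (of_real (\<mu> (\<tau> l)) * lin_form n (\<theta> l) (\<lambda>j. of_real (x j))))"
      unfolding lin_form_def sum_distrib_left sum_distrib_right by (subst sum.swap) (simp add: mult.assoc)
    finally show ?thesis by (simp add: T_def)
  qed
  have Rc: "lin_form_real n (c i) (mat_act n R x) = of_real (\<mu> i) * lin_form_real n (c i) x" if "i < d" for i x
  proof -
    have "lin_form_real n (c i) (mat_act n R x) = lin_form n (c i) (T (\<lambda>j. of_real (x j)))"
      by (rule lin_form_cong) (simp_all only: mat_act_nth RT)
    then show ?thesis using Tc[OF that] by simp
  qed
  have \<mu>0: "\<mu> i \<noteq> 0" for i by (simp add: \<mu>_def)
  have "(\<Prod>i<d. \<mu> i) = 1"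
  proof -
    have "(\<Prod>i<d. \<mu> i) = (2 ^ \<beta>) ^ \<alpha> * ((1/2) ^ \<alpha>) ^ \<beta>"
      unfolding \<mu>_def by (subst prod.If_cases) (auto simp: \<alpha>_def \<beta>_def)
    also have "\<dots> = 1" by (simp add: power_mult[symmetric] mult.commute power_divide)
    finally show ?thesis .
  qed
  then have "(\<Prod>i<d. complex_of_real (\<mu> i)) = 1" by (metis of_real_1 of_real_prod)
  then have inv: "(\<Prod>i<d. lin_form_real n (c i) (mat_act n R x)) = (\<Prod>i<d. lin_form_real n (c i) x)" for x
    by (simp add: Rc prod.distrib)
  obtain p where p: "p < n" "c i0 p \<noteq> 0" using nonzero[OF i0(1)] by auto
  show ?thesis
  proof (rule infinite_volume_of_expansion[OF sets_unit_body emeasure_unit_body_pos, where c = "c i0"])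
    show "fdet n R \<noteq> 0"
    proof
      assume "fdet n R = 0"
      then obtain x where x: "\<exists>j<n. x j \<noteq> 0" "\<And>k. k < n \<Longrightarrow> (\<Sum>j<n. R k j * x j) = 0"
        unfolding fdet_eq_0_iff by auto
      have "lin_form_real n (\<theta> k) x = 0" if "k < n" for k
      proof -
        have "lin_form_real n (\<theta> k) (mat_act n R x) = 0" by (simp add: lin_form_def mat_act_nth x(2))
        then show ?thesis using Rc[OF \<tau>(1)[OF that]] \<mu>0 by (simp add: \<theta>_def)
      qed
      then have "x m = 0" if "m < n" for m using coords[OF that, of "\<lambda>j. of_real (x j)"] by simp
      then show False using x(1) by auto
    qed
    show "p < n" "c i0 p \<noteq> 0" by fact+
    show "(2::real) ^ \<beta> > 1" using \<beta> by (simp add: one_less_power)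
    fix x :: "nat \<Rightarrow> real" assume x: "x \<in> space (real_space n)"
    show "mat_act n R x \<in> unit_body n d c \<longleftrightarrow> x \<in> unit_body n d c"
      using x by (simp add: unit_body_def mat_act_in_space inv)
    show "cmod (lin_form_real n (c i0) (mat_act n R x)) = 2 ^ \<beta> * cmod (lin_form_real n (c i0) x)"
      unfolding Rc[OF i0(1)] using i0(2) by (simp add: norm_mult \<mu>_def norm_power)
  qed
qed

end

section \<open>Decay of the volumes\<close>

text \<open>The infinite sum is 1 / (exp \<epsilon> - 1), and exp \<epsilon> - 1 is at least
  \<epsilon>.\<close>

lemma geometric_tail_le:
  fixes \<epsilon> :: real
  assumes "\<epsilon> > 0"
  shows "(\<Sum>j<R. exp (- \<epsilon> * real (Suc j))) \<le> 1 / \<epsilon>"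
proof -
  define r where "r = exp (- \<epsilon>)"
  have r: "0 < r" "r < 1" using assms by (auto simp: r_def)
  have "(\<Sum>j<R. exp (- \<epsilon> * real (Suc j))) = r * (\<Sum>j<R. r ^ j)"
    by (simp add: r_def sum_distrib_left exp_of_nat_mult[symmetric] exp_add[symmetric] algebra_simps)
  also have "(\<Sum>j<R. r ^ j) \<le> 1 / (1 - r)"
  proof -
    have "(\<Sum>j<R. r ^ j) = (1 - r ^ R) / (1 - r)" using r by (subst sum_gp_strict) auto
    also have "\<dots> \<le> 1 / (1 - r)" using r by (intro divide_right_mono) auto
    finally show ?thesis .
  qed
  also have "r * (1 / (1 - r)) \<le> 1 / \<epsilon>"
  proof -
    have "1 + \<epsilon> \<le> exp \<epsilon>" by (rule exp_ge_add_one_self)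
    then have "r * (1 + \<epsilon>) \<le> r * exp \<epsilon>" using r by (intro mult_left_mono) auto
    also have "r * exp \<epsilon> = 1" by (simp add: r_def exp_minus)
    finally show ?thesis using r assms by (simp add: field_simps)
  qed
  finally show ?thesis using r by simp
qed

lemma sum_exp_abs_le:
  fixes \<epsilon> :: real and A :: "int set"
  assumes \<epsilon>: "\<epsilon> > 0" and A: "finite A"
  shows "(\<Sum>k\<in>A. exp (- \<epsilon> * \<bar>real_of_int (k - k0)\<bar>)) \<le> 1 + 2 / \<epsilon>"
proof -
  define f where "f k = exp (- \<epsilon> * \<bar>real_of_int k\<bar>)" for k
  define R where "R = nat (Max (insert 0 ((\<lambda>k. \<bar>k - k0\<bar>) ` A)))"
  have f0: "f k \<ge> 0" for k by (simp add: f_def)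
  have "(\<Sum>k\<in>A. f (k - k0)) = (\<Sum>k\<in>(\<lambda>k. k - k0) ` A. f k)"
    by (subst sum.reindex) (auto simp: inj_on_def)
  also have "\<dots> \<le> (\<Sum>k\<in>{0} \<union> ((\<lambda>j. int (Suc j)) ` {..<R} \<union> (\<lambda>j. - int (Suc j)) ` {..<R}). f k)"
  proof (rule sum_mono2)
    show "(\<lambda>k. k - k0) ` A \<subseteq> {0} \<union> ((\<lambda>j. int (Suc j)) ` {..<R} \<union> (\<lambda>j. - int (Suc j)) ` {..<R})"
    proof
      fix k assume "k \<in> (\<lambda>k. k - k0) ` A"
      then have "\<bar>k\<bar> \<le> Max (insert 0 ((\<lambda>k. \<bar>k - k0\<bar>) ` A))" using A by (intro Max_ge) auto
      then have kR: "nat \<bar>k\<bar> \<le> R" by (simp add: R_def)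
      consider "k = 0" | "k > 0" | "k < 0" by linarith
      then show "k \<in> {0} \<union> ((\<lambda>j. int (Suc j)) ` {..<R} \<union> (\<lambda>j. - int (Suc j)) ` {..<R})"
      proof cases
        case 2
        then have "k = int (Suc (nat k - 1))" "nat k - 1 < R" using kR by auto
        then show ?thesis by blast
      next
        case 3
        then have "k = - int (Suc (nat (- k) - 1))" "nat (- k) - 1 < R" using kR by auto
        then show ?thesis by blast
      qed simp
    qed
  qed (use f0 in auto)
  also have "\<dots> \<le> (\<Sum>k\<in>{0}. f k) + ((\<Sum>k\<in>(\<lambda>j. int (Suc j)) ` {..<R}. f k) + (\<Sum>k\<in>(\<lambda>j. - int (Suc j)) ` {..<R}. f k))"
  proof -
    have "(\<Sum>k\<in>P \<union> Q. f k) \<le> (\<Sum>k\<in>P. f k) + (\<Sum>k\<in>Q. f k)" if "finite P" "finite Q" for P Q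
      using sum.union_inter[OF that, of f] sum_nonneg[of "P \<inter> Q" f] f0 by auto
    then show ?thesis by (smt (verit) finite.emptyI finite.insertI finite_UnI finite_imageI finite_lessThan)
  qed
  also have "(\<Sum>k\<in>(\<lambda>j. int (Suc j)) ` {..<R}. f k) = (\<Sum>j<R. exp (- \<epsilon> * real (Suc j)))"
    by (subst sum.reindex) (auto simp: inj_on_def f_def intro!: sum.cong)
  also have "(\<Sum>k\<in>(\<lambda>j. - int (Suc j)) ` {..<R}. f k) = (\<Sum>j<R. exp (- \<epsilon> * real (Suc j)))"
    by (subst sum.reindex) (auto simp: inj_on_def f_def intro!: sum.cong)
  finally show ?thesis using geometric_tail_le[OF \<epsilon>, of R] by (simp add: f_def)
qed

text \<open>Here M = n d^n bounds the degree D of the product of all minors. The first summand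
  dominates the logarithm of (D!)^d d^d, by D! <= M^M and ln x <= x; the second, 4 d M, dominates
  each of D, n and 3 d D. Logarithms are estimated away so that only natural number arithmetic
  remains, which makes computability immediate.\<close>

definition spread_const :: "nat \<Rightarrow> nat \<Rightarrow> nat" where
  "spread_const n d = ((n * d ^ n) ^ (n * d ^ n)) ^ d * d ^ d + 4 * d * (n * d ^ n)"

text \<open>This is 3 * 9^n * (1 + 2 / \<epsilon>)^d, where 1 / \<epsilon> = 9 d^2
  \<open>spread_const n d\<close> is the reciprocal decay rate. The factor 9^n bounds (3 e)^n, the
  factor 3 bounds e, and every coordinate of v contributes a two-sided geometric series.\<close>

definition volume_const :: "nat \<Rightarrow> nat \<Rightarrow> nat" where
  "volume_const n d = 3 * 9 ^ n * (1 + 2 * (d * (9 * d * spread_const n d))) ^ d"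

context
  fixes n d :: nat and c :: "nat \<Rightarrow> nat \<Rightarrow> complex" and F :: "int mpoly"
  assumes n: "n \<ge> 1" and d: "d \<ge> 1"
    and nonzero: "\<And>i. i < d \<Longrightarrow> \<exists>j<n. c i j \<noteq> 0"
    and F: "\<And>x. eval_mpoly (of_int_mpoly F) x = (\<Prod>i<d. lin_form n (c i) x)"
    and nonvanishing: "\<And>z :: nat \<Rightarrow> int. \<exists>i<n. z i \<noteq> 0 \<Longrightarrow> eval_mpoly F z \<noteq> 0"
    and finite_volume: "emeasure (real_space n) (unit_body n d c) < \<infinity>"
begin

section \<open>Rescaled minors and box volumes\<close>

lemma conj_symmetric: "(\<Prod>i<d. lin_form n (c i) (\<lambda>j. cnj (x j))) = cnj (\<Prod>i<d. lin_form n (c i) x)"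
  unfolding F[symmetric] by (rule eval_of_int_mpoly_cnj)

lemma bases_nonempty: "bases n d c \<noteq> {}"
proof
  assume e: "bases n d c = {}"
  have "fdet n (\<lambda>k. c (\<tau> k)) = 0" if "\<tau> \<in> {..<n} \<rightarrow>\<^sub>E {..<d}" for \<tau>
    using e that by (auto simp: bases_def)
  then obtain w where "\<exists>j<n. w j \<noteq> 0" "\<And>i. i < d \<Longrightarrow> lin_form n (c i) w = 0"
    by (rule common_kernel[of n d c]) auto
  then have "emeasure (real_space n) (unit_body n d c) = \<infinity>"
    by (intro infinite_of_common_kernel[where w = w] nonzero conj_symmetric) auto
  then show False using finite_volume by simp
qed

text \<open>The modulus of the minor of the rescaled forms exp(-v_i) L_i, which define the box as
  the set where all of them are at most 1 in modulus.\<close>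

definition minor :: "(nat \<Rightarrow> nat) \<Rightarrow> (nat \<Rightarrow> real) \<Rightarrow> real" where
  "minor \<tau> v = cmod (fdet n (\<lambda>k. c (\<tau> k))) / exp (\<Sum>k<n. v (\<tau> k))"

definition body :: "(nat \<Rightarrow> real) \<Rightarrow> (nat \<Rightarrow> real) set" where
  "body v = form_body n d c (\<lambda>i. exp (v i))"

lemma minor_pos: "\<tau> \<in> bases n d c \<Longrightarrow> minor \<tau> v > 0"
  by (simp add: minor_def bases_def)

lemma emeasure_body_le:
  assumes \<tau>: "\<tau> \<in> bases n d c"
  shows "emeasure (real_space n) (body v) \<le> ennreal (4 ^ n / minor \<tau> v)"
proof -
  have "body v \<subseteq> form_body n n (\<lambda>k. c (\<tau> k)) (\<lambda>k. exp (v (\<tau> k)))"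
    using basesD[OF \<tau>] by (auto simp: body_def form_body_def)
  then have "emeasure (real_space n) (body v) \<le> emeasure (real_space n) (form_body n n (\<lambda>k. c (\<tau> k)) (\<lambda>k. exp (v (\<tau> k))))"
    by (rule emeasure_mono) simp
  also have "\<dots> \<le> ennreal (4 ^ n * (\<Prod>k<n. exp (v (\<tau> k))) / cmod (fdet n (\<lambda>k. c (\<tau> k))))"
    using \<tau> by (intro emeasure_form_body_le) (auto simp: bases_def)
  also have "\<dots> = ennreal (4 ^ n / minor \<tau> v)" by (simp add: minor_def exp_sum)
  finally show ?thesis .
qed

definition vol :: "(nat \<Rightarrow> real) \<Rightarrow> real" where "vol v = measure (real_space n) (body v)"

lemma emeasure_body: "emeasure (real_space n) (body v) = ennreal (vol v)"
proof -
  obtain \<tau> where "\<tau> \<in> bases n d c" using bases_nonempty by auto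
  from emeasure_body_le[OF this, of v] have "emeasure (real_space n) (body v) \<noteq> \<infinity>"
    by (metis ennreal_less_top infinity_ennreal_def leD)
  then show ?thesis unfolding vol_def by (intro emeasure_eq_ennreal_measure) simp
qed

lemma vol_pos: "vol v > 0"
proof -
  have "emeasure (real_space n) (body v) > 0" unfolding body_def by (rule emeasure_form_body_pos) simp
  then show ?thesis by (simp add: emeasure_body)
qed

lemma vol_minor_le: "\<tau> \<in> bases n d c \<Longrightarrow> vol v * minor \<tau> v \<le> 4 ^ n"
  using emeasure_body_le[of \<tau> v] minor_pos[of \<tau> v] unfolding emeasure_body
  by (simp add: ennreal_le_iff field_simps)

text \<open>The upper bound is the volume estimate. For the lower bound, arithmetic bounds the
  product of all minors from below, and every minor but one is replaced by its upper bound. The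
  exponent 3 d D collects d D from F(z)^D, d D from normalizing the rows, and at most d D from the
  other minors.\<close>

lemma minor_bounds:
  assumes v: "(\<Sum>i<d. v i) \<le> real d"
  obtains X where "X \<ge> 1" "vol v * X ^ n = (3 * exp 1) ^ n"
    "\<And>\<tau>. \<tau> \<in> bases n d c \<Longrightarrow> minor \<tau> v \<le> X ^ n"
    "\<And>\<tau>. \<tau> \<in> bases n d c \<Longrightarrow> 1 \<le> fact (n * card (bases n d c)) ^ d * real d ^ d *
        exp (real (n * card (bases n d c))) * X ^ (3 * d * (n * card (bases n d c))) * minor \<tau> v"
proof -
  define D where "D = n * card (bases n d c)"
  \<comment> \<open>With 3 in place of 2 the dilated box has volume 3^n, strictly more than
    Minkowski's 2^n. The factor e in X absorbs the slack d in the hypothesis on the sum of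
    v.\<close>
  define s where "s = 3 / root n (vol v)"
  define X where "X = exp 1 * s"
  have rootp: "root n (vol v) > 0" using vol_pos n by (simp add: real_root_gt_zero)
  have s0: "s > 0" using rootp by (simp add: s_def)
  have X0: "X > 0" using s0 by (simp add: X_def)
  have svol: "s ^ n * vol v = 3 ^ n"
    using rootp n vol_pos[of v] by (simp add: s_def power_divide real_root_pow_pos2 less_imp_le)
  have volX: "vol v * X ^ n = (3 * exp 1) ^ n"
    using svol by (simp add: X_def power_mult_distrib mult_ac)
  have "emeasure (real_space n) (form_body n d c (\<lambda>i. s * exp (v i))) = ennreal (3 ^ n)"
    using s0 svol vol_pos[of v] unfolding emeasure_form_body_scale[OF s0]
    by (simp add: body_def[symmetric] emeasure_body ennreal_mult'[symmetric])
  also have "\<dots> > 2 ^ n"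
  proof -
    have "(2::real) ^ n < 3 ^ n" using n by (intro power_strict_mono) auto
    then have "ennreal (2 ^ n) < ennreal (3 ^ n)" by (simp add: ennreal_lessI)
    then show ?thesis by (simp add: ennreal_power[symmetric])
  qed
  finally obtain z :: "nat \<Rightarrow> int" where z: "\<exists>i<n. z i \<noteq> 0" "\<And>i. i < d \<Longrightarrow> cmod (lin_form_int n (c i) z) \<le> s * exp (v i)"
    by (rule minkowski_form_body) auto
  define a where "a = eval_mpoly F z"
  define l where "l i = cmod (lin_form_int n (c i) z)" for i
  have a0: "a \<noteq> 0" unfolding a_def by (rule nonvanishing[OF z(1)])
  have la: "(\<Prod>i<d. l i) = \<bar>of_int a\<bar>"
  proof -
    have "(\<Prod>i<d. lin_form_int n (c i) z) = of_int a" unfolding F[symmetric] a_def by (rule eval_of_int_mpoly_of_int)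
    then have "cmod (\<Prod>i<d. lin_form_int n (c i) z) = \<bar>of_int a\<bar>" by simp
    then show ?thesis by (simp add: l_def prod_norm)
  qed
  have a1: "1 \<le> \<bar>real_of_int a\<bar>" using a0 by linarith
  have l: "0 \<le> l i" "i < d \<Longrightarrow> l i \<le> s * exp (v i)" for i using z(2) by (auto simp: l_def)
  have sv: "(\<Prod>i<d. s * exp (v i)) \<le> X ^ d"
  proof -
    have "(\<Prod>i<d. s * exp (v i)) = s ^ d * exp (\<Sum>i<d. v i)" by (simp add: prod.distrib exp_sum)
    also have "\<dots> \<le> s ^ d * exp (real d)" using v s0 by (intro mult_left_mono) auto
    also have "\<dots> = X ^ d" by (simp add: X_def power_mult_distrib exp_of_nat_mult[symmetric] mult.commute)
    finally show ?thesis .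
  qed
  have "(\<Prod>i<d. l i) \<le> (\<Prod>i<d. s * exp (v i))" using l by (intro prod_mono) auto
  then have aX: "\<bar>real_of_int a\<bar> \<le> X ^ d" using la sv by simp
  \<comment> \<open>F(z) is a nonzero integer, so 1 <= |F(z)| <= X^d. In particular no box
    considered here has volume above (3 e)^n.\<close>
  have X1: "X \<ge> 1"
  proof (rule ccontr)
    assume "\<not> X \<ge> 1"
    then have "X ^ Suc (d - 1) < 1" using X0 by (intro power_Suc_less_one) auto
    then have "X ^ d < 1" using d by simp
    then show False using a1 aX by simp
  qed
  \<comment> \<open>The product of all |L_j(z)| is at least 1 while each factor obeys its upper
    bound, so no single factor falls far below its own bound.\<close>
  have l_ge: "s * exp (v i) \<le> l i * X ^ d" if i: "i < d" for i
  proof -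
    have "s * exp (v i) \<le> (s * exp (v i)) * (\<Prod>i<d. l i)" using la a1 s0 by simp
    also have "(\<Prod>i<d. l i) = l i * (\<Prod>j\<in>{..<d} - {i}. l j)" using i by (intro prod.remove) auto
    also have "(s * exp (v i)) * \<dots> \<le> (s * exp (v i)) * (l i * (\<Prod>j\<in>{..<d} - {i}. s * exp (v j)))"
      using l s0 by (intro mult_left_mono prod_mono) auto
    also have "\<dots> = l i * ((s * exp (v i)) * (\<Prod>j\<in>{..<d} - {i}. s * exp (v j)))" by (simp add: mult_ac)
    also have "(s * exp (v i)) * (\<Prod>j\<in>{..<d} - {i}. s * exp (v j)) = (\<Prod>i<d. s * exp (v i))"
      using i by (intro prod.remove[symmetric]) auto
    also have "l i * \<dots> \<le> l i * X ^ d" using l sv by (intro mult_left_mono) auto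
    finally show ?thesis .
  qed
  have normalized: "cmod (fdet n (\<lambda>k j. c (\<tau> k) j / lin_form_int n (c (\<tau> k)) z)) \<le> minor \<tau> v * (exp (real n) * X ^ (d * n))"
    if \<tau>: "\<tau> \<in> bases n d c" for \<tau>
  proof -
    have lp: "l (\<tau> k) > 0" if "k < n" for k
    proof -
      have "0 < s * exp (v (\<tau> k))" using s0 by simp
      also have "\<dots> \<le> l (\<tau> k) * X ^ d" using basesD[OF \<tau> that] by (rule l_ge)
      finally show ?thesis using X0 by (simp add: zero_less_mult_iff)
    qed
    have "fdet n (\<lambda>k j. c (\<tau> k) j / lin_form_int n (c (\<tau> k)) z) = (\<Prod>k<n. 1 / lin_form_int n (c (\<tau> k)) z) * fdet n (\<lambda>k. c (\<tau> k))"
      unfolding fdet_row_scale[symmetric] by simp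
    then have "cmod (fdet n (\<lambda>k j. c (\<tau> k) j / lin_form_int n (c (\<tau> k)) z)) = (\<Prod>k<n. 1 / l (\<tau> k)) * cmod (fdet n (\<lambda>k. c (\<tau> k)))"
      by (simp add: norm_mult l_def prod_norm[symmetric] norm_divide)
    also have "\<dots> \<le> (\<Prod>k<n. X ^ d / (s * exp (v (\<tau> k)))) * cmod (fdet n (\<lambda>k. c (\<tau> k)))"
    proof (intro mult_right_mono prod_mono conjI)
      fix k assume "k \<in> {..<n}"
      then have k: "k < n" by simp
      show "1 / l (\<tau> k) \<le> X ^ d / (s * exp (v (\<tau> k)))"
        using l_ge[OF basesD[OF \<tau> k]] lp[OF k] s0 by (simp add: field_simps)
      show "0 \<le> 1 / l (\<tau> k)" using l by simp
    qed simp
    also have "\<dots> = minor \<tau> v * (X ^ (d * n) / s ^ n)"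
      by (simp add: minor_def prod_dividef prod.distrib exp_sum power_mult mult_ac)
    also have "\<dots> \<le> minor \<tau> v * (exp (real n) * X ^ (d * n))"
    proof (intro mult_left_mono)
      have "1 / s ^ n = exp (real n) / X ^ n"
        by (simp add: X_def power_mult_distrib exp_of_nat_mult[symmetric])
      also have "\<dots> \<le> exp (real n) / 1" using X1 by (intro divide_left_mono) (auto simp: one_le_power)
      finally have "1 / s ^ n \<le> exp (real n)" by simp
      then have "X ^ (d * n) * (1 / s ^ n) \<le> X ^ (d * n) * exp (real n)" using X0 by (intro mult_left_mono) auto
      then show "X ^ (d * n) / s ^ n \<le> exp (real n) * X ^ (d * n)" by (simp add: mult.commute)
    qed (use minor_pos[OF \<tau>, of v] in simp)
    finally show ?thesis .
  qed
  have upper: "minor \<tau> v \<le> X ^ n" if \<tau>: "\<tau> \<in> bases n d c" for \<tau>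
  proof -
    have "vol v * minor \<tau> v \<le> 4 ^ n" by (rule vol_minor_le[OF \<tau>])
    also have "\<dots> \<le> (3 * exp 1) ^ n"
    proof (rule power_mono)
      have "(2::real) \<le> exp 1" using exp_ge_add_one_self[of "1::real"] by simp
      then show "4 \<le> 3 * exp (1::real)" by linarith
    qed simp
    also have "\<dots> = vol v * X ^ n" using volX by simp
    finally show ?thesis using vol_pos[of v] by simp
  qed
  have lower: "1 \<le> fact D ^ d * real d ^ d * exp (real D) * X ^ (3 * d * D) * minor \<tau> v" if \<tau>: "\<tau> \<in> bases n d c" for \<tau>
  proof -
    let ?N = "fact D ^ d * real d ^ d"
    define E where "E = exp (real n) * X ^ (d * n)"
    have N0: "?N \<ge> 0" by simp
    have "1 \<le> ?N * \<bar>of_int a\<bar> ^ D * (\<Prod>\<tau>\<in>bases n d c. cmod (fdet n (\<lambda>k j. c (\<tau> k) j / lin_form_int n (c (\<tau> k)) z)))"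
      using product_of_minors_ge[OF F, of z] a0 by (simp add: D_def a_def)
    also have "\<dots> \<le> ?N * (X ^ d) ^ D * (\<Prod>\<tau>\<in>bases n d c. minor \<tau> v * E)"
      using aX a1 N0 X0 normalized unfolding E_def by (intro mult_mono mult_left_mono power_mono prod_mono) (auto intro!: prod_nonneg mult_nonneg_nonneg)
    also have "\<dots> = ?N * (X ^ (d * D) * E ^ card (bases n d c)) * (\<Prod>\<tau>\<in>bases n d c. minor \<tau> v)"
      by (simp add: prod.distrib power_mult[symmetric] mult_ac)
    also have "E ^ card (bases n d c) = exp (real D) * X ^ (d * D)"
      by (simp add: E_def D_def power_mult_distrib exp_of_nat_mult[symmetric] power_mult[symmetric] mult_ac)
    also have "(\<Prod>\<tau>\<in>bases n d c. minor \<tau> v) \<le> minor \<tau> v * X ^ (d * D)"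
    proof -
      have "(\<Prod>\<tau>\<in>bases n d c. minor \<tau> v) = minor \<tau> v * (\<Prod>\<tau>\<in>bases n d c - {\<tau>}. minor \<tau> v)"
        by (rule prod.remove[OF finite_bases \<tau>])
      also have "\<dots> \<le> minor \<tau> v * (\<Prod>\<tau>\<in>bases n d c - {\<tau>}. X ^ n)"
        using minor_pos upper \<tau> by (intro mult_left_mono prod_mono) (auto simp: less_imp_le)
      also have "(\<Prod>\<tau>\<in>bases n d c - {\<tau>}. X ^ n) = X ^ (n * (card (bases n d c) - 1))"
        using \<tau> by (simp add: power_mult finite_bases card_Diff_singleton)
      also have "minor \<tau> v * \<dots> \<le> minor \<tau> v * X ^ (d * D)"
      proof (intro mult_left_mono power_increasing X1)
        have "n * (card (bases n d c) - 1) \<le> 1 * D" by (simp add: D_def)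
        also have "\<dots> \<le> d * D" using d by (intro mult_right_mono) auto
        finally show "n * (card (bases n d c) - 1) \<le> d * D" .
      qed (use minor_pos[OF \<tau>, of v] in simp)
      finally show ?thesis .
    qed
    finally have "1 \<le> ?N * (X ^ (d * D) * (exp (real D) * X ^ (d * D))) * (minor \<tau> v * X ^ (d * D))"
      using N0 X0 by (simp add: mult_left_mono)
    also have "\<dots> = ?N * exp (real D) * (X ^ (d * D) * X ^ (d * D) * X ^ (d * D)) * minor \<tau> v"
      by (simp add: mult_ac)
    also have "X ^ (d * D) * X ^ (d * D) * X ^ (d * D) = X ^ (3 * d * D)"
    proof -
      have "d * D + d * D + d * D = 3 * d * D" by simp
      then show ?thesis by (simp only: power_add[symmetric])
    qed
    finally show ?thesis .
  qed
  show ?thesis by (rule that[OF X1 volX]) (use upper lower in \<open>auto simp: D_def\<close>)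
qed

(* A gap wider than 2 T + 2 in the values of u gives a partition with no exchange between its parts. *)
lemma spread_bound:
  fixes u :: "nat \<Rightarrow> real"
  assumes T: "\<And>\<tau>. \<tau> \<in> bases n d c \<Longrightarrow> \<bar>\<Sum>k<n. u (\<tau> k)\<bar> \<le> T"
    and close: "\<And>i i'. i < d \<Longrightarrow> i' < d \<Longrightarrow> conj_proportional n (c i) (c i') \<Longrightarrow> \<bar>u i - u i'\<bar> \<le> 2"
    and i: "i < d"
  shows "\<bar>u i\<bar> \<le> T + real d * (2 * T + 2)"
proof -
  \<comment> \<open>Exchanging one basis element moves between two sums of absolute value at most T,
    so by at most 2 T; the additional 2 keeps conjugate forms on the same side of a gap.\<close>
  define g where "g = 2 * T + 2"
  obtain \<tau> where \<tau>: "\<tau> \<in> bases n d c" using bases_nonempty by auto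
  have T0: "T \<ge> 0" using T[OF \<tau>] by linarith
  obtain m where m: "m < d" "\<And>j. j < d \<Longrightarrow> u m \<le> u j"
  proof -
    have "0 \<in> {..<d}" using d by simp
    then have "Min (u ` {..<d}) \<in> u ` {..<d}" by (intro Min_in) blast+
    then obtain m where "m < d" "u m = Min (u ` {..<d})" by auto
    then show ?thesis using that by (metis Min_le finite_imageI finite_lessThan imageI lessThan_iff)
  qed
  \<comment> \<open>Sublevel sets at spacing g above the minimum. While one of them is proper, the
    next is strictly larger, since otherwise a gap wider than g would split the forms; so d steps
    exhaust all indices.\<close>
  define A where "A k = {j. j < d \<and> u j \<le> u m + real k * g}" for k
  have g0: "g \<ge> 2" using T0 by (simp add: g_def)
  have step: "\<exists>j\<in>A (Suc k). j \<notin> A k" if ne: "A k \<noteq> {..<d}" for k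
  proof (rule ccontr)
    assume neg: "\<not> (\<exists>j\<in>A (Suc k). j \<notin> A k)"
    have gap: "u j - u i > g" if "i \<in> A k" "j < d" "j \<notin> A k" for i j
    proof -
      have "j \<notin> A (Suc k)" using neg that by blast
      then have "u j > u m + real (Suc k) * g" using that(2) by (simp add: A_def)
      moreover have "u i \<le> u m + real k * g" using that by (simp add: A_def)
      ultimately show ?thesis by (simp add: algebra_simps)
    qed
    obtain j0 where j0: "j0 < d" "j0 \<notin> A k" using ne by (auto simp: A_def)
    have mA: "m \<in> A k" using m(1) g0 by (simp add: A_def)
    have "emeasure (real_space n) (unit_body n d c) = \<infinity>"
    proof (rule infinite_of_splitting[OF nonzero conj_symmetric, where A = "A k" and \<tau> = \<tau>])
      fix i i' assume ii: "i < d" "i' < d" "conj_proportional n (c i) (c i')"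
      then show "i \<in> A k \<longleftrightarrow> i' \<in> A k"
        using close[OF ii] gap[of i i'] gap[of i' i] g0 by (smt (verit))
    next
      fix k' j assume kj: "k' < n" "j < d" "(\<tau> k' \<in> A k) \<noteq> (j \<in> A k)"
      show "fdet n ((\<lambda>k. c (\<tau> k))(k' := c j)) = 0"
      proof (rule ccontr)
        assume nz: "fdet n ((\<lambda>k. c (\<tau> k))(k' := c j)) \<noteq> 0"
        have "(\<lambda>k. c ((\<tau>(k' := j)) k)) = (\<lambda>k. c (\<tau> k))(k' := c j)" by auto
        then have \<tau>': "\<tau>(k' := j) \<in> bases n d c"
          using nz \<tau> kj(1,2) by (auto simp: bases_def PiE_iff extensional_def)
        have "(\<Sum>k<n. u ((\<tau>(k' := j)) k)) = u j + (\<Sum>k\<in>{..<n} - {k'}. u (\<tau> k))"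
          using kj(1) by (subst sum.remove[of _ k']) auto
        moreover have "(\<Sum>k<n. u (\<tau> k)) = u (\<tau> k') + (\<Sum>k\<in>{..<n} - {k'}. u (\<tau> k))"
          using kj(1) by (subst sum.remove[of _ k']) auto
        ultimately have "\<bar>u j - u (\<tau> k')\<bar> \<le> 2 * T" using T[OF \<tau>] T[OF \<tau>'] by linarith
        moreover have "\<bar>u j - u (\<tau> k')\<bar> > g"
          using gap[of "\<tau> k'" j] gap[of j "\<tau> k'"] kj basesD[OF \<tau> kj(1)] by (cases "j \<in> A k") auto
        ultimately show False by (simp add: g_def)
      qed
    qed (use basesD[OF \<tau>] \<tau> m(1) mA j0 in \<open>auto simp: bases_def\<close>)
    then show False using finite_volume by simp
  qed
  have mono: "A k \<subseteq> A (Suc k)" for k using g0 by (auto simp: A_def algebra_simps)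
  have card: "A k = {..<d} \<or> k < card (A k)" for k
  proof (induction k)
    case 0
    have "m \<in> A 0" using m(1) by (simp add: A_def)
    moreover have "finite (A 0)" by (simp add: A_def)
    ultimately show ?case by (auto simp: card_gt_0_iff)
  next
    case (Suc k)
    show ?case
    proof (cases "A k = {..<d}")
      case True
      then show ?thesis using mono[of k] by (auto simp: A_def)
    next
      case False
      then have "A k \<subset> A (Suc k)" using step[OF False] mono[of k] by auto
      then have "card (A k) < card (A (Suc k))" by (intro psubset_card_mono) (auto simp: A_def)
      then show ?thesis using Suc False by auto
    qed
  qed
  have "card (A d) \<le> card {..<d}" by (rule card_mono) (auto simp: A_def)
  then have "A d = {..<d}" using card[of d] by auto
  then have "u j \<le> u m + real d * g" if "j < d" for j using that by (auto simp: A_def)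
  then have spread: "\<bar>u i - u j\<bar> \<le> real d * g" if "j < d" for j
    using m(2)[OF that] m(2)[OF i] i that by (smt (verit))
  \<comment> \<open>The spread controls only differences; the bound for the sum over one basis fixes
    the position.\<close>
  have "real n * \<bar>u i\<bar> = \<bar>(\<Sum>k<n. u (\<tau> k)) + (\<Sum>k<n. u i - u (\<tau> k))\<bar>"
    by (simp add: sum_subtractf abs_mult)
  also have "\<dots> \<le> T + (\<Sum>k<n. \<bar>u i - u (\<tau> k)\<bar>)"
    using T[OF \<tau>] sum_abs[of "\<lambda>k. u i - u (\<tau> k)" "{..<n}"] by linarith
  also have "\<dots> \<le> real n * T + (\<Sum>k<n. real d * g)"
    using n T0 spread basesD[OF \<tau>] by (intro add_mono sum_mono) (auto simp: mult_le_cancel_right1)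
  also have "\<dots> = real n * (T + real d * g)" by (simp add: algebra_simps)
  finally show ?thesis using n by (simp add: g_def)
qed


section \<open>Numerical estimates and logarithmic bounds\<close>

lemma card_bases_le: "n * card (bases n d c) \<le> n * d ^ n"
proof -
  have "card (bases n d c) \<le> card ({..<n} \<rightarrow>\<^sub>E {..<d})"
    by (rule card_mono) (auto simp: bases_def intro: finite_PiE)
  then show ?thesis by (simp add: card_PiE)
qed

lemma spread_const_bounds:
  defines "D \<equiv> n * card (bases n d c)"
  shows "1 \<le> spread_const n d" "real n \<le> real (spread_const n d)"
    "ln (fact D ^ d * real d ^ d) + real D \<le> real (spread_const n d)"
    "real (3 * d * D) \<le> real (spread_const n d)"
proof -
  define M where "M = n * d ^ n"
  have DM: "D \<le> M" using card_bases_le by (simp add: D_def M_def)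
  have dn: "1 \<le> d ^ n" using d by (simp add: one_le_power)
  then have nM: "n \<le> M" by (simp add: M_def)
  have M1: "1 \<le> M" using nM n by simp
  define P where "P = d * M"
  have K: "spread_const n d = (M ^ M) ^ d * d ^ d + 4 * P" by (simp add: spread_const_def M_def P_def)
  have MP: "M \<le> P" using d by (simp add: P_def)
  show "1 \<le> spread_const n d" unfolding K using MP M1 by linarith
  have "n \<le> spread_const n d" unfolding K using nM MP by linarith
  then show "real n \<le> real (spread_const n d)" by simp
  have "d * D \<le> P" using DM by (simp add: P_def)
  then have "3 * (d * D) \<le> spread_const n d" unfolding K by linarith
  then have "3 * d * D \<le> spread_const n d" by (simp only: mult.assoc)
  then show "real (3 * d * D) \<le> real (spread_const n d)" by (simp only: of_nat_le_iff)
  have "fact D \<le> (fact M :: nat)" by (rule fact_mono[OF DM])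
  also have "\<dots> \<le> M ^ M" using fact_le_power[of M, where 'a = nat] by simp
  finally have "fact D ^ d * d ^ d \<le> (M ^ M) ^ d * d ^ d" by (intro mult_right_mono power_mono) auto
  then have "real (fact D ^ d * d ^ d) \<le> real ((M ^ M) ^ d * d ^ d)" by (simp only: of_nat_le_iff)
  moreover have "ln (fact D ^ d * real d ^ d) \<le> real (fact D ^ d * d ^ d)"
    using ln_le_minus_one[of "fact D ^ d * real d ^ d"] d by simp
  ultimately have "ln (fact D ^ d * real d ^ d) \<le> real ((M ^ M) ^ d * d ^ d)" by linarith
  moreover have "real D \<le> real (4 * P)" using DM MP by (simp only: of_nat_le_iff)
  ultimately show "ln (fact D ^ d * real d ^ d) + real D \<le> real (spread_const n d)" unfolding K by simp
qed

text \<open>The parameter q is ln X for the X of \<open>minor_bounds\<close>. It makes the volume an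
  exact exponential in q and turns both bounds for a minor into one bound linear in 1 + q.\<close>

lemma log_minor_bounds:
  assumes v: "(\<Sum>i<d. v i) \<le> real d"
  obtains q where "q \<ge> 0" "vol v = (3 * exp 1) ^ n * exp (- real n * q)"
    "\<And>\<tau>. \<tau> \<in> bases n d c \<Longrightarrow> \<bar>ln (minor \<tau> v)\<bar> \<le> real (spread_const n d) * (1 + q)"
proof -
  define D where "D = n * card (bases n d c)"
  define K where "K = real (spread_const n d)"
  obtain X where X: "X \<ge> 1" "vol v * X ^ n = (3 * exp 1) ^ n"
    "\<And>\<tau>. \<tau> \<in> bases n d c \<Longrightarrow> minor \<tau> v \<le> X ^ n"
    "\<And>\<tau>. \<tau> \<in> bases n d c \<Longrightarrow> 1 \<le> fact D ^ d * real d ^ d * exp (real D) * X ^ (3 * d * D) * minor \<tau> v"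
    by (rule minor_bounds[OF v, folded D_def]) (rule that)
  have q: "ln X \<ge> 0" using X(1) by simp
  have Xn: "exp (- real n * ln X) = 1 / X ^ n"
    using X(1) by (simp add: exp_minus exp_of_nat_mult field_simps)
  show ?thesis
  proof (rule that[OF q])
    show "vol v = (3 * exp 1) ^ n * exp (- real n * ln X)"
      unfolding Xn X(2)[symmetric] using X(1) by simp
    fix \<tau> assume \<tau>: "\<tau> \<in> bases n d c"
    have "ln (minor \<tau> v) \<le> ln (X ^ n)" using X(3)[OF \<tau>] minor_pos[OF \<tau>, of v] X(1) by (subst ln_le_cancel_iff) auto
    also have "\<dots> = real n * ln X" using X(1) by (simp add: ln_realpow)
    also have "\<dots> \<le> K * (1 + ln X)"
      using spread_const_bounds(2) q by (intro mult_mono) (auto simp: K_def)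
    finally have 1: "ln (minor \<tau> v) \<le> K * (1 + ln X)" .
    have N: "0 < fact D ^ d * real d ^ d" using d by simp
    have "0 \<le> ln (fact D ^ d * real d ^ d * exp (real D) * X ^ (3 * d * D) * minor \<tau> v)"
      using X(4)[OF \<tau>] by simp
    also have "\<dots> = ln (fact D ^ d * real d ^ d) + real D + real (3 * d * D) * ln X + ln (minor \<tau> v)"
    proof -
      have XD: "0 < X ^ (3 * d * D)" using X(1) by simp
      have "ln (fact D ^ d * real d ^ d * exp (real D) * X ^ (3 * d * D) * minor \<tau> v)
         = ln (fact D ^ d * real d ^ d) + ln (exp (real D)) + ln (X ^ (3 * d * D)) + ln (minor \<tau> v)"
      proof -
        have L: "ln (p * e * x * y) = ln p + ln e + ln x + ln y" if "p > 0" "e > 0" "x > 0" "y > 0" for p e x y :: real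
          using that by (simp add: ln_mult)
        show ?thesis by (rule L[OF N _ XD minor_pos[OF \<tau>]]) simp
      qed
      then show ?thesis using X(1) by (simp only: ln_exp ln_realpow[of X] less_le_trans[OF zero_less_one])
    qed
    also have "\<dots> \<le> K + K * ln X + ln (minor \<tau> v)"
      using spread_const_bounds(3,4) q unfolding K_def D_def by (intro add_mono mult_right_mono) auto
    finally have "- ln (minor \<tau> v) \<le> K * (1 + ln X)" by (simp add: algebra_simps)
    then show "\<bar>ln (minor \<tau> v)\<bar> \<le> real (spread_const n d) * (1 + ln X)" using 1 by (simp add: K_def abs_le_iff)
  qed
qed

text \<open>Vectors of rounded logarithms at actual points of the region |F| <= 1. Restricting to
  them supplies the bound on the sum of v and the near agreement on conjugate forms.\<close>

definition admissible :: "(nat \<Rightarrow> int) \<Rightarrow> bool" where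
  "admissible v \<longleftrightarrow> (\<exists>x\<in>unit_body n d c. \<forall>i<d. lin_form_real n (c i) x \<noteq> 0 \<and> v i = \<lceil>ln (cmod (lin_form_real n (c i) x))\<rceil>)"

lemma admissible_sum:
  assumes "admissible v"
  shows "(\<Sum>i<d. real_of_int (v i)) \<le> real d"
proof -
  obtain x where x: "x \<in> unit_body n d c" "\<And>i. i < d \<Longrightarrow> lin_form_real n (c i) x \<noteq> 0"
    "\<And>i. i < d \<Longrightarrow> v i = \<lceil>ln (cmod (lin_form_real n (c i) x))\<rceil>" using assms by (auto simp: admissible_def)
  have "(\<Sum>i<d. real_of_int (v i)) \<le> (\<Sum>i<d. ln (cmod (lin_form_real n (c i) x)) + 1)"
    using x(3) by (intro sum_mono) (auto simp: of_int_ceiling_le_add_one)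
  also have "\<dots> = ln (\<Prod>i<d. cmod (lin_form_real n (c i) x)) + real d"
    using x(2) by (subst ln_prod) (auto simp: sum.distrib)
  also have "(\<Prod>i<d. cmod (lin_form_real n (c i) x)) = cmod (\<Prod>i<d. lin_form_real n (c i) x)" by (rule prod_norm)
  also have "ln \<dots> \<le> 0"
  proof -
    have "cmod (\<Prod>i<d. lin_form_real n (c i) x) \<le> 1" using x(1) by (simp add: unit_body_def)
    moreover have "0 < cmod (\<Prod>i<d. lin_form_real n (c i) x)" using x(2) by simp
    ultimately show ?thesis by (simp only: ln_le_zero_iff)
  qed
  finally show ?thesis by simp
qed

text \<open>For every admissible v the difference v i - v i' lies within 1 of ln r, where r is the
  fixed ratio of the moduli of the two forms. This constant depends on F, but it cancels between v
  and w.\<close>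

lemma admissible_close:
  assumes "admissible v" "admissible w" "i < d" "i' < d" "conj_proportional n (c i) (c i')"
  shows "\<bar>(real_of_int (v i) - real_of_int (w i)) - (real_of_int (v i') - real_of_int (w i'))\<bar> \<le> 2"
proof -
  obtain r where r: "r > 0" "\<And>x. cmod (lin_form_real n (c i) x) = r * cmod (lin_form_real n (c i') x)"
    using conj_proportional_cmod[OF assms(5)] by blast
  have "ln r - 1 \<le> real_of_int (v i) - real_of_int (v i') \<and> real_of_int (v i) - real_of_int (v i') \<le> ln r + 1"
    if v: "admissible v" for v
  proof -
    obtain x where x: "\<And>i. i < d \<Longrightarrow> lin_form_real n (c i) x \<noteq> 0"
      "\<And>i. i < d \<Longrightarrow> v i = \<lceil>ln (cmod (lin_form_real n (c i) x))\<rceil>" using v by (auto simp: admissible_def)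
    have "ln (cmod (lin_form_real n (c i) x)) = ln r + ln (cmod (lin_form_real n (c i') x))"
      unfolding r(2) using r(1) x(1)[OF assms(4)] by (simp add: ln_mult)
    then show ?thesis unfolding x(2)[OF assms(3)] x(2)[OF assms(4)] by linarith
  qed
  from this[OF assms(1)] this[OF assms(2)] show ?thesis by linarith
qed

text \<open>Subtracting the logarithmic bounds for v and w cancels the determinants and leaves
  bounds for the sums of u = v - w over bases. By \<open>spread_bound\<close> every |u i| is then at
  most a constant times 1 + q, so a box far from w has large q and small volume. Hypothesis
  \<open>le\<close> makes q, the parameter of v, the larger of the two.\<close>

lemma vol_decay:
  assumes v: "admissible v" and w: "admissible w" and le: "vol (\<lambda>i. v i) \<le> vol (\<lambda>i. w i)"
  defines "\<epsilon> \<equiv> 1 / real (d * (9 * d * spread_const n d))"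
  shows "vol (\<lambda>i. v i) \<le> 3 * 9 ^ n * (\<Prod>i<d. exp (- \<epsilon> * \<bar>real_of_int (v i - w i)\<bar>))"
proof -
  define K where "K = real (spread_const n d)"
  have K1: "K \<ge> 1" using spread_const_bounds(1) by (simp add: K_def)
  obtain q where q: "q \<ge> 0" "vol (\<lambda>i. v i) = (3 * exp 1) ^ n * exp (- real n * q)"
    "\<And>\<tau>. \<tau> \<in> bases n d c \<Longrightarrow> \<bar>ln (minor \<tau> (\<lambda>i. v i))\<bar> \<le> K * (1 + q)"
    by (rule log_minor_bounds[OF admissible_sum[OF v], folded K_def]) (rule that)
  obtain q' where q': "q' \<ge> 0" "vol (\<lambda>i. w i) = (3 * exp 1) ^ n * exp (- real n * q')"
    "\<And>\<tau>. \<tau> \<in> bases n d c \<Longrightarrow> \<bar>ln (minor \<tau> (\<lambda>i. w i))\<bar> \<le> K * (1 + q')"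
    by (rule log_minor_bounds[OF admissible_sum[OF w], folded K_def]) (rule that)
  have "exp (- real n * q) \<le> exp (- real n * q')" using le unfolding q(2) q'(2) by simp
  then have qq: "q' \<le> q" using n by simp
  define u where "u i = real_of_int (v i) - real_of_int (w i)" for i
  define T where "T = 2 * K * (1 + q)"
  have T: "\<bar>\<Sum>k<n. u (\<tau> k)\<bar> \<le> T" if \<tau>: "\<tau> \<in> bases n d c" for \<tau>
  proof -
    have ln_minor: "ln (minor \<tau> y) = ln (cmod (fdet n (\<lambda>k. c (\<tau> k)))) - (\<Sum>k<n. y (\<tau> k))" for y
      using \<tau> by (simp add: minor_def bases_def ln_div)
    have "(\<Sum>k<n. u (\<tau> k)) = ln (minor \<tau> (\<lambda>i. w i)) - ln (minor \<tau> (\<lambda>i. v i))"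
      unfolding ln_minor by (simp add: u_def sum_subtractf)
    moreover have "K * (1 + q') \<le> K * (1 + q)" using qq K1 by (intro mult_left_mono) auto
    ultimately show ?thesis using q(3)[OF \<tau>] q'(3)[OF \<tau>] unfolding T_def by linarith
  qed
  have close: "\<bar>u i - u i'\<bar> \<le> 2" if "i < d" "i' < d" "conj_proportional n (c i) (c i')" for i i'
    unfolding u_def by (rule admissible_close[OF v w that])
  have u: "\<bar>u i\<bar> \<le> 9 * real d * K * (1 + q)" if "i < d" for i
  proof -
    have d1: "1 \<le> real d" using d by simp
    have KQ: "1 \<le> K * (1 + q)" using mult_mono[OF K1, of 1 "1 + q"] q(1) K1 by simp
    \<comment> \<open>The right-hand side is at most d (3 T + 2) with T = 2 K (1 + q), hence at most
      8 d K (1 + q), which is rounded up to 9.\<close>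
    have "\<bar>u i\<bar> \<le> T + real d * (2 * T + 2)" by (rule spread_bound[OF T close that])
    also have "\<dots> \<le> real d * T + real d * (2 * T + 2)"
      using mult_right_mono[OF d1, of T] KQ by (simp add: T_def)
    also have "\<dots> = real d * (6 * (K * (1 + q)) + 2)" by (simp add: T_def algebra_simps)
    also have "\<dots> \<le> real d * (9 * (K * (1 + q)))" using KQ by (intro mult_left_mono) auto
    finally show ?thesis by (simp add: mult_ac)
  qed
  have "(\<Sum>i<d. \<bar>u i\<bar>) \<le> (\<Sum>i<d. 9 * real d * K * (1 + q))" using u by (intro sum_mono) auto
  also have "\<dots> = (1 + q) / \<epsilon>" by (simp add: \<epsilon>_def K_def)
  finally have "\<epsilon> * (\<Sum>i<d. \<bar>u i\<bar>) \<le> 1 + q"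
    using d K1 by (simp add: \<epsilon>_def K_def field_simps)
  moreover have "q \<le> real n * q" using n q(1) by (simp add: mult_le_cancel_right1)
  ultimately have "- real n * q \<le> 1 + (- \<epsilon> * (\<Sum>i<d. \<bar>u i\<bar>))" by linarith
  then have "exp (- real n * q) \<le> exp 1 * exp (- \<epsilon> * (\<Sum>i<d. \<bar>u i\<bar>))"
    by (simp add: exp_add[symmetric])
  also have "\<dots> = exp 1 * (\<Prod>i<d. exp (- \<epsilon> * \<bar>u i\<bar>))"
    by (simp only: sum_distrib_left exp_sum finite_lessThan)
  finally have "vol (\<lambda>i. v i) \<le> (3 * exp 1) ^ n * (exp 1 * (\<Prod>i<d. exp (- \<epsilon> * \<bar>u i\<bar>)))"
    unfolding q(2) by (intro mult_left_mono) auto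
  also have "\<dots> \<le> 9 ^ n * (3 * (\<Prod>i<d. exp (- \<epsilon> * \<bar>u i\<bar>)))"
  proof (intro mult_mono power_mono)
    show "3 * exp 1 \<le> (9::real)" using exp_le by simp
    show "exp 1 \<le> (3::real)" by (rule exp_le)
  qed (auto intro!: prod_nonneg mult_nonneg_nonneg)
  finally show ?thesis by (simp add: u_def mult_ac)
qed

text \<open>The decay is centred at a vector w of largest volume in V. Enlarging V to the product of
  its coordinate projections makes the sum factor over the coordinates.\<close>

lemma finite_sum_vol_le:
  fixes V :: "(nat \<Rightarrow> int) set"
  assumes V: "finite V" "V \<subseteq> {..<d} \<rightarrow>\<^sub>E UNIV" "\<And>v. v \<in> V \<Longrightarrow> admissible v"
  shows "(\<Sum>v\<in>V. vol (\<lambda>i. v i)) \<le> (real (volume_const n d))"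
proof (cases "V = {}")
  case True
  then show ?thesis by (simp add: volume_const_def)
next
  case False
  define \<epsilon> where "\<epsilon> = 1 / real (d * (9 * d * spread_const n d))"
  have \<epsilon>: "\<epsilon> > 0" using d spread_const_bounds(1) by (simp add: \<epsilon>_def)
  have "Max ((\<lambda>v. vol (\<lambda>i. v i)) ` V) \<in> (\<lambda>v. vol (\<lambda>i. v i)) ` V" using V(1) False by (intro Max_in) auto
  then obtain w where w: "w \<in> V" "vol (\<lambda>i. w i) = Max ((\<lambda>v. vol (\<lambda>i. v i)) ` V)" by auto
  have le: "vol (\<lambda>i. v i) \<le> vol (\<lambda>i. w i)" if "v \<in> V" for v
    unfolding w(2) using V(1) that by (intro Max_ge) auto
  define A where "A i = (\<lambda>v. v i) ` V" for i
  have A: "finite (A i)" for i using V(1) by (simp add: A_def)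
  have "(\<Sum>v\<in>V. vol (\<lambda>i. v i)) \<le> (\<Sum>v\<in>V. 3 * 9 ^ n * (\<Prod>i<d. exp (- \<epsilon> * \<bar>real_of_int (v i - w i)\<bar>)))"
    unfolding \<epsilon>_def using V(3) le w(1) by (intro sum_mono vol_decay) auto
  also have "\<dots> \<le> (\<Sum>v\<in>Pi\<^sub>E {..<d} A. 3 * 9 ^ n * (\<Prod>i<d. exp (- \<epsilon> * \<bar>real_of_int (v i - w i)\<bar>)))"
  proof (rule sum_mono2)
    show "V \<subseteq> Pi\<^sub>E {..<d} A" using V(2) by (auto simp: A_def PiE_iff)
  qed (use A in \<open>auto intro!: finite_PiE prod_nonneg mult_nonneg_nonneg\<close>)
  also have "\<dots> = 3 * 9 ^ n * (\<Prod>i<d. \<Sum>k\<in>A i. exp (- \<epsilon> * \<bar>real_of_int (k - w i)\<bar>))"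
    using A by (subst prod_sum_PiE) (auto simp: sum_distrib_left)
  also have "\<dots> \<le> 3 * 9 ^ n * (\<Prod>i<d. 1 + 2 / \<epsilon>)"
    using sum_exp_abs_le[OF \<epsilon> A] by (intro mult_left_mono prod_mono) (auto intro!: sum_nonneg)
  also have "\<dots> = (real (volume_const n d))" by (simp add: volume_const_def \<epsilon>_def)
  finally show ?thesis .
qed

section \<open>Covering the region by boxes\<close>

lemma unit_body_covered:
  assumes x: "x \<in> unit_body n d c" "\<And>i. i < d \<Longrightarrow> lin_form_real n (c i) x \<noteq> 0"
  shows "\<exists>v\<in>{..<d} \<rightarrow>\<^sub>E UNIV. admissible v \<and> x \<in> body (\<lambda>i. v i)"
proof
  let ?v = "\<lambda>i\<in>{..<d}. \<lceil>ln (cmod (lin_form_real n (c i) x))\<rceil>"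
  show "?v \<in> {..<d} \<rightarrow>\<^sub>E UNIV" by simp
  have "cmod (lin_form_real n (c i) x) \<le> exp (?v i)" if "i < d" for i
  proof -
    have "cmod (lin_form_real n (c i) x) = exp (ln (cmod (lin_form_real n (c i) x)))" using x(2)[OF that] by simp
    also have "\<dots> \<le> exp (?v i)" using that by simp
    finally show ?thesis .
  qed
  then show "admissible ?v \<and> x \<in> body (\<lambda>i. ?v i)"
    using x by (auto simp: admissible_def body_def form_body_def unit_body_def)
qed

text \<open>The bound for finite sums is uniform, so exhausting the admissible vectors by finite
  sets and using continuity from below suffices. Points where some form vanishes have no logarithm
  to round; they form a null set.\<close>

lemma unit_body_volume_le: "emeasure (real_space n) (unit_body n d c) \<le> ennreal (real (volume_const n d))"
proof -
  define V where "V N = {v \<in> {..<d} \<rightarrow>\<^sub>E {- int N..int N}. admissible v}" for N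
  define U where "U N = (\<Union>v\<in>V N. body (\<lambda>i. v i))" for N
  have finV: "finite (V N)" for N
    by (rule finite_subset[of _ "{..<d} \<rightarrow>\<^sub>E {- int N..int N}"]) (auto simp: V_def intro: finite_PiE)
  have body: "body v \<in> sets (real_space n)" for v by (simp add: body_def)
  have U: "U N \<in> sets (real_space n)" for N unfolding U_def using finV body by (intro sets.finite_UN) auto
  have UN: "emeasure (real_space n) (U N) \<le> ennreal (real (volume_const n d))" for N
  proof -
    have "emeasure (real_space n) (U N) \<le> (\<Sum>v\<in>V N. emeasure (real_space n) (body (\<lambda>i. v i)))"
      unfolding U_def using finV body by (intro emeasure_subadditive_finite) auto
    also have "\<dots> = ennreal (\<Sum>v\<in>V N. vol (\<lambda>i. v i))"
      unfolding emeasure_body using vol_pos by (intro sum_ennreal) (auto simp: less_imp_le)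
    also have "\<dots> \<le> ennreal (real (volume_const n d))"
      by (intro ennreal_leI finite_sum_vol_le finV) (auto simp: V_def PiE_iff extensional_def)
    finally show ?thesis .
  qed
  have inc: "incseq U"
  proof (rule incseq_SucI)
    fix N show "U N \<subseteq> U (Suc N)" unfolding U_def
      by (rule UN_mono) (force simp: V_def PiE_iff)+
  qed
  define H where "H i = {x \<in> space (real_space n). lin_form_real n (c i) x = 0}" for i
  have H: "H i \<in> sets (real_space n)" for i unfolding H_def by measurable
  have H0: "emeasure (real_space n) (\<Union>i\<in>{..<d}. H i) = 0"
  proof -
    have "emeasure (real_space n) (\<Union>i\<in>{..<d}. H i) \<le> (\<Sum>i\<in>{..<d}. emeasure (real_space n) (H i))"
      using H by (intro emeasure_subadditive_finite) auto
    also have "\<dots> = 0"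
    proof (intro sum.neutral ballI)
      fix i assume "i \<in> {..<d}"
      then obtain p where "p < n" "c i p \<noteq> 0" using nonzero by auto
      then show "emeasure (real_space n) (H i) = 0" unfolding H_def by (rule null_complex_hyperplane)
    qed
    finally show ?thesis by simp
  qed
  have "unit_body n d c \<subseteq> (\<Union>N. U N) \<union> (\<Union>i\<in>{..<d}. H i)"
  proof
    fix x assume x: "x \<in> unit_body n d c"
    show "x \<in> (\<Union>N. U N) \<union> (\<Union>i\<in>{..<d}. H i)"
    proof (cases "\<exists>i<d. lin_form_real n (c i) x = 0")
      case True
      then show ?thesis using x by (auto simp: H_def unit_body_def)
    next
      case False
      then obtain v where v: "v \<in> {..<d} \<rightarrow>\<^sub>E UNIV" "admissible v" "x \<in> body (\<lambda>i. v i)"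
        using unit_body_covered[OF x] by auto
      define N where "N = nat (\<Sum>i<d. \<bar>v i\<bar>)"
      have "\<bar>v i\<bar> \<le> int N" if "i < d" for i
        using that member_le_sum[of i "{..<d}" "\<lambda>i. \<bar>v i\<bar>"] by (auto simp: N_def)
      then have "v \<in> V N" using v by (auto simp: V_def PiE_iff abs_le_iff minus_le_iff)
      then have "x \<in> U N" using v(3) by (auto simp: U_def)
      then show ?thesis by auto
    qed
  qed
  then have "emeasure (real_space n) (unit_body n d c) \<le> emeasure (real_space n) ((\<Union>N. U N) \<union> (\<Union>i\<in>{..<d}. H i))"
    by (rule emeasure_mono) (use U H in auto)
  also have "\<dots> \<le> emeasure (real_space n) (\<Union>N. U N) + emeasure (real_space n) (\<Union>i\<in>{..<d}. H i)"
    by (rule emeasure_subadditive) (use U H in auto)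
  also have "\<dots> = (SUP N. emeasure (real_space n) (U N))"
    using SUP_emeasure_incseq[of U, OF _ inc] U by (simp add: H0 image_subset_iff)
  also have "\<dots> \<le> ennreal (real (volume_const n d))" by (rule SUP_least) (rule UN)
  finally show ?thesis .
qed

end

section \<open>Computability of the bound\<close>

lemma recursive_const: "recursive_fun (\<lambda>_. m)"
proof (induction m)
  case (Suc m)
  have "recursive_fun (\<lambda>xs. (\<lambda>xs. case xs of [] \<Rightarrow> 0 | x # _ \<Rightarrow> Suc x) (map (\<lambda>f. f xs) [\<lambda>_. m]))"
    by (rule recursive_fun.comp[OF recursive_fun.succ]) (use Suc in auto)
  then show ?case by simp
qed (rule recursive_fun.zero)

abbreviation arg :: "nat \<Rightarrow> nat list \<Rightarrow> nat" where
  "arg i xs \<equiv> (if i < length xs then xs ! i else 0)"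

lemma recursive_Suc:
  assumes "recursive_fun f"
  shows "recursive_fun (\<lambda>xs. Suc (f xs))"
proof -
  have "recursive_fun (\<lambda>xs. (\<lambda>xs. case xs of [] \<Rightarrow> 0 | x # _ \<Rightarrow> Suc x) (map (\<lambda>f. f xs) [f]))"
    by (rule recursive_fun.comp[OF recursive_fun.succ]) (use assms in auto)
  then show ?thesis by simp
qed

text \<open>Primitive recursion with one parameter, composed with its two arguments. The step
  function receives the list of accumulator, counter and parameter, which explains the projections 0
  and 2 used for the arithmetic operations.\<close>

lemma recursive_binary:
  assumes base: "recursive_fun b" and step: "recursive_fun s"
    and f: "recursive_fun f" and g: "recursive_fun g"
  shows "recursive_fun (\<lambda>xs. rec_nat (b [g xs]) (\<lambda>k r. s [r, k, g xs]) (f xs))"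
proof -
  have "recursive_fun (\<lambda>xs. (\<lambda>xs. case xs of [] \<Rightarrow> 0
      | x # ys \<Rightarrow> rec_nat (b ys) (\<lambda>k r. s (r # k # ys)) x) (map (\<lambda>f. f xs) [f, g]))"
    by (rule recursive_fun.comp[OF recursive_fun.prec[OF base step]]) (use f g in auto)
  then show ?thesis by simp
qed

lemma recursive_add:
  assumes "recursive_fun f" "recursive_fun g"
  shows "recursive_fun (\<lambda>xs. f xs + g xs)"
proof -
  have "rec_nat y (\<lambda>k r. Suc r) x = x + y" for x y :: nat by (induction x) auto
  then show ?thesis
    using recursive_binary[OF recursive_fun.proj[of 0] recursive_Suc[OF recursive_fun.proj[of 0]] assms] by simp
qed

lemma recursive_mult:
  assumes "recursive_fun f" "recursive_fun g"
  shows "recursive_fun (\<lambda>xs. f xs * g xs)"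
proof -
  have "rec_nat 0 (\<lambda>k r. r + y) x = x * y" for x y :: nat by (induction x) auto
  then show ?thesis
    using recursive_binary[OF recursive_fun.zero recursive_add[OF recursive_fun.proj[of 0] recursive_fun.proj[of 2]] assms] by simp
qed

lemma recursive_power:
  assumes "recursive_fun f" "recursive_fun g"
  shows "recursive_fun (\<lambda>xs. f xs ^ g xs)"
proof -
  have "rec_nat 1 (\<lambda>k r. r * y) x = y ^ x" for x y :: nat by (induction x) auto
  \<comment> \<open>The recursion runs over the exponent, so the two arguments are passed in swapped
    order.\<close>
  then show ?thesis
    using recursive_binary[OF recursive_const[of 1] recursive_mult[OF recursive_fun.proj[of 0] recursive_fun.proj[of 2]] assms(2,1)]
    by simp
qed

lemma computable_real2_of_nat:
  assumes "recursive_fun f" "\<And>n d k. f [n, d, k] = g n d"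
  shows "computable_real2 (\<lambda>n d. real (g n d))"
proof -
  \<comment> \<open>Argument 2 is the precision k: the numerator g n d (k + 1) over k + 1 gives the
    value without error.\<close>
  have "recursive_fun (\<lambda>xs. f xs * Suc (arg 2 xs))"
    by (intro recursive_mult recursive_Suc recursive_fun.proj assms)
  moreover have "recursive_fun (\<lambda>_. 0)" by (rule recursive_fun.zero)
  moreover have "\<bar>real (g n d) - (real (f [n, d, k] * Suc (arg 2 [n, d, k])) - real 0) / real (k + 1)\<bar> \<le> 1 / real (k + 1)" for n d k
    by (simp add: assms(2) field_simps)
  ultimately show ?thesis unfolding computable_real2_def by fast
qed

lemma computable_volume_const: "computable_real2 (\<lambda>n d. real (volume_const n d))"
proof (rule computable_real2_of_nat)
  show "recursive_fun (\<lambda>xs. volume_const (arg 0 xs) (arg 1 xs))"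
    unfolding volume_const_def spread_const_def
    by (intro recursive_mult recursive_add recursive_power recursive_const recursive_fun.proj)
qed simp

theorem theorem1:
  shows "\<exists>c :: nat \<Rightarrow> nat \<Rightarrow> real. computable_real2 c \<and>
    (\<forall>n d. n \<ge> 2 \<longrightarrow> d \<ge> 1 \<longrightarrow>
       c n d > 0 \<and>
       (\<forall>F :: int mpoly.
          decomposable_form n d F \<longrightarrow>
          form_volume n F < \<infinity> \<longrightarrow>
          (\<forall>x :: nat \<Rightarrow> int. (\<exists>i<n. x i \<noteq> 0) \<longrightarrow> eval_mpoly F x \<noteq> 0) \<longrightarrow>
          form_volume n F \<le> ennreal (c n d)))"
proof (intro exI[of _ "\<lambda>n d. real (volume_const n d)"] conjI allI impI)
  show "computable_real2 (\<lambda>n d. real (volume_const n d))" by (rule computable_volume_const)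
next
  fix n d :: nat
  have "0 < volume_const n d" by (simp add: volume_const_def)
  then show "0 < real (volume_const n d)" by simp
next
  fix n d :: nat and F :: "int mpoly"
  assume nd: "n \<ge> 2" "d \<ge> 1" and dec: "decomposable_form n d F" and fin: "form_volume n F < \<infinity>"
    and nonvanishing: "\<forall>x :: nat \<Rightarrow> int. (\<exists>i<n. x i \<noteq> 0) \<longrightarrow> eval_mpoly F x \<noteq> 0"
  show "form_volume n F \<le> ennreal (real (volume_const n d))"
  proof (rule decomposable_form_factors[OF dec])
    fix c :: "nat \<Rightarrow> nat \<Rightarrow> complex"
    assume nonzero: "\<And>i. i < d \<Longrightarrow> \<exists>j<n. c i j \<noteq> 0"
      and c: "\<And>x. eval_mpoly (of_int_mpoly F) x = (\<Prod>i<d. lin_form n (c i) x)"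
    have "\<bar>eval_mpoly (of_int_mpoly F) x\<bar> = cmod (\<Prod>i<d. lin_form_real n (c i) x)" for x
      unfolding c[symmetric] eval_of_int_mpoly_of_real by simp
    then have vol: "form_volume n F = emeasure (real_space n) (unit_body n d c)"
      by (simp add: form_volume_def unit_body_def real_space_def Let_def)
    show ?thesis
      unfolding vol
    proof (rule unit_body_volume_le[OF _ nd(2) nonzero c])
      show "1 \<le> n" using nd(1) by simp
      show "eval_mpoly F z \<noteq> 0" if "\<exists>i<n. z i \<noteq> 0" for z using nonvanishing that by blast
      show "emeasure (real_space n) (unit_body n d c) < \<infinity>" using fin vol by simp
    qed
  qed
qed

end
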